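(* For every $l\in\{\pm1,\ldots,\pm N\}$ and $\delta\in\{+,-\}$, the following identities of meromorphic functions of $(x,y)\in\mathbb{C}^N\times\mathbb{C}^N$ hold: $$\big(\mathcal{A}^+_{l,\delta}(x)-\mathcal{A}^+_{-l,\delta}(y)\big)S^+(x,y)=0,\qquad \big(\mathcal{A}^-_{l,\delta}(x)-\mathcal{A}^-_{-l,\delta}(y)\big)S^-(x,y)=0,$$ $$\big(H_{l,\delta}(x)-H_{-l,\delta}(y)\big)U(x)^{-1/2}U(y)^{-1/2}S^+(x,y)=0,\qquad \big(H_{l,\delta}(x)-H_{-l,\delta}(y)\big)U(x)^{1/2}U(y)^{1/2}S^-(x,y)=0,$$ where $$S^+(x,y)=\prod_{m=1}^N\frac{G_R(y_m-x_{m+1}-ia/2-\eta/2)}{G_L(y_m-x_m+ia/2+\eta/2)},\qquad S^-(x,y)=\prod_{m=1}^N\frac{G_L(y_m-x_m-ia/2+\eta/2)}{G_R(y_m-x_{m+1}+ia/2-\eta/2)}.$$ Furthermore, these identities still hold when $S^\pm(x,y)$ is replaced by $S^\pm(y,x)$ or by $S^\pm(\sigma(x),y)$, with $\sigma$ any cyclic permutation of the coordinates.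
   Context: Fix $a_+,a_->0$, $a=(a_++a_-)/2$, $\eta\in\mathbb{R}$. For $\delta\in\{+,-\}$, $-\delta$ denotes the opposite sign and $e_\delta(z)=\exp(\pi z/a_\delta)$. The hyperbolic gamma function $G(z)$ is the meromorphic function on $\mathbb{C}$ given for $|\mathrm{Im}\,z|<a$ by $G(z)=\exp\Big(i\int_0^\infty\frac{dy}{y}\Big(\frac{\sin(2yz)}{2\sinh(a_+y)\sinh(a_-y)}-\frac{z}{a_+a_-y}\Big)\Big)$, extended meromorphically. Put $\chi=\frac{\pi}{24}(a_+/a_-+a_-/a_+)$, $G_R(z)=G(z)\exp(i\chi+i\pi z^2/(2a_+a_-))$, $G_L(z)=G(z)\exp(-i\chi-i\pi z^2/(2a_+a_-))$. Periodic convention: indices mod $N$, i.e. $x_{N+1}=x_1$, $x_0=x_N$, and $m\pm1$ in conditions $m\pm1\notin I$ is read mod $N$. Let $T^\pm_\delta(z)=1+e_\delta(2z\pm ia_{-\delta}+2\eta)$. The operator $\exp(\mp ic\partial_{x_m})$ acts on meromorphic $f$ by $f(x)\mapsto f(x_1,\ldots,x_m\mp ic,\ldots,x_N)$. For $k=1,\ldots,N$ (sums over $I\subset\{1,\ldots,N\}$, $|I|=k$): $\mathcal{A}^+_{k,\delta}=\sum_I\prod_{m\in I,m+1\notin I}T^+_\delta(x_{m+1}-x_m)\prod_{m\in I}e^{-ia_{-\delta}\partial_{x_m}}$; $\mathcal{A}^+_{-k,\delta}=\sum_I\prod_{m\in I,m-1\notin I}T^+_\delta(x_m-x_{m-1})\prod_{m\in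 I}e^{ia_{-\delta}\partial_{x_m}}$; $\mathcal{A}^-_{k,\delta}=\sum_I\prod_{m\in I,m-1\notin I}T^-_\delta(x_m-x_{m-1})\prod_{m\in I}e^{-ia_{-\delta}\partial_{x_m}}$; $\mathcal{A}^-_{-k,\delta}=\sum_I\prod_{m\in I,m+1\notin I}T^-_\delta(x_{m+1}-x_m)\prod_{m\in I}e^{ia_{-\delta}\partial_{x_m}}$. Let $U(x)=\prod_{m=1}^N 1/G_L(x_{m+1}-x_m+\eta)$, let $U^{1/2}$ denote a square root of $U$, and $H_{l,\delta}(x)=U(x)^{1/2}\mathcal{A}^-_{l,\delta}(x)U(x)^{-1/2}$ $(=U(x)^{-1/2}\mathcal{A}^+_{l,\delta}(x)U(x)^{1/2})$. *)

theory Defs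
  imports "HOL-Complex_Analysis.Complex_Analysis"
begin

(* Parameters: ap = a_+, am = a_-, eta = \<eta>.  Sign \<delta> encoded as d :: bool (True = +).
   Points of C^N are functions x :: nat \<Rightarrow> complex, coordinates x 0, ..., x (N-1)
   (0-based; index m+1 is read as (m+1) mod N). *)

definition ahalf :: "real \<Rightarrow> real \<Rightarrow> real" where
  "ahalf ap am = (ap + am) / 2"

definition adelta :: "real \<Rightarrow> real \<Rightarrow> bool \<Rightarrow> real" where
  "adelta ap am d = (if d then ap else am)"

definition G_strip :: "real \<Rightarrow> real \<Rightarrow> complex \<Rightarrow> complex" where
  "G_strip ap am z = exp (\<i> * integral {0<..}
     (\<lambda>y::real. (1 / of_real y) *
        (sin (2 * of_real y * z) / (2 * of_real (sinh (ap * y) * sinh (am * y)))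
         - z / of_real (ap * am * y))))"

text \<open>Hyperbolic gamma function: the meromorphic extension to C of G_strip,
  normalised (nicely meromorphic: value 0 at poles, continuous elsewhere) so it is unique.\<close>
definition hypG :: "real \<Rightarrow> real \<Rightarrow> complex \<Rightarrow> complex" where
  "hypG ap am = (THE g. g nicely_meromorphic_on UNIV \<and>
      (\<forall>z. \<bar>Im z\<bar> < ahalf ap am \<longrightarrow> g z = G_strip ap am z))"

definition chi :: "real \<Rightarrow> real \<Rightarrow> real" where
  "chi ap am = pi / 24 * (ap / am + am / ap)"

definition G_R :: "real \<Rightarrow> real \<Rightarrow> complex \<Rightarrow> complex" where
  "G_R ap am z = hypG ap am z * exp (\<i> * of_real (chi ap am) + \<i> * of_real pi * z\<^sup>2 / of_real (2 * ap * am))"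

definition G_L :: "real \<Rightarrow> real \<Rightarrow> complex \<Rightarrow> complex" where
  "G_L ap am z = hypG ap am z * exp (- \<i> * of_real (chi ap am) - \<i> * of_real pi * z\<^sup>2 / of_real (2 * ap * am))"

definition Tfun :: "real \<Rightarrow> real \<Rightarrow> real \<Rightarrow> bool \<Rightarrow> bool \<Rightarrow> complex \<Rightarrow> complex" where
  "Tfun ap am eta d s z = 1 + exp (of_real pi *
      (2 * z + (if s then 1 else -1) * \<i> * of_real (adelta ap am (\<not> d)) + 2 * of_real eta)
      / of_real (adelta ap am d))"

definition nxt :: "nat \<Rightarrow> nat \<Rightarrow> nat" where "nxt N m = (m + 1) mod N"
definition prv :: "nat \<Rightarrow> nat \<Rightarrow> nat" where "prv N m = (m + N - 1) mod N"

definition shift :: "nat set \<Rightarrow> complex \<Rightarrow> (nat \<Rightarrow> complex) \<Rightarrow> (nat \<Rightarrow> complex)" where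
  "shift I c x = (\<lambda>m. if m \<in> I then x m + c else x m)"

definition subsets_k :: "nat \<Rightarrow> nat \<Rightarrow> nat set set" where
  "subsets_k N k = {I. I \<subseteq> {..<N} \<and> card I = k}"

definition Aplus :: "nat \<Rightarrow> real \<Rightarrow> real \<Rightarrow> real \<Rightarrow> bool \<Rightarrow> int \<Rightarrow>
    ((nat \<Rightarrow> complex) \<Rightarrow> complex) \<Rightarrow> (nat \<Rightarrow> complex) \<Rightarrow> complex" where
  "Aplus N ap am eta d l f x =
    (let c = \<i> * of_real (adelta ap am (\<not> d)) in
     if l > 0 then
       (\<Sum>I\<in>subsets_k N (nat l).
          (\<Prod>m\<in>{m\<in>I. nxt N m \<notin> I}. Tfun ap am eta d True (x (nxt N m) - x m))
          * f (shift I (- c) x))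
     else
       (\<Sum>I\<in>subsets_k N (nat (- l)).
          (\<Prod>m\<in>{m\<in>I. prv N m \<notin> I}. Tfun ap am eta d True (x m - x (prv N m)))
          * f (shift I c x)))"

definition Aminus :: "nat \<Rightarrow> real \<Rightarrow> real \<Rightarrow> real \<Rightarrow> bool \<Rightarrow> int \<Rightarrow>
    ((nat \<Rightarrow> complex) \<Rightarrow> complex) \<Rightarrow> (nat \<Rightarrow> complex) \<Rightarrow> complex" where
  "Aminus N ap am eta d l f x =
    (let c = \<i> * of_real (adelta ap am (\<not> d)) in
     if l > 0 then
       (\<Sum>I\<in>subsets_k N (nat l).
          (\<Prod>m\<in>{m\<in>I. prv N m \<notin> I}. Tfun ap am eta d False (x m - x (prv N m)))
          * f (shift I (- c) x))
     else
       (\<Sum>I\<in>subsets_k N (nat (- l)).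
          (\<Prod>m\<in>{m\<in>I. nxt N m \<notin> I}. Tfun ap am eta d False (x (nxt N m) - x m))
          * f (shift I c x)))"

definition Ufun :: "nat \<Rightarrow> real \<Rightarrow> real \<Rightarrow> real \<Rightarrow> (nat \<Rightarrow> complex) \<Rightarrow> complex" where
  "Ufun N ap am eta x = (\<Prod>m<N. 1 / G_L ap am (x (nxt N m) - x m + of_real eta))"

text \<open>H_{l,\<delta>} = U^{1/2} A^-_{l,\<delta>} U^{-1/2}, with sq a chosen square root of U.\<close>
definition Hop :: "((nat \<Rightarrow> complex) \<Rightarrow> complex) \<Rightarrow> nat \<Rightarrow> real \<Rightarrow> real \<Rightarrow> real \<Rightarrow> bool \<Rightarrow> int \<Rightarrow>
    ((nat \<Rightarrow> complex) \<Rightarrow> complex) \<Rightarrow> (nat \<Rightarrow> complex) \<Rightarrow> complex" where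
  "Hop sq N ap am eta d l f x = sq x * Aminus N ap am eta d l (\<lambda>x'. f x' / sq x') x"

definition Splus :: "nat \<Rightarrow> real \<Rightarrow> real \<Rightarrow> real \<Rightarrow> (nat \<Rightarrow> complex) \<Rightarrow> (nat \<Rightarrow> complex) \<Rightarrow> complex" where
  "Splus N ap am eta x y = (\<Prod>m<N.
     G_R ap am (y m - x (nxt N m) - \<i> * of_real (ahalf ap am) / 2 - of_real eta / 2)
     / G_L ap am (y m - x m + \<i> * of_real (ahalf ap am) / 2 + of_real eta / 2))"

definition Sminus :: "nat \<Rightarrow> real \<Rightarrow> real \<Rightarrow> real \<Rightarrow> (nat \<Rightarrow> complex) \<Rightarrow> (nat \<Rightarrow> complex) \<Rightarrow> complex" where
  "Sminus N ap am eta x y = (\<Prod>m<N.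
     G_L ap am (y m - x m - \<i> * of_real (ahalf ap am) / 2 + of_real eta / 2)
     / G_R ap am (y m - x (nxt N m) + \<i> * of_real (ahalf ap am) / 2 - of_real eta / 2))"

definition rot :: "nat \<Rightarrow> nat \<Rightarrow> (nat \<Rightarrow> complex) \<Rightarrow> (nat \<Rightarrow> complex)" where
  "rot N j x = (\<lambda>m. if m < N then x ((m + j) mod N) else x m)"

text \<open>An identity F = 0 of meromorphic functions of (x,y): F vanishes on an open dense set.\<close>
definition mero_zero :: "((nat \<Rightarrow> complex) \<times> (nat \<Rightarrow> complex) \<Rightarrow> complex) \<Rightarrow> bool" where
  "mero_zero F \<longleftrightarrow> (\<exists>D. open D \<and> closure D = UNIV \<and> (\<forall>p\<in>D. F p = 0))"

definition kernel_identities ::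
  "((nat \<Rightarrow> complex) \<Rightarrow> complex) \<Rightarrow> nat \<Rightarrow> real \<Rightarrow> real \<Rightarrow> real \<Rightarrow> bool \<Rightarrow> int \<Rightarrow>
   ((nat \<Rightarrow> complex) \<Rightarrow> (nat \<Rightarrow> complex) \<Rightarrow> complex) \<Rightarrow>
   ((nat \<Rightarrow> complex) \<Rightarrow> (nat \<Rightarrow> complex) \<Rightarrow> complex) \<Rightarrow> bool" where
  "kernel_identities sq N ap am eta d l Kp Km \<longleftrightarrow>
     mero_zero (\<lambda>(x, y). Aplus N ap am eta d l (\<lambda>x'. Kp x' y) x
                       - Aplus N ap am eta d (- l) (\<lambda>y'. Kp x y') y)
   \<and> mero_zero (\<lambda>(x, y). Aminus N ap am eta d l (\<lambda>x'. Km x' y) x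
                       - Aminus N ap am eta d (- l) (\<lambda>y'. Km x y') y)
   \<and> mero_zero (\<lambda>(x, y). Hop sq N ap am eta d l (\<lambda>x'. Kp x' y / (sq x' * sq y)) x
                       - Hop sq N ap am eta d (- l) (\<lambda>y'. Kp x y' / (sq x * sq y')) y)
   \<and> mero_zero (\<lambda>(x, y). Hop sq N ap am eta d l (\<lambda>x'. sq x' * sq y * Km x' y) x
                       - Hop sq N ap am eta d (- l) (\<lambda>y'. sq x * sq y' * Km x y') y)"

end

theory Submission
  imports Defs "HOL-Probability.Sinc_Integral" "HOL-Real_Asymp.Real_Asymp"
begin

text \<open>
  Write \<open>c = \<i> a\<^bsub>-\<delta>\<^esub>\<close> and \<open>e z = exp (\<pi> z / a\<^bsub>\<delta>\<^esub>)\<close>. The integral representation of \<open>G\<close> gives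
  \<open>G (- z) = 1 / G z\<close> and the difference equation \<open>G_L (w + c) = (1 + e (2 w + c)) * G_L w\<close>; the latter
  also yields the meromorphic continuation. By reflection, \<open>S\<^sup>+\<close> and \<open>S\<^sup>-\<close> are products of \<open>1 / G_L\<close> resp.
  \<open>G_L\<close> over the differences of neighbours in the cyclic sequence \<open>x\<^sub>1, y\<^sub>1, x\<^sub>2, y\<^sub>2, \<dots>\<close>. Dividing the
  kernel identity by the kernel leaves a rational identity in \<open>X\<^sub>m = e (2 x\<^sub>m)\<close> and \<open>V\<^sub>m \<propto> e (2 y\<^sub>m)\<close>
  between two sums over subsets of the cyclic index set. With a variable \<open>z\<close> marking cardinality, both
  sums are traces of products of \<open>2 \<times> 2\<close> transfer matrices \<open>L\<^sub>m\<close>, \<open>R\<^sub>m\<close>, and these are gauge equivalent: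
  \<open>L\<^sub>m C\<^sub>m\<^sub>+\<^sub>1 = C\<^sub>m R\<^sub>m\<close> with \<open>det C\<^sub>m \<noteq> 0\<close> for \<open>z \<noteq> -1\<close>. The identity for \<open>S\<^sup>-\<close> is the one for
  complementary index sets; negative \<open>l\<close>, the exchange of \<open>x\<close> and \<open>y\<close> and cyclic permutations follow
  from the cyclic symmetry of the kernels, and the identities for \<open>H\<close> from \<open>U A\<^sup>- U\<^sup>-\<^sup>1 = A\<^sup>+\<close>.
\<close>

section \<open>Transfer matrices and the rational identity\<close>

text \<open>Two obstacles shape the analytic half. \<open>hypG\<close> is a definite description, so
  nothing is known about it until existence and uniqueness of the continuation are proved; the value
  0 at poles is what makes uniqueness and reflection hold at every point. And the constant in the
  difference equation must be evaluated: the exponents at \<open>z + \<i> b / 2\<close> and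
  \<open>z - \<i> b / 2\<close> differ by an integral in which \<open>b\<close> cancels; on the real
  axis this integral, minus its value at 0, is a sum of Frullani integrals giving the logarithm of
  the infinite product for \<open>cosh\<close>.

  In the algebraic half the half-periods in the kernels matter: \<open>4 s\<close> exceeds the
  exponent shift in \<open>Tfun\<close> by one \<open>\<i> a\<close> of the same sign, which flips a
  sign and turns every coefficient into \<open>1 - t X' / X\<close> with \<open>t = e (4 s)\<close>.
  This is the form that the transfer matrices factor.

  For \<open>N = 1\<close> each coordinate is its own neighbour, so the differences inside
  \<open>U\<close> vanish identically and no generic condition can be imposed on them; the
  nonvanishing of \<open>G_L\<close> at the real point \<open>eta\<close> takes its place.\<close>

definition path_sum :: "(nat \<Rightarrow> bool \<Rightarrow> bool \<Rightarrow> complex) \<Rightarrow> nat \<Rightarrow> bool \<Rightarrow> bool \<Rightarrow> complex" where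
  "path_sum M n = rec_nat (\<lambda>i j. of_bool (i = j)) (\<lambda>n P i j. \<Sum>k\<in>UNIV. P i k * M n k j) n"

lemma path_sum_0: "path_sum M 0 i j = of_bool (i = j)"
  by (simp add: path_sum_def)

lemma path_sum_Suc: "path_sum M (Suc n) i j = (\<Sum>k\<in>UNIV. path_sum M n i k * M n k j)"
  by (simp add: path_sum_def)

text \<open>Expanding the product of the matrices \<open>M 0\<close>, ..., \<open>M (n - 1)\<close>
  gives a sum over sequences of \<open>n + 1\<close> Boolean indices. Such a sequence is the
  indicator of a subset of \<open>{..n}\<close>: index \<open>True\<close> at position
  \<open>m\<close> means \<open>m \<in> I\<close>.\<close>

lemma path_sum_eq_sum_subsets:
  "path_sum M n i j = (\<Sum>I | I \<subseteq> {..n} \<and> (0 \<in> I) = i \<and> (n \<in> I) = j.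
     \<Prod>m<n. M m (m \<in> I) (Suc m \<in> I))"
proof (induction n arbitrary: j)
  case 0
  have "{I. I \<subseteq> {..0::nat} \<and> (0 \<in> I) = i \<and> (0 \<in> I) = j} = (if i = j then {if i then {0} else {}} else {})"
    by auto
  then show ?case by (simp add: path_sum_0)
next
  case (Suc n)
  let ?A = "\<lambda>k. {I. I \<subseteq> {..n} \<and> (0 \<in> I) = i \<and> (n \<in> I) = k}"
  let ?B = "{I. I \<subseteq> {..Suc n} \<and> (0 \<in> I) = i \<and> (Suc n \<in> I) = j}"
  let ?f = "\<lambda>I. I \<union> (if j then {Suc n} else {})"
  have fin: "finite (?A k)" for k
    by (rule finite_subset[of _ "Pow {..n}"]) auto
  have "path_sum M (Suc n) i j = (\<Sum>k\<in>UNIV. \<Sum>I\<in>?A k. (\<Prod>m<n. M m (m \<in> I) (Suc m \<in> I)) * M n k j)"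
    by (simp add: path_sum_Suc Suc sum_distrib_right)
  also have "\<dots> = (\<Sum>k\<in>UNIV. \<Sum>I\<in>?A k. (\<Prod>m<Suc n. M m (m \<in> ?f I) (Suc m \<in> ?f I)))"
  proof (intro sum.cong refl)
    fix k I assume I: "I \<in> ?A k"
    then have "Suc n \<notin> I" by auto
    then have "(\<Prod>m<n. M m (m \<in> ?f I) (Suc m \<in> ?f I)) = (\<Prod>m<n. M m (m \<in> I) (Suc m \<in> I))"
      and "M n (n \<in> ?f I) (Suc n \<in> ?f I) = M n k j"
      using I by (auto intro!: prod.cong)
    then show "(\<Prod>m<n. M m (m \<in> I) (Suc m \<in> I)) * M n k j = (\<Prod>m<Suc n. M m (m \<in> ?f I) (Suc m \<in> ?f I))"
      by simp
  qed
  also have "\<dots> = (\<Sum>I\<in>(\<Union>k. ?A k). (\<Prod>m<Suc n. M m (m \<in> ?f I) (Suc m \<in> ?f I)))"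
    by (rule sum.UNION_disjoint[symmetric]) (use fin in auto)
  also have "\<dots> = (\<Sum>I\<in>?B. \<Prod>m<Suc n. M m (m \<in> I) (Suc m \<in> I))"
  proof (rule sum.reindex_bij_witness[of _ "\<lambda>I. I - {Suc n}" ?f])
    fix I assume "I \<in> (\<Union>k. ?A k)"
    then have I: "I \<subseteq> {..n}" "(0 \<in> I) = i" by auto
    then have "Suc n \<notin> I" by auto
    then show "?f I - {Suc n} = I" by auto
    show "?f I \<in> ?B" using I \<open>Suc n \<notin> I\<close> by (auto intro: le_SucI)
  next
    fix I assume I: "I \<in> ?B"
    then show "?f (I - {Suc n}) = I" by auto
    show "I - {Suc n} \<in> (\<Union>k. ?A k)" using I le_Suc_eq by fastforce
  qed auto
  finally show ?case .
qed

text \<open>Taking the trace makes membership of \<open>0\<close> and of \<open>N\<close> agree.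
  This identifies \<open>N\<close> with \<open>0\<close> and closes the path to a cycle, whence
  \<open>nxt\<close> instead of \<open>Suc\<close>.\<close>

lemma path_sum_trace:
  assumes "N > 0"
  shows "path_sum M N True True + path_sum M N False False =
     (\<Sum>I\<in>Pow {..<N}. \<Prod>m<N. M m (m \<in> I) (nxt N m \<in> I))"
proof -
  let ?A = "\<lambda>k. {I. I \<subseteq> {..N} \<and> (0 \<in> I) = k \<and> (N \<in> I) = k}"
  have fin: "finite (?A k)" for k
    by (rule finite_subset[of _ "Pow {..N}"]) auto
  have "path_sum M N True True + path_sum M N False False
     = (\<Sum>k\<in>UNIV. \<Sum>I\<in>?A k. \<Prod>m<N. M m (m \<in> I) (Suc m \<in> I))"
    by (simp add: path_sum_eq_sum_subsets UNIV_bool add.commute)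
  also have "\<dots> = (\<Sum>I\<in>(\<Union>k. ?A k). \<Prod>m<N. M m (m \<in> I) (Suc m \<in> I))"
    by (rule sum.UNION_disjoint[symmetric]) (use fin in auto)
  also have "\<dots> = (\<Sum>I\<in>Pow {..<N}. \<Prod>m<N. M m (m \<in> I) (nxt N m \<in> I))"
  proof (rule sum.reindex_bij_witness[of _ "\<lambda>I. I \<union> (if 0 \<in> I then {N} else {})" "\<lambda>I. I - {N}"])
    fix I assume I: "I \<in> (\<Union>k. ?A k)"
    have "(0 \<in> I - {N}) \<longleftrightarrow> N \<in> I" using I assms by auto
    then show "I - {N} \<union> (if 0 \<in> I - {N} then {N} else {}) = I" by auto
    show "I - {N} \<in> Pow {..<N}" using I by (auto simp: subset_iff le_less)
    show "(\<Prod>m<N. M m (m \<in> I - {N}) (nxt N m \<in> I - {N})) = (\<Prod>m<N. M m (m \<in> I) (Suc m \<in> I))"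
    proof (rule prod.cong)
      fix m assume m: "m \<in> {..<N}"
      have "(nxt N m \<in> I - {N}) = (Suc m \<in> I)"
        using m I assms by (cases "Suc m = N") (auto simp: nxt_def)
      then show "M m (m \<in> I - {N}) (nxt N m \<in> I - {N}) = M m (m \<in> I) (Suc m \<in> I)"
        using m by auto
    qed simp
  next
    fix I assume I: "I \<in> Pow {..<N}"
    then have "N \<notin> I" by auto
    then show "I \<union> (if 0 \<in> I then {N} else {}) - {N} = I" by auto
    show "I \<union> (if 0 \<in> I then {N} else {}) \<in> (\<Union>k. ?A k)" using I \<open>N \<notin> I\<close> assms by (auto simp: subset_iff)
  qed
  finally show ?thesis .
qed

lemma path_sum_intertwine:
  assumes "\<And>m i j. m < n \<Longrightarrow> (\<Sum>k\<in>UNIV. L m i k * C (Suc m) k j) = (\<Sum>k\<in>UNIV. C m i k * R m k j)"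
  shows "(\<Sum>k\<in>UNIV. path_sum L n i k * C n k j) = (\<Sum>k\<in>UNIV. C 0 i k * path_sum R n k j)"
  using assms
proof (induction n arbitrary: j)
  case 0
  then show ?case by (cases i; cases j) (simp_all add: path_sum_0 UNIV_bool)
next
  case (Suc n)
  have "(\<Sum>k\<in>UNIV. path_sum L (Suc n) i k * C (Suc n) k j) =
     (\<Sum>h\<in>UNIV. path_sum L n i h * (\<Sum>k\<in>UNIV. L n h k * C (Suc n) k j))"
    by (simp add: path_sum_Suc UNIV_bool algebra_simps)
  also have "\<dots> = (\<Sum>h\<in>UNIV. (\<Sum>k\<in>UNIV. path_sum L n i k * C n k h) * R n h j)"
    using Suc.prems by (simp add: UNIV_bool algebra_simps)
  also have "\<dots> = (\<Sum>k\<in>UNIV. C 0 i k * path_sum R (Suc n) k j)"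
    using Suc.IH Suc.prems by (simp add: path_sum_Suc UNIV_bool algebra_simps)
  finally show ?case .
qed

text \<open>Similarity invariance of the trace; multiplying by the determinant and expanding with
  the adjugate of \<open>C\<close> avoids inverse matrices.\<close>

lemma trace_eq_of_intertwine:
  fixes P Q C :: "bool \<Rightarrow> bool \<Rightarrow> complex"
  assumes PC: "\<And>i j. (\<Sum>k\<in>UNIV. P i k * C k j) = (\<Sum>k\<in>UNIV. C i k * Q k j)"
  assumes det: "C False False * C True True - C False True * C True False \<noteq> 0"
  shows "P True True + P False False = Q True True + Q False False"
proof -
  let ?d = "C False False * C True True - C False True * C True False"
  have "(P True True + P False False) * ?d =
    (P True True * C True True + P True False * C False True) * C False False
    - (P True True * C True False + P True False * C False False) * C False True
    - (P False True * C True True + P False False * C False True) * C True False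
    + (P False True * C True False + P False False * C False False) * C True True"
    by (simp add: algebra_simps)
  also have "\<dots> = (Q True True + Q False False) * ?d"
    using PC[of True True] PC[of True False] PC[of False True] PC[of False False]
    by (simp add: UNIV_bool add.commute) (simp add: algebra_simps)
  finally show ?thesis using det by simp
qed

lemma cyclic_sum_eq_of_intertwine:
  fixes L R C :: "nat \<Rightarrow> bool \<Rightarrow> bool \<Rightarrow> complex"
  assumes "N > 0"
    and "\<And>m i j. m < N \<Longrightarrow> (\<Sum>k\<in>UNIV. L m i k * C (nxt N m) k j) = (\<Sum>k\<in>UNIV. C m i k * R m k j)"
    and "C 0 False False * C 0 True True - C 0 False True * C 0 True False \<noteq> 0"
  shows "(\<Sum>I\<in>Pow {..<N}. \<Prod>m<N. L m (m \<in> I) (nxt N m \<in> I)) =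
         (\<Sum>I\<in>Pow {..<N}. \<Prod>m<N. R m (m \<in> I) (nxt N m \<in> I))"
proof -
  \<comment> \<open>Reading the index of \<open>C\<close> modulo \<open>N\<close> makes the last
    gauge matrix equal to \<open>C 0\<close>, so the two full products become similar.\<close>
  have "(\<Sum>k\<in>UNIV. path_sum L N i k * C (N mod N) k j) = (\<Sum>k\<in>UNIV. C (0 mod N) i k * path_sum R N k j)" for i j
    by (rule path_sum_intertwine[where C = "\<lambda>m. C (m mod N)"]) (use assms(2) in \<open>simp add: nxt_def\<close>)
  then show ?thesis
    using trace_eq_of_intertwine[of "path_sum L N" "C 0" "path_sum R N"] assms
    by (simp add: path_sum_trace)
qed

section \<open>Neighbours on the cycle and extraction of coefficients\<close>

lemma nxt_prv: "m < N \<Longrightarrow> nxt N (prv N m) = m"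
  by (cases m) (auto simp: nxt_def prv_def)

lemma prv_nxt: "m < N \<Longrightarrow> prv N (nxt N m) = m"
  by (cases "Suc m = N") (auto simp: nxt_def prv_def)

lemma nxt_less: "m < N \<Longrightarrow> nxt N m < N" and prv_less: "m < N \<Longrightarrow> prv N m < N"
  by (auto simp: nxt_def prv_def)

lemma bij_betw_nxt: "bij_betw (nxt N) {..<N} {..<N}"
  by (rule bij_betw_byWitness[where f' = "prv N"]) (auto simp: nxt_prv prv_nxt nxt_less prv_less)

lemma prod_nxt: "(\<Prod>m<N. f (nxt N m)) = (\<Prod>m<N. f m)"
  by (rule prod.reindex_bij_betw[OF bij_betw_nxt])

lemma prod_set_if:
  assumes "I \<subseteq> {..<N::nat}"
  shows "(\<Prod>m\<in>{m\<in>I. P m}. f m) = (\<Prod>m<N. if m \<in> I \<and> P m then f m else (1::complex))"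
proof -
  have "(\<Prod>m<N. if m \<in> I \<and> P m then f m else 1) = (\<Prod>m\<in>{m\<in>{..<N}. m \<in> I \<and> P m}. f m)"
    by (rule prod.inter_filter[symmetric]) simp
  also have "{m\<in>{..<N}. m \<in> I \<and> P m} = {m\<in>I. P m}" using assms by auto
  finally show ?thesis by simp
qed

lemma prod_subset_if:
  assumes "I \<subseteq> {..<N::nat}"
  shows "(\<Prod>m\<in>I. f m) = (\<Prod>m<N. if m \<in> I then f m else (1::complex))"
  using prod_set_if[OF assms, where P = "\<lambda>_. True" and f = f] by simp

text \<open>Two polynomials in \<open>z\<close> that agree off one point are equal, so a degenerate
  gauge matrix at \<open>z = -1\<close> does no harm.\<close>

lemma coeffs_eq_of_card_generating:
  fixes f g :: "nat set \<Rightarrow> complex"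
  assumes "\<And>z. z \<noteq> -1 \<Longrightarrow> (\<Sum>I\<in>Pow {..<N}. z ^ card I * f I) = (\<Sum>I\<in>Pow {..<N}. z ^ card I * g I)"
  shows "(\<Sum>I\<in>subsets_k N k. f I) = (\<Sum>I\<in>subsets_k N k. g I)"
proof -
  define P where "P = (\<lambda>h :: nat set \<Rightarrow> complex. \<Sum>I\<in>Pow {..<N}. monom (h I) (card I))"
  have fin: "finite (Pow {..<N})" by simp
  have "poly (P f - P g) z = 0" if "z \<noteq> -1" for z
    using assms[OF that] by (simp add: P_def poly_sum poly_monom mult.commute)
  then have "UNIV - {-1} \<subseteq> {z. poly (P f - P g) z = 0}" by auto
  moreover have "infinite (UNIV - {-1 :: complex})"
    by (simp add: infinite_UNIV_char_0)
  ultimately have "P f - P g = 0"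
    using poly_roots_finite[of "P f - P g"] finite_subset by blast
  then have "coeff (P f) k = coeff (P g) k" by simp
  moreover have "coeff (P h) k = (\<Sum>I\<in>subsets_k N k. h I)" for h
  proof -
    have "coeff (P h) k = (\<Sum>I\<in>Pow {..<N}. if card I = k then h I else 0)"
      by (simp add: P_def coeff_sum)
    also have "\<dots> = (\<Sum>I\<in>{I\<in>Pow {..<N}. card I = k}. h I)"
      by (rule sum.inter_filter[symmetric]) simp
    also have "{I\<in>Pow {..<N}. card I = k} = subsets_k N k"
      by (auto simp: subsets_k_def)
    finally show ?thesis .
  qed
  ultimately show ?thesis by simp
qed

text \<open>\<open>XV\<close> keeps the denominators of the weights away from 0; \<open>VX\<close>
  keeps the determinant of the gauge matrix away from 0.\<close>

lemma toda_kernel_rational_identity: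
  fixes X V :: "nat \<Rightarrow> complex" and t :: complex
  assumes N: "N > 0"
    and X: "\<And>m. X m \<noteq> 0" and V: "\<And>m. V m \<noteq> 0"
    and XV: "\<And>m. m < N \<Longrightarrow> X m + V m \<noteq> 0"
    and VX: "\<And>m. m < N \<Longrightarrow> V m + t * X (nxt N m) \<noteq> 0"
  shows "(\<Sum>I\<in>subsets_k N k. (\<Prod>m\<in>{m\<in>I. nxt N m \<notin> I}. 1 - t * X (nxt N m) / X m) *
            (\<Prod>m\<in>I. (1 + t * X m / V (prv N m)) / (1 + V m / X m)))
       = (\<Sum>I\<in>subsets_k N k. (\<Prod>m\<in>{m\<in>I. prv N m \<notin> I}. 1 - t * V m / V (prv N m)) *
            (\<Prod>m\<in>I. (1 + t * X (nxt N m) / V m) / (1 + V m / X m)))"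
proof (rule coeffs_eq_of_card_generating)
  fix z :: complex assume z: "z \<noteq> -1"
  define w where "w = (\<lambda>m. (1 + t * X m / V (prv N m)) / (1 + V m / X m))"
  define w' where "w' = (\<lambda>m. (1 + t * X (nxt N m) / V m) / (1 + V m / X m))"
  define L :: "nat \<Rightarrow> bool \<Rightarrow> bool \<Rightarrow> complex" where
    "L = (\<lambda>m i j. if i then z * w m * (if j then 1 else 1 - t * X (nxt N m) / X m) else 1)"
  define R :: "nat \<Rightarrow> bool \<Rightarrow> bool \<Rightarrow> complex" where
    "R = (\<lambda>m i j. (if i then z * w' m else 1) * (if j \<and> \<not> i then 1 - t * V (nxt N m) / V m else 1))"
  \<comment> \<open>With \<open>u = V m / X m\<close> and
    \<open>A = 1 + t * X m / V (prv N m)\<close> the rows are \<open>(1, 1 + u)\<close> and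
    \<open>(z * A, (z - u) * A)\<close>, columns ordered \<open>False\<close>, \<open>True\<close>;
    the determinant is \<open>- (1 + z) * u * A\<close>.\<close>
  define C :: "nat \<Rightarrow> bool \<Rightarrow> bool \<Rightarrow> complex" where
    "C = (\<lambda>m i j. if i then z * (1 + t * X m / V (prv N m)) - (if j then V m / X m + t * V m / V (prv N m) else 0)
                  else (if j then 1 + V m / X m else 1))"
  have card_if: "z ^ card I = (\<Prod>m<N. if m \<in> I then z else 1)" if "I \<subseteq> {..<N}" for I
    using prod_subset_if[OF that, where f = "\<lambda>_. z"] by simp
  have lhs: "z ^ card I * ((\<Prod>m\<in>{m\<in>I. nxt N m \<notin> I}. 1 - t * X (nxt N m) / X m) * (\<Prod>m\<in>I. w m))
      = (\<Prod>m<N. L m (m \<in> I) (nxt N m \<in> I))" if I: "I \<in> Pow {..<N}" for I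
    using I by (auto simp: card_if prod_set_if prod_subset_if L_def simp flip: prod.distrib intro!: prod.cong)
  have rhs: "z ^ card I * ((\<Prod>m\<in>{m\<in>I. prv N m \<notin> I}. 1 - t * V m / V (prv N m)) * (\<Prod>m\<in>I. w' m))
      = (\<Prod>m<N. R m (m \<in> I) (nxt N m \<in> I))" if I: "I \<in> Pow {..<N}" for I
  proof -
    have "(\<Prod>m\<in>{m\<in>I. prv N m \<notin> I}. 1 - t * V m / V (prv N m))
       = (\<Prod>m<N. if m \<in> I \<and> prv N m \<notin> I then 1 - t * V m / V (prv N m) else 1)"
      using I by (intro prod_set_if) auto
    \<comment> \<open>A transfer matrix at \<open>m\<close> sees only the memberships of
      \<open>m\<close> and \<open>nxt N m\<close>. The factor attached to \<open>m\<close> with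
      \<open>prv N m \<notin> I\<close> is therefore moved to the left end of its link.\<close>
    also have "\<dots> = (\<Prod>m<N. if nxt N m \<in> I \<and> m \<notin> I then 1 - t * V (nxt N m) / V m else 1)"
      by (subst prod_nxt[symmetric]) (auto simp: prv_nxt intro!: prod.cong)
    finally show ?thesis
      using I by (auto simp: card_if prod_subset_if R_def simp flip: prod.distrib intro!: prod.cong)
  qed
  have "(\<Sum>I\<in>Pow {..<N}. \<Prod>m<N. L m (m \<in> I) (nxt N m \<in> I)) =
         (\<Sum>I\<in>Pow {..<N}. \<Prod>m<N. R m (m \<in> I) (nxt N m \<in> I))"
  proof (rule cyclic_sum_eq_of_intertwine[where C = C])
    fix m i j assume m: "m < N"
    \<comment> \<open>In these variables \<open>t * X (nxt N m) / X m = u * (B - 1)\<close> and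
      \<open>t * V (nxt N m) / V m = u' * (B - 1)\<close>, so that the gauge relation becomes a
      polynomial identity in \<open>u\<close>, \<open>u'\<close>, \<open>w\<close>,
      \<open>w'\<close> and \<open>z\<close>.\<close>
    define u u' A B where "u = V m / X m" and "u' = V (nxt N m) / X (nxt N m)"
      and "A = 1 + t * X m / V (prv N m)" and "B = 1 + t * X (nxt N m) / V m"
    have "1 + u \<noteq> 0"
      using XV[OF m] X[of m] by (simp add: u_def divide_simps)
    then have A: "A = w m * (1 + u)" and B: "B = w' m * (1 + u)"
      by (simp_all add: A_def B_def u_def w_def w'_def)
    have L': "L m = (\<lambda>i j. if i then z * w m * (if j then 1 else 1 - u * (B - 1)) else 1)"
      using V[of m] by (auto simp: L_def u_def B_def fun_eq_iff)
    have R': "R m = (\<lambda>i j. (if i then z * w' m else 1) * (if j \<and> \<not> i then 1 - u' * (B - 1) else 1))"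
      using X[of "nxt N m"] by (auto simp: R_def u'_def B_def fun_eq_iff)
    have "V m / X m + t * V m / V (prv N m) = u * A"
      using X[of m] by (simp add: u_def A_def algebra_simps)
    then have C': "C m = (\<lambda>i j. if i then z * A - (if j then u * A else 0) else (if j then 1 + u else 1))"
      by (auto simp: C_def u_def A_def fun_eq_iff)
    have "V (nxt N m) / X (nxt N m) + t * V (nxt N m) / V m = u' * B"
      using X[of "nxt N m"] by (simp add: u'_def B_def algebra_simps)
    then have C'': "C (nxt N m) = (\<lambda>i j. if i then z * B - (if j then u' * B else 0) else (if j then 1 + u' else 1))"
      using m by (auto simp: C_def u'_def B_def fun_eq_iff prv_nxt)
    show "(\<Sum>k\<in>UNIV. L m i k * C (nxt N m) k j) = (\<Sum>k\<in>UNIV. C m i k * R m k j)"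
      unfolding L' R' C' C'' A B by (cases i; cases j) (simp_all add: UNIV_bool algebra_simps)
  next
    define u A where "u = V 0 / X 0" and "A = 1 + t * X 0 / V (prv N 0)"
    have "V 0 / X 0 + t * V 0 / V (prv N 0) = u * A"
      using X[of 0] by (simp add: u_def A_def algebra_simps)
    then have "C 0 False False * C 0 True True - C 0 False True * C 0 True False = - (1 + z) * u * A"
      by (simp add: C_def flip: u_def A_def) (simp add: algebra_simps)
    moreover have "A \<noteq> 0"
      using VX[of "prv N 0"] N V[of "prv N 0"] by (simp add: A_def nxt_prv prv_less divide_simps)
    moreover have "u \<noteq> 0" using X[of 0] V[of 0] by (simp add: u_def)
    moreover have "- (1 + z) \<noteq> 0" using z by (metis add_eq_0_iff neg_equal_0_iff_equal)
    ultimately show "C 0 False False * C 0 True True - C 0 False True * C 0 True False \<noteq> 0"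
      by (simp only: mult_eq_0_iff) auto
  qed (rule N)
  then have "(\<Sum>I\<in>Pow {..<N}. z ^ card I * ((\<Prod>m\<in>{m\<in>I. nxt N m \<notin> I}. 1 - t * X (nxt N m) / X m) * (\<Prod>m\<in>I. w m)))
       = (\<Sum>I\<in>Pow {..<N}. z ^ card I * ((\<Prod>m\<in>{m\<in>I. prv N m \<notin> I}. 1 - t * V m / V (prv N m)) * (\<Prod>m\<in>I. w' m)))"
    by (intro trans[OF sum.cong[OF refl lhs] trans[OF _ sum.cong[OF refl rhs, symmetric]]])
  then show "(\<Sum>I\<in>Pow {..<N}. z ^ card I * ((\<Prod>m\<in>{m\<in>I. nxt N m \<notin> I}. 1 - t * X (nxt N m) / X m) *
            (\<Prod>m\<in>I. (1 + t * X m / V (prv N m)) / (1 + V m / X m))))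
       = (\<Sum>I\<in>Pow {..<N}. z ^ card I * ((\<Prod>m\<in>{m\<in>I. prv N m \<notin> I}. 1 - t * V m / V (prv N m)) *
            (\<Prod>m\<in>I. (1 + t * X (nxt N m) / V m) / (1 + V m / X m))))"
    unfolding w_def w'_def .
qed

section \<open>Generic points\<close>

text \<open>The condition of \<open>mero_zero\<close> freed from equations, so that identities and
  regularity conditions can be intersected.\<close>

definition generic :: "('a::topological_space \<Rightarrow> bool) \<Rightarrow> bool" where
  "generic P \<longleftrightarrow> (\<exists>D. open D \<and> closure D = UNIV \<and> (\<forall>p\<in>D. P p))"

lemma mero_zero_iff_generic: "mero_zero F \<longleftrightarrow> generic (\<lambda>p. F p = 0)"
  by (simp add: mero_zero_def generic_def)

lemma generic_mono: "generic P \<Longrightarrow> (\<And>p. P p \<Longrightarrow> Q p) \<Longrightarrow> generic Q"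
  unfolding generic_def by blast

lemma generic_True: "generic (\<lambda>_. True)"
  unfolding generic_def by (intro exI[of _ UNIV]) auto

lemma generic_conj:
  assumes "generic P" "generic Q"
  shows "generic (\<lambda>p. P p \<and> Q p)"
proof -
  obtain D E where D: "open D" "closure D = UNIV" "\<forall>p\<in>D. P p"
    and E: "open E" "closure E = UNIV" "\<forall>p\<in>E. Q p"
    using assms unfolding generic_def by blast
  have "closure (D \<inter> E) = UNIV"
  proof -
    have "D \<inter> E \<inter> U \<noteq> {}" if "open U" "U \<noteq> {}" for U
    proof -
      have "E \<inter> U \<noteq> {}"
        using that E(2) open_Int_closure_eq_empty[of U E] by (auto simp: Int_commute)
      then show ?thesis
        using D(2) that E(1) open_Int_closure_eq_empty[of "E \<inter> U" D] by (auto simp: Int_ac)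
    qed
    from this[of "- closure (D \<inter> E)"] have "- closure (D \<inter> E) = {}"
      using closure_subset[of "D \<inter> E"] by (auto simp: open_Compl)
    then show ?thesis by auto
  qed
  then show ?thesis
    unfolding generic_def using D E by (intro exI[of _ "D \<inter> E"]) auto
qed

lemma generic_Ball:
  assumes "finite A" "\<And>a. a \<in> A \<Longrightarrow> generic (P a)"
  shows "generic (\<lambda>p. \<forall>a\<in>A. P a p)"
  using assms by (induction A rule: finite_induct) (auto intro: generic_True generic_conj)

lemma generic_compose_homeomorphism:
  assumes "generic P" "continuous_on UNIV h" "continuous_on UNIV h'" "\<And>q. h (h' q) = q"
    and "\<And>q. h' (h q) = q"
  shows "generic (\<lambda>p. P (h p))"
proof -
  obtain D where D: "open D" "closure D = UNIV" "\<forall>p\<in>D. P p"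
    using assms(1) unfolding generic_def by blast
  have "x \<in> closure (h -` D)" for x
    unfolding closure_iff_nhds_not_empty
  proof (intro allI impI)
    fix A U assume U: "U \<subseteq> A" "open U" "x \<in> U"
    have "open (h' -` U)" using assms(3) U by (intro open_vimage) auto
    moreover have "h x \<in> h' -` U" using U assms(5) by auto
    ultimately have "D \<inter> h' -` U \<noteq> {}"
      using D(2) open_Int_closure_eq_empty[of "h' -` U" D] by (auto simp: Int_commute)
    then obtain q where "q \<in> D" "h' q \<in> U" by auto
    then show "h -` D \<inter> A \<noteq> {}" using assms(4) U by auto
  qed
  moreover have "open (h -` D)" using assms(2) D by (intro open_vimage) auto
  ultimately show ?thesis
    unfolding generic_def using D(3) by (intro exI[of _ "h -` D"]) auto
qed

text \<open>The exceptional set is sparse, hence closed, which gives openness. For density, moving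
  along \<open>\<gamma> p\<close> changes \<open>f p\<close> by exactly \<open>t\<close>, and
  \<open>P\<close> holds at \<open>f p + t\<close> for all small \<open>t \<noteq> 0\<close>, so
  good points accumulate at \<open>p\<close>.\<close>

lemma generic_cosparse:
  assumes P: "eventually P (cosparse (UNIV :: complex set))"
    and f: "continuous_on UNIV f"
    and \<gamma>: "\<And>p. continuous_on UNIV (\<gamma> p)" "\<And>p. \<gamma> p 0 = p" "\<And>p t. f (\<gamma> p t) = f p + t"
  shows "generic (\<lambda>p. P (f p))"
proof -
  let ?B = "{w. \<not> P w}"
  have sp: "?B sparse_in UNIV" using P by (simp add: eventually_cosparse)
  have "closed ?B"
    using sp by (rule sparse_in_UNIV_imp_closed)
  then have "open (f -` (- ?B))"
    using f by (intro open_vimage) auto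
  moreover have "x \<in> closure (f -` (- ?B))" for x
    unfolding closure_iff_nhds_not_empty
  proof (intro allI impI)
    fix A U assume U: "U \<subseteq> A" "open U" "x \<in> U"
    have "open (\<gamma> x -` U)" using \<gamma>(1) U by (intro open_vimage) auto
    then have "eventually (\<lambda>t. t \<in> \<gamma> x -` U) (at 0)"
      using U \<gamma>(2)[of x] by (auto simp: eventually_at_topological)
    moreover have "eventually (\<lambda>t. P (f x + t)) (at 0)"
      using eventually_cosparse_imp_eventually_at[OF P, of "f x" UNIV]
      by (simp add: at_to_0[of "f x"] eventually_filtermap add.commute)
    ultimately have "eventually (\<lambda>t. t \<in> \<gamma> x -` U \<and> P (f x + t)) (at 0)"
      by (rule eventually_conj)
    then obtain t where "\<gamma> x t \<in> U" "P (f x + t)"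
      using eventually_happens by fastforce
    then have "\<gamma> x t \<in> f -` (- ?B) \<inter> A" using \<gamma>(3) U by auto
    then show "f -` (- ?B) \<inter> A \<noteq> {}" by blast
  qed
  ultimately show ?thesis
    unfolding generic_def by (intro exI[of _ "f -` (- ?B)"]) auto
qed

lemma continuous_on_fun_upd_add:
  "continuous_on UNIV (\<lambda>t. (x :: nat \<Rightarrow> complex)(i := x i + t))"
proof (rule continuous_on_coordinatewise_then_product)
  show "continuous_on UNIV (\<lambda>t. (x(i := x i + t)) k)" for k
    by (cases "k = i") (auto intro!: continuous_intros)
qed

lemma continuous_on_coordinate:
  "continuous_on UNIV (\<lambda>p :: ('i \<Rightarrow> 'a::topological_space) \<times> 'b::topological_space. fst p i)"
  "continuous_on UNIV (\<lambda>p :: 'b \<times> ('i \<Rightarrow> 'a). snd p i)"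
  by (rule continuous_on_compose2[OF continuous_on_product_coordinates[of i]],
      rule continuous_on_fst[OF continuous_on_id], simp)
     (rule continuous_on_compose2[OF continuous_on_product_coordinates[of i]],
      rule continuous_on_snd[OF continuous_on_id], simp)

text \<open>Moving the single coordinate \<open>i\<close> moves the argument. With
  \<open>i = j\<close> the argument would be the constant \<open>k\<close>, which is the situation
  of the cycle of length 1.\<close>

lemma generic_diff_fst:
  assumes "eventually P (cosparse (UNIV :: complex set))" "i \<noteq> j"
  shows "generic (\<lambda>(x :: nat \<Rightarrow> complex, y :: nat \<Rightarrow> complex). P (x i - x j + k))"
proof -
  have "generic (\<lambda>p :: (nat \<Rightarrow> complex) \<times> (nat \<Rightarrow> complex). P (fst p i - fst p j + k))"
  proof (rule generic_cosparse[OF assms(1), where \<gamma> = "\<lambda>p t. ((fst p)(i := fst p i + t), snd p)"])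
    show "continuous_on UNIV (\<lambda>p :: (nat \<Rightarrow> complex) \<times> (nat \<Rightarrow> complex). fst p i - fst p j + k)"
      by (intro continuous_on_add continuous_on_diff continuous_on_const continuous_on_coordinate)
    show "continuous_on UNIV (\<lambda>t. ((fst p)(i := fst p i + t), snd p))" for p :: "(nat \<Rightarrow> complex) \<times> (nat \<Rightarrow> complex)"
      by (intro continuous_on_Pair continuous_on_const continuous_on_fun_upd_add)
  qed (use assms(2) in auto)
  then show ?thesis by (simp add: case_prod_unfold)
qed

lemma generic_diff_mixed:
  assumes "eventually P (cosparse (UNIV :: complex set))"
  shows "generic (\<lambda>(x :: nat \<Rightarrow> complex, y :: nat \<Rightarrow> complex). P (x i - y j + k))"
proof -
  have "generic (\<lambda>p :: (nat \<Rightarrow> complex) \<times> (nat \<Rightarrow> complex). P (fst p i - snd p j + k))"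
  proof (rule generic_cosparse[OF assms(1), where \<gamma> = "\<lambda>p t. ((fst p)(i := fst p i + t), snd p)"])
    show "continuous_on UNIV (\<lambda>p :: (nat \<Rightarrow> complex) \<times> (nat \<Rightarrow> complex). fst p i - snd p j + k)"
      by (intro continuous_on_add continuous_on_diff continuous_on_const continuous_on_coordinate)
    show "continuous_on UNIV (\<lambda>t. ((fst p)(i := fst p i + t), snd p))" for p :: "(nat \<Rightarrow> complex) \<times> (nat \<Rightarrow> complex)"
      by (intro continuous_on_Pair continuous_on_const continuous_on_fun_upd_add)
  qed auto
  then show ?thesis by (simp add: case_prod_unfold)
qed

lemma generic_swap:
  assumes "generic (\<lambda>(x, y). P x y)"
  shows "generic (\<lambda>(x, y). P y x)"
proof -
  have "generic (\<lambda>p. (\<lambda>(x, y). P x y) (prod.swap p))"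
    by (rule generic_compose_homeomorphism[OF assms, where h' = prod.swap])
       (auto simp: continuous_on_swap)
  then show ?thesis by (simp add: case_prod_unfold)
qed

lemma rot_rot: "rot N i (rot N j x) = rot N (i + j) x"
  by (auto simp: rot_def fun_eq_iff mod_simps add.assoc)

lemma rot_0: "rot N 0 x = x" and rot_self: "rot N N x = x"
  by (auto simp: rot_def fun_eq_iff)

lemma continuous_on_rot: "continuous_on UNIV (rot N j)"
  unfolding rot_def
proof (rule continuous_on_coordinatewise_then_product)
  show "continuous_on UNIV (\<lambda>x::nat \<Rightarrow> complex. if m < N then x ((m + j) mod N) else x m)" for m
    by (cases "m < N") (auto intro!: continuous_on_product_coordinates)
qed

lemma generic_rot_fst:
  fixes P :: "(nat \<Rightarrow> complex) \<Rightarrow> 'a::topological_space \<Rightarrow> bool"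
  assumes "generic (\<lambda>(x, y). P x y)"
  shows "generic (\<lambda>(x, y). P (rot N 1 x) y)"
proof (cases "N = 0")
  case True
  then have "rot N 1 x = x" for x by (auto simp: rot_def)
  then show ?thesis using assms by simp
next
  case False
  have cont: "continuous_on UNIV (\<lambda>p :: (nat \<Rightarrow> complex) \<times> 'a. (rot N j (fst p), snd p))" for j
    by (intro continuous_on_Pair continuous_on_compose2[OF continuous_on_rot] continuous_on_fst
        continuous_on_snd continuous_on_id subset_UNIV)
  have "generic (\<lambda>p. (\<lambda>(x, y). P x y) (rot N 1 (fst p), snd p))"
    by (rule generic_compose_homeomorphism[OF assms cont cont[of "N - 1"]])
       (use False in \<open>auto simp: rot_rot rot_self\<close>)
  then show ?thesis by (simp add: case_prod_unfold)
qed

section \<open>The difference operators and their kernels\<close>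

text \<open>The difference equation at \<open>w\<close> and at \<open>w - c\<close>, with nonzero
  values. As \<open>hypG\<close> has value 0 at its poles, nonvanishing of \<open>G_L\<close>
  excludes poles as well as zeros.\<close>

definition shift_regular :: "(complex \<Rightarrow> complex) \<Rightarrow> real \<Rightarrow> complex \<Rightarrow> complex \<Rightarrow> bool" where
  "shift_regular g r c w \<longleftrightarrow> g w \<noteq> 0 \<and> g (w + c) \<noteq> 0 \<and> g (w - c) \<noteq> 0 \<and>
     g (w + c) = (1 + exp (of_real pi * (2 * w + c) / of_real r)) * g w \<and>
     g w = (1 + exp (of_real pi * (2 * w - c) / of_real r)) * g (w - c)"

definition kernel_prod :: "(complex \<Rightarrow> complex) \<Rightarrow> nat \<Rightarrow> complex \<Rightarrow> (nat \<Rightarrow> complex) \<Rightarrow> (nat \<Rightarrow> complex) \<Rightarrow> complex" where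
  "kernel_prod g N s x y = (\<Prod>m<N. g (x m - y (prv N m) + s) * g (y m - x m + s))"

text \<open>At regular points, the quotient of \<open>kernel_prod\<close> by its value after
  \<open>x m\<close> is lowered by \<open>c\<close>. Each factor of the kernel contains one
  coordinate of \<open>x\<close> and one of \<open>y\<close>, so for several shifted coordinates of
  \<open>x\<close> these quotients multiply without interaction.\<close>

definition shift_factor_x :: "real \<Rightarrow> nat \<Rightarrow> complex \<Rightarrow> complex \<Rightarrow> (nat \<Rightarrow> complex) \<Rightarrow> (nat \<Rightarrow> complex) \<Rightarrow> nat \<Rightarrow> complex" where
  "shift_factor_x r N c s x y m =
     (1 + exp (of_real pi * (2 * (x m - y (prv N m) + s) - c) / of_real r))
     / (1 + exp (of_real pi * (2 * (y m - x m + s) + c) / of_real r))"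

text \<open>At regular points, the analogous quotient when \<open>y m\<close> is raised by
  \<open>c\<close>.\<close>

definition shift_factor_y :: "real \<Rightarrow> nat \<Rightarrow> complex \<Rightarrow> complex \<Rightarrow> (nat \<Rightarrow> complex) \<Rightarrow> (nat \<Rightarrow> complex) \<Rightarrow> nat \<Rightarrow> complex" where
  "shift_factor_y r N c s x y m =
     (1 + exp (of_real pi * (2 * (x (nxt N m) - y m + s) - c) / of_real r))
     / (1 + exp (of_real pi * (2 * (y m - x m + s) + c) / of_real r))"

definition kernel_regular :: "(complex \<Rightarrow> complex) \<Rightarrow> real \<Rightarrow> nat \<Rightarrow> complex \<Rightarrow> complex \<Rightarrow> (nat \<Rightarrow> complex) \<Rightarrow> (nat \<Rightarrow> complex) \<Rightarrow> bool" where
  "kernel_regular g r N c s x y \<longleftrightarrow>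
     (\<forall>m<N. shift_regular g r c (x m - y (prv N m) + s) \<and> shift_regular g r c (y m - x m + s))"

lemma kernel_prod_nxt:
  "kernel_prod g N s x y = (\<Prod>m<N. g (x (nxt N m) - y m + s) * g (y m - x m + s))"
proof -
  have "(\<Prod>m<N. g (x m - y (prv N m) + s)) = (\<Prod>m<N. g (x (nxt N m) - y m + s))"
    by (subst prod_nxt[symmetric]) (simp add: prv_nxt)
  then show ?thesis by (simp add: kernel_prod_def prod.distrib)
qed

lemma kernel_regular_nxt:
  assumes "kernel_regular g r N c s x y" "m < N"
  shows "shift_regular g r c (x (nxt N m) - y m + s)" "shift_regular g r c (y m - x m + s)"
  using assms unfolding kernel_regular_def by (metis nxt_less prv_nxt, metis)

lemma shift_regular_factor_nz:
  assumes "shift_regular g r c w"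
  shows "1 + exp (of_real pi * (2 * w + c) / of_real r) \<noteq> 0" "1 + exp (of_real pi * (2 * w - c) / of_real r) \<noteq> 0"
  using assms unfolding shift_regular_def by auto

lemma shift_regular_pair:
  assumes w: "shift_regular g r c w" and v: "shift_regular g r c v"
  shows "g w * g v = g (w - c) * g (v + c) *
    ((1 + exp (of_real pi * (2 * w - c) / of_real r)) / (1 + exp (of_real pi * (2 * v + c) / of_real r)))"
proof -
  define e1 e2 where "e1 = 1 + exp (of_real pi * (2 * w - c) / of_real r)"
    and "e2 = 1 + exp (of_real pi * (2 * v + c) / of_real r)"
  have "g w = e1 * g (w - c)" "g (v + c) = e2 * g v" "e2 \<noteq> 0"
    using w v unfolding shift_regular_def e1_def e2_def by auto
  then show ?thesis unfolding e1_def[symmetric] e2_def[symmetric] by simp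
qed

lemma kernel_prod_shift_x:
  assumes reg: "kernel_regular g r N c s x y" and I: "I \<subseteq> {..<N}"
  shows "kernel_prod g N s x y = kernel_prod g N s (shift I (- c) x) y * (\<Prod>m\<in>I. shift_factor_x r N c s x y m)"
  unfolding kernel_prod_def prod_subset_if[OF I] prod.distrib[symmetric]
proof (rule prod.cong)
  fix m assume "m \<in> {..<N}"
  then have "shift_regular g r c (x m - y (prv N m) + s)" "shift_regular g r c (y m - x m + s)"
    using reg by (auto simp: kernel_regular_def)
  note * = shift_regular_pair[OF this]
  have eqs: "x m + - c - y (prv N m) + s = x m - y (prv N m) + s - c" "y m - (x m + - c) + s = y m - x m + s + c"
    by simp_all
  show "g (x m - y (prv N m) + s) * g (y m - x m + s) =
    g (shift I (- c) x m - y (prv N m) + s) * g (y m - shift I (- c) x m + s) *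
    (if m \<in> I then shift_factor_x r N c s x y m else 1)"
    by (cases "m \<in> I") (simp_all only: shift_def shift_factor_x_def if_True if_False mult_1_right eqs *)
qed simp

lemma kernel_prod_shift_y:
  assumes reg: "kernel_regular g r N c s x y" and I: "I \<subseteq> {..<N}"
  shows "kernel_prod g N s x y = kernel_prod g N s x (shift I c y) * (\<Prod>m\<in>I. shift_factor_y r N c s x y m)"
  unfolding kernel_prod_nxt prod_subset_if[OF I] prod.distrib[symmetric]
proof (rule prod.cong)
  fix m assume "m \<in> {..<N}"
  then have "shift_regular g r c (x (nxt N m) - y m + s)" "shift_regular g r c (y m - x m + s)"
    using kernel_regular_nxt[OF reg] by auto
  note * = shift_regular_pair[OF this]
  have eqs: "x (nxt N m) - (y m + c) + s = x (nxt N m) - y m + s - c" "y m + c - x m + s = y m - x m + s + c"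
    by simp_all
  show "g (x (nxt N m) - y m + s) * g (y m - x m + s) =
    g (x (nxt N m) - shift I c y m + s) * g (shift I c y m - x m + s) *
    (if m \<in> I then shift_factor_y r N c s x y m else 1)"
    by (cases "m \<in> I") (simp_all only: shift_def shift_factor_y_def if_True if_False mult_1_right eqs *)
qed simp

lemma shift_factors_nz:
  assumes "kernel_regular g r N c s x y" "m < N"
  shows "shift_factor_x r N c s x y m \<noteq> 0" "shift_factor_y r N c s x y m \<noteq> 0"
proof -
  note reg = kernel_regular_nxt[OF assms]
  have "shift_regular g r c (x m - y (prv N m) + s)" using assms by (auto simp: kernel_regular_def)
  note nz = shift_regular_factor_nz(1)[OF reg(2)] shift_regular_factor_nz(2)[OF reg(1)]
    shift_regular_factor_nz(2)[OF this]
  show "shift_factor_x r N c s x y m \<noteq> 0" "shift_factor_y r N c s x y m \<noteq> 0"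
    unfolding shift_factor_x_def shift_factor_y_def using nz by (simp_all only: divide_eq_0_iff simp_thms)
qed

text \<open>Lowering all \<open>x m\<close> and raising all \<open>y m\<close> by \<open>c\<close>
  have the same effect on every difference between an \<open>x\<close> and a
  \<open>y\<close>.\<close>

lemma prod_shift_factors: "(\<Prod>m<N. shift_factor_x r N c s x y m) = (\<Prod>m<N. shift_factor_y r N c s x y m)"
proof -
  let ?f = "\<lambda>m. 1 + exp (of_real pi * (2 * (x m - y (prv N m) + s) - c) / of_real r)"
  have "(\<Prod>m<N. ?f m) = (\<Prod>m<N. ?f (nxt N m))"
    by (rule prod_nxt[symmetric])
  then show ?thesis
    by (simp add: shift_factor_x_def shift_factor_y_def prod_dividef prv_nxt)
qed

lemma exp_kernel_identity:
  fixes x y :: "nat \<Rightarrow> complex" and r :: real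
  assumes N: "N > 0" and reg: "kernel_regular g r N c s x y"
  shows "(\<Sum>I\<in>subsets_k N k. (\<Prod>m\<in>{m\<in>I. nxt N m \<notin> I}. 1 - exp (of_real pi * (4 * s + 2 * (x (nxt N m) - x m)) / of_real r)) *
            (\<Prod>m\<in>I. shift_factor_x r N c s x y m))
       = (\<Sum>I\<in>subsets_k N k. (\<Prod>m\<in>{m\<in>I. prv N m \<notin> I}. 1 - exp (of_real pi * (4 * s + 2 * (y m - y (prv N m))) / of_real r)) *
            (\<Prod>m\<in>I. shift_factor_y r N c s x y m))"
proof -
  define X where "X = (\<lambda>m. exp (of_real pi * (2 * x m) / of_real r))"
  \<comment> \<open>The offset \<open>2 * s + c\<close> is chosen so that both
    \<open>V i / X i\<close> and \<open>t * X i / V j\<close> are exactly the exponentials in the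
    shift factors; in the second one \<open>4 * s\<close> from \<open>t\<close> leaves
    \<open>2 * s - c\<close>.\<close>
  define V where "V = (\<lambda>m. exp (of_real pi * (2 * y m + 2 * s + c) / of_real r))"
  define t where "t = exp (of_real pi * (4 * s) / of_real r)"
  have eqs: "1 - t * X i / X j = 1 - exp (of_real pi * (4 * s + 2 * (x i - x j)) / of_real r)"
       "1 - t * V i / V j = 1 - exp (of_real pi * (4 * s + 2 * (y i - y j)) / of_real r)"
       "1 + t * X i / V j = 1 + exp (of_real pi * (2 * (x i - y j + s) - c) / of_real r)"
       "1 + V i / X i = 1 + exp (of_real pi * (2 * (y i - x i + s) + c) / of_real r)" for i j
    unfolding t_def X_def V_def
    by (simp_all flip: exp_add exp_diff add: add_divide_distrib diff_divide_distrib algebra_simps)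
  have nz: "X m \<noteq> 0" "V m \<noteq> 0" for m by (simp_all add: X_def V_def)
  have XV: "X m + V m \<noteq> 0" if "m < N" for m
    using shift_regular_factor_nz(1)[OF kernel_regular_nxt(2)[OF reg that]] nz[of m]
    unfolding eqs(4)[symmetric] by (simp add: divide_simps)
  have VX: "V m + t * X (nxt N m) \<noteq> 0" if "m < N" for m
    using shift_regular_factor_nz(2)[OF kernel_regular_nxt(1)[OF reg that]] nz[of m]
    unfolding eqs(3)[symmetric] by (simp add: divide_simps)
  show ?thesis
    unfolding shift_factor_x_def shift_factor_y_def
    by (rule toda_kernel_rational_identity[where X = X and V = V and t = t and k = k,
          OF N nz XV VX, unfolded eqs])
qed

section \<open>Complementary index sets\<close>

lemma sum_subsets_k_complement:
  assumes "k \<le> N"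
  shows "(\<Sum>I\<in>subsets_k N k. f I) = (\<Sum>I\<in>subsets_k N (N - k). f ({..<N} - I))"
  by (rule sum.reindex_bij_witness[of _ "\<lambda>I. {..<N} - I" "\<lambda>I. {..<N} - I"])
     (use assms in \<open>auto simp: subsets_k_def double_diff card_Diff_subset finite_subset\<close>)

lemma prod_complement:
  fixes f :: "nat \<Rightarrow> complex"
  assumes "I \<subseteq> {..<N}" "\<And>m. m < N \<Longrightarrow> f m \<noteq> 0"
  shows "(\<Prod>m\<in>{..<N} - I. 1 / f m) = (\<Prod>m\<in>I. f m) / (\<Prod>m<N. f m)"
proof -
  have "(\<Prod>m<N. f m) = (\<Prod>m\<in>{..<N} - I. f m) * (\<Prod>m\<in>I. f m)"
    using prod.subset_diff[OF assms(1), of f] by simp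
  moreover have "(\<Prod>m\<in>I. f m) \<noteq> 0" using assms finite_subset[OF assms(1)] by (auto simp: prod_zero_iff)
  ultimately show ?thesis by (simp add: prod_dividef)
qed

text \<open>A link of the cycle with exactly one end in \<open>I\<close> has exactly one end in the
  complement; only the direction in which it is crossed is reversed.\<close>

lemma prod_boundary_complement:
  assumes I: "I \<subseteq> {..<N}"
  shows "(\<Prod>m\<in>{m \<in> {..<N} - I. prv N m \<notin> {..<N} - I}. f (prv N m) m) = (\<Prod>m\<in>{m\<in>I. nxt N m \<notin> I}. f m (nxt N m))"
    "(\<Prod>m\<in>{m \<in> {..<N} - I. nxt N m \<notin> {..<N} - I}. f m (nxt N m)) = (\<Prod>m\<in>{m\<in>I. prv N m \<notin> I}. f (prv N m) m)"
   by (rule prod.reindex_bij_witness[of _ "nxt N" "prv N"],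
       use I in \<open>auto simp: nxt_prv prv_nxt nxt_less prv_less subset_iff\<close>)
      (rule prod.reindex_bij_witness[of _ "prv N" "nxt N"],
       use I in \<open>auto simp: nxt_prv prv_nxt nxt_less prv_less subset_iff\<close>)

text \<open>Passing to complements of index sets inverts the shift factors, up to their total product.\<close>
lemma exp_kernel_identity_inverse:
  fixes x y :: "nat \<Rightarrow> complex" and r :: real
  assumes N: "N > 0" and reg: "kernel_regular g r N c s x y" and k: "k \<le> N"
  shows "(\<Sum>I\<in>subsets_k N k. (\<Prod>m\<in>{m\<in>I. prv N m \<notin> I}. 1 - exp (of_real pi * (4 * s + 2 * (x m - x (prv N m))) / of_real r)) *
            (\<Prod>m\<in>I. 1 / shift_factor_x r N c s x y m))
       = (\<Sum>I\<in>subsets_k N k. (\<Prod>m\<in>{m\<in>I. nxt N m \<notin> I}. 1 - exp (of_real pi * (4 * s + 2 * (y (nxt N m) - y m)) / of_real r)) *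
            (\<Prod>m\<in>I. 1 / shift_factor_y r N c s x y m))"
proof -
  let ?P = "\<Prod>m<N. shift_factor_x r N c s x y m"
  let ?T = "\<lambda>u. 1 - exp (of_real pi * (4 * s + 2 * u) / of_real r)"
  have sub: "I \<subseteq> {..<N}" if "I \<in> subsets_k N (N - k)" for I using that by (auto simp: subsets_k_def)
  have "(\<Sum>I\<in>subsets_k N k. (\<Prod>m\<in>{m\<in>I. prv N m \<notin> I}. ?T (x m - x (prv N m))) * (\<Prod>m\<in>I. 1 / shift_factor_x r N c s x y m))
     = (\<Sum>I\<in>subsets_k N (N - k). (\<Prod>m\<in>{m\<in>I. nxt N m \<notin> I}. ?T (x (nxt N m) - x m)) * (\<Prod>m\<in>I. shift_factor_x r N c s x y m)) / ?P"
    unfolding sum_subsets_k_complement[OF k] sum_divide_distrib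
    by (intro sum.cong refl)
       (simp only: prod_complement[OF sub shift_factors_nz(1)[OF reg]] times_divide_eq_right
          prod_boundary_complement(1)[OF sub, where f = "\<lambda>i j. ?T (x j - x i)"])
  also have "\<dots> = (\<Sum>I\<in>subsets_k N (N - k). (\<Prod>m\<in>{m\<in>I. prv N m \<notin> I}. ?T (y m - y (prv N m))) * (\<Prod>m\<in>I. shift_factor_y r N c s x y m)) / ?P"
    by (simp only: exp_kernel_identity[OF N reg])
  also have "\<dots> = (\<Sum>I\<in>subsets_k N k. (\<Prod>m\<in>{m\<in>I. nxt N m \<notin> I}. ?T (y (nxt N m) - y m)) * (\<Prod>m\<in>I. 1 / shift_factor_y r N c s x y m))"
    unfolding sum_subsets_k_complement[OF k] sum_divide_distrib prod_shift_factors
    by (intro sum.cong refl)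
       (simp only: prod_complement[OF sub shift_factors_nz(2)[OF reg]] times_divide_eq_right
          prod_boundary_complement(2)[OF sub, where f = "\<lambda>i j. ?T (y j - y i)"])
  finally show ?thesis .
qed

text \<open>Relative to \<open>Tfun\<close>, \<open>4 * s\<close> contains the extra term plus or
  minus \<open>\<i> * adelta ap am d\<close>. Divided by \<open>adelta ap am d\<close> and
  multiplied by \<open>pi\<close> it contributes \<open>exp (\<i> * pi) = -1\<close> for either
  sign.\<close>

lemma Tfun_eq:
  assumes s: "4 * s = 2 * of_real eta + (if p then 1 else -1) * (\<i> * of_real (adelta ap am d) + \<i> * of_real (adelta ap am (\<not> d)))"
    and r: "adelta ap am d > 0"
  shows "Tfun ap am eta d p z = 1 - exp (of_real pi * (4 * s + 2 * z) / of_real (adelta ap am d))"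
proof -
  let ?r = "complex_of_real (adelta ap am d)"
  have "of_real pi * (4 * s + 2 * z) / ?r = (if p then 1 else -1) * (\<i> * of_real pi) +
      of_real pi * (2 * z + (if p then 1 else -1) * \<i> * of_real (adelta ap am (\<not> d)) + 2 * of_real eta) / ?r"
    unfolding s using r by (simp add: field_simps)
  moreover have "exp ((if p then 1 else -1) * (\<i> * of_real pi)) = -1"
    by (simp add: exp_minus)
  ultimately show ?thesis by (simp add: Tfun_def exp_add)
qed

text \<open>Reflection turns \<open>G_R\<close> at \<open>y m - x (nxt N m) - s\<close> into
  \<open>1 / G_L\<close> at \<open>x (nxt N m) - y m + s\<close>, so both kinds of factors acquire
  the same offset \<open>s\<close>.\<close>

lemma Splus_eq_kernel_prod:
  assumes "\<And>z. G_R ap am z = 1 / G_L ap am (- z)"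
  shows "Splus N ap am eta x y = 1 / kernel_prod (G_L ap am) N (\<i> * of_real (ahalf ap am) / 2 + of_real eta / 2) x y"
  unfolding Splus_def kernel_prod_nxt assms
  by (simp add: prod_dividef algebra_simps prod.distrib)

lemma Sminus_eq_kernel_prod:
  assumes "\<And>z. G_R ap am z = 1 / G_L ap am (- z)"
  shows "Sminus N ap am eta x y = kernel_prod (G_L ap am) N (- \<i> * of_real (ahalf ap am) / 2 + of_real eta / 2) x y"
  unfolding Sminus_def kernel_prod_nxt assms
  by (simp add: prod_dividef algebra_simps prod.distrib)

lemma rot_1: "m < N \<Longrightarrow> rot N 1 x m = x (nxt N m)" "m < N \<Longrightarrow> rot N (Suc 0) x m = x (nxt N m)"
  by (simp_all add: rot_def nxt_def)

text \<open>The cyclic sequence of alternating \<open>x\<close> and \<open>y\<close> may equally be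
  read from its first \<open>y\<close> on; then \<open>y\<close> comes first and \<open>x\<close>
  appears rotated by one.\<close>

lemma kernel_prod_rot: "kernel_prod g N s x y = kernel_prod g N s y (rot N 1 x)"
  unfolding kernel_prod_nxt[of g N s x y] unfolding kernel_prod_def
  by (intro prod.cong) (auto simp: rot_1 prv_less nxt_prv mult.commute)

lemma subsets_kD: "I \<in> subsets_k N k \<Longrightarrow> I \<subseteq> {..<N}"
  by (simp add: subsets_k_def)

lemma four_half_a:
  "4 * (p * \<i> * of_real (ahalf ap am) / 2 + of_real eta / 2) =
     2 * of_real eta + p * (\<i> * of_real (adelta ap am d) + \<i> * of_real (adelta ap am (\<not> d)))"
  by (simp add: ahalf_def adelta_def algebra_simps)

lemma Aplus_Splus_pos:
  assumes GR: "\<And>z. G_R ap am z = 1 / G_L ap am (- z)"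
    and pos: "adelta ap am d > 0" and N: "N > 0" and l: "l > 0"
    and c: "c = \<i> * of_real (adelta ap am (\<not> d))" and s: "s = \<i> * of_real (ahalf ap am) / 2 + of_real eta / 2"
    and reg: "kernel_regular (G_L ap am) (adelta ap am d) N c s x y"
  shows "Aplus N ap am eta d l (\<lambda>x'. Splus N ap am eta x' y) x
       = Aplus N ap am eta d (- l) (\<lambda>y'. Splus N ap am eta x y') y"
proof -
  let ?r = "adelta ap am d"
  let ?K = "kernel_prod (G_L ap am) N s"
  have nl: "\<not> - l > 0" using l by simp
  have T: "Tfun ap am eta d True z = 1 - exp (of_real pi * (4 * s + 2 * z) / of_real ?r)" for z
    by (rule Tfun_eq) (use four_half_a[of 1 ap am eta d] pos s in auto)
  have S: "Splus N ap am eta x y = 1 / ?K x y" for x y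
    unfolding Splus_eq_kernel_prod[OF GR] s ..
  have 1: "1 / ?K (shift I (- c) x) y = (\<Prod>m\<in>I. shift_factor_x ?r N c s x y m) / ?K x y"
    if "I \<subseteq> {..<N}" for I
  proof -
    have "(\<Prod>m\<in>I. shift_factor_x ?r N c s x y m) \<noteq> 0"
      using shift_factors_nz[OF reg] that finite_subset[OF that]
      by (auto simp: prod_zero_iff)
    then show ?thesis using kernel_prod_shift_x[OF reg that] by simp
  qed
  have 2: "1 / ?K x (shift I c y) = (\<Prod>m\<in>I. shift_factor_y ?r N c s x y m) / ?K x y"
    if "I \<subseteq> {..<N}" for I
  proof -
    have "(\<Prod>m\<in>I. shift_factor_y ?r N c s x y m) \<noteq> 0"
      using shift_factors_nz[OF reg] that finite_subset[OF that]
      by (auto simp: prod_zero_iff)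
    then show ?thesis using kernel_prod_shift_y[OF reg that] by simp
  qed
  have "Aplus N ap am eta d l (\<lambda>x'. Splus N ap am eta x' y) x
    = (\<Sum>I\<in>subsets_k N (nat l). (\<Prod>m\<in>{m\<in>I. nxt N m \<notin> I}. 1 - exp (of_real pi * (4 * s + 2 * (x (nxt N m) - x m)) / of_real ?r)) *
            (\<Prod>m\<in>I. shift_factor_x ?r N c s x y m)) / ?K x y"
    unfolding Aplus_def Let_def c[symmetric] S T if_P[OF l] sum_divide_distrib
    by (intro sum.cong refl, subst 1, erule subsets_kD, simp add: mult.assoc)
  also have "\<dots> = Aplus N ap am eta d (- l) (\<lambda>y'. Splus N ap am eta x y') y"
    unfolding exp_kernel_identity[OF N reg] Aplus_def Let_def c[symmetric] S T sum_divide_distrib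
      if_not_P[OF nl] minus_minus
    by (intro sum.cong refl, subst 2, erule subsets_kD, simp add: mult.assoc)
  finally show ?thesis .
qed

text \<open>This kernel is \<open>kernel_prod\<close> itself instead of its reciprocal, so the shift
  factors occur inverted. The complementary identity applies, and with it the bound
  \<open>l \<le> int N\<close>.\<close>

lemma Aminus_Sminus_pos:
  assumes GR: "\<And>z. G_R ap am z = 1 / G_L ap am (- z)"
    and pos: "adelta ap am d > 0" and N: "N > 0" and l: "l > 0" "l \<le> int N"
    and c: "c = \<i> * of_real (adelta ap am (\<not> d))" and s: "s = - \<i> * of_real (ahalf ap am) / 2 + of_real eta / 2"
    and reg: "kernel_regular (G_L ap am) (adelta ap am d) N c s x y"
  shows "Aminus N ap am eta d l (\<lambda>x'. Sminus N ap am eta x' y) x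
       = Aminus N ap am eta d (- l) (\<lambda>y'. Sminus N ap am eta x y') y"
proof -
  let ?r = "adelta ap am d"
  let ?K = "kernel_prod (G_L ap am) N s"
  have nl: "\<not> - l > 0" using l by simp
  have T: "Tfun ap am eta d False z = 1 - exp (of_real pi * (4 * s + 2 * z) / of_real ?r)" for z
    by (rule Tfun_eq) (use four_half_a[of "-1" ap am eta d] pos s in auto)
  have S: "Sminus N ap am eta x y = ?K x y" for x y
    unfolding Sminus_eq_kernel_prod[OF GR] s ..
  have k: "nat l \<le> N" using l by auto
  have 1: "?K (shift I (- c) x) y = (\<Prod>m\<in>I. 1 / shift_factor_x ?r N c s x y m) * ?K x y"
    if "I \<subseteq> {..<N}" for I
  proof -
    have "(\<Prod>m\<in>I. shift_factor_x ?r N c s x y m) \<noteq> 0"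
      using shift_factors_nz[OF reg] that finite_subset[OF that]
      by (auto simp: prod_zero_iff)
    then show ?thesis using kernel_prod_shift_x[OF reg that] by (simp add: prod_dividef)
  qed
  have 2: "?K x (shift I c y) = (\<Prod>m\<in>I. 1 / shift_factor_y ?r N c s x y m) * ?K x y"
    if "I \<subseteq> {..<N}" for I
  proof -
    have "(\<Prod>m\<in>I. shift_factor_y ?r N c s x y m) \<noteq> 0"
      using shift_factors_nz[OF reg] that finite_subset[OF that]
      by (auto simp: prod_zero_iff)
    then show ?thesis using kernel_prod_shift_y[OF reg that] by (simp add: prod_dividef)
  qed
  have "Aminus N ap am eta d l (\<lambda>x'. Sminus N ap am eta x' y) x
    = (\<Sum>I\<in>subsets_k N (nat l). (\<Prod>m\<in>{m\<in>I. prv N m \<notin> I}. 1 - exp (of_real pi * (4 * s + 2 * (x m - x (prv N m))) / of_real ?r)) *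
            (\<Prod>m\<in>I. 1 / shift_factor_x ?r N c s x y m)) * ?K x y"
    unfolding Aminus_def Let_def c[symmetric] S T if_P[OF l(1)] sum_distrib_right
    by (intro sum.cong refl, subst 1, erule subsets_kD, simp add: mult.assoc)
  also have "\<dots> = Aminus N ap am eta d (- l) (\<lambda>y'. Sminus N ap am eta x y') y"
    unfolding exp_kernel_identity_inverse[OF N reg k] Aminus_def Let_def c[symmetric] S T sum_distrib_right
      if_not_P[OF nl] minus_minus
    by (intro sum.cong refl, subst 2, erule subsets_kD, simp add: mult.assoc)
  finally show ?thesis .
qed

section \<open>Cyclic rotations of the variables\<close>

lemma sum_subsets_k_nxt: "(\<Sum>I\<in>subsets_k N k. f (nxt N ` I)) = (\<Sum>I\<in>subsets_k N k. f I)"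
proof (rule sum.reindex_bij_witness[of _ "\<lambda>I. prv N ` I" "\<lambda>I. nxt N ` I"])
  fix I assume I: "I \<in> subsets_k N k"
  then have sub: "I \<subseteq> {..<N}" by (rule subsets_kD)
  show "prv N ` nxt N ` I = I" "nxt N ` prv N ` I = I"
    using sub by (auto simp: image_image prv_nxt nxt_prv subset_iff intro!: image_eqI)
  have "inj_on (nxt N) I" "inj_on (prv N) I"
    by (rule inj_on_inverseI[of _ "prv N"]; use sub in \<open>auto simp: prv_nxt\<close>)
       (rule inj_on_inverseI[of _ "nxt N"]; use sub in \<open>auto simp: nxt_prv\<close>)
  then show "nxt N ` I \<in> subsets_k N k" "prv N ` I \<in> subsets_k N k"
    using I by (auto simp: subsets_k_def card_image nxt_less prv_less subset_iff)
qed simp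

lemma nxt_in_image_iff: "I \<subseteq> {..<N} \<Longrightarrow> m < N \<Longrightarrow> nxt N m \<in> nxt N ` I \<longleftrightarrow> m \<in> I"
  using inj_on_image_mem_iff[OF bij_betw_imp_inj_on[OF bij_betw_nxt], of m N I] by simp

lemma shift_rot:
  assumes "I \<subseteq> {..<N}"
  shows "shift I c (rot N 1 x) = rot N 1 (shift (nxt N ` I) c x)"
  using nxt_in_image_iff[OF assms] assms
  by (auto simp: shift_def rot_def fun_eq_iff nxt_def)

lemma boundary_prod_nxt:
  fixes x :: "nat \<Rightarrow> complex"
  assumes I: "I \<subseteq> {..<N}"
  shows "(\<Prod>m\<in>{m\<in>nxt N ` I. nxt N m \<notin> nxt N ` I}. T (x (nxt N m) - x m))
     = (\<Prod>m\<in>{m\<in>I. nxt N m \<notin> I}. T (rot N 1 x (nxt N m) - rot N 1 x m))"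
    and "(\<Prod>m\<in>{m\<in>nxt N ` I. prv N m \<notin> nxt N ` I}. T (x m - x (prv N m)))
     = (\<Prod>m\<in>{m\<in>I. prv N m \<notin> I}. T (rot N 1 x m - rot N 1 x (prv N m)))"
proof -
  show "(\<Prod>m\<in>{m\<in>nxt N ` I. nxt N m \<notin> nxt N ` I}. T (x (nxt N m) - x m))
     = (\<Prod>m\<in>{m\<in>I. nxt N m \<notin> I}. T (rot N 1 x (nxt N m) - rot N 1 x m))"
    by (rule prod.reindex_bij_witness[of _ "nxt N" "prv N"])
       (use I in \<open>auto simp: rot_1 nxt_less prv_less prv_nxt nxt_prv subset_iff nxt_in_image_iff\<close>)
  show "(\<Prod>m\<in>{m\<in>nxt N ` I. prv N m \<notin> nxt N ` I}. T (x m - x (prv N m)))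
     = (\<Prod>m\<in>{m\<in>I. prv N m \<notin> I}. T (rot N 1 x m - rot N 1 x (prv N m)))"
  proof (rule prod.reindex_bij_witness[of _ "nxt N" "prv N"])
    fix m assume "m \<in> {m\<in>I. prv N m \<notin> I}"
    then show "nxt N m \<in> {m \<in> nxt N ` I. prv N m \<notin> nxt N ` I}"
      using I nxt_in_image_iff[OF I, of "prv N m"] by (auto simp: prv_nxt nxt_prv prv_less subset_iff)
  next
    fix m assume "m \<in> {m \<in> nxt N ` I. prv N m \<notin> nxt N ` I}"
    then obtain i where i: "m = nxt N i" "i \<in> I" "prv N m \<notin> nxt N ` I" by auto
    then have "i < N" using I by auto
    then show "prv N m \<in> {m\<in>I. prv N m \<notin> I}"
      using i I nxt_in_image_iff[OF I, of "prv N i"] by (auto simp: prv_nxt nxt_prv prv_less)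
  qed (use I in \<open>auto simp: rot_1 nxt_less prv_less prv_nxt nxt_prv subset_iff\<close>)
qed

text \<open>Rotation commutes with the operator because the sum runs over all subsets of a given
  size. Together with \<open>kernel_prod_rot\<close> this makes exchanging \<open>x\<close> and
  \<open>y\<close> a symmetry of the identities.\<close>

lemma Aplus_rot: "Aplus N ap am eta d l f (rot N 1 x) = Aplus N ap am eta d l (\<lambda>x'. f (rot N 1 x')) x"
proof (cases "l > 0")
  case True
  show ?thesis
    unfolding Aplus_def Let_def if_P[OF True]
    by (rule trans[OF _ sum_subsets_k_nxt], intro sum.cong refl, drule subsets_kD)
       (simp only: shift_rot boundary_prod_nxt)
next
  case False
  show ?thesis
    unfolding Aplus_def Let_def if_not_P[OF False]
    by (rule trans[OF _ sum_subsets_k_nxt], intro sum.cong refl, drule subsets_kD)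
       (simp only: shift_rot boundary_prod_nxt)
qed

lemma Aminus_rot: "Aminus N ap am eta d l f (rot N 1 x) = Aminus N ap am eta d l (\<lambda>x'. f (rot N 1 x')) x"
proof (cases "l > 0")
  case True
  show ?thesis
    unfolding Aminus_def Let_def if_P[OF True]
    by (rule trans[OF _ sum_subsets_k_nxt], intro sum.cong refl, drule subsets_kD)
       (simp only: shift_rot boundary_prod_nxt)
next
  case False
  show ?thesis
    unfolding Aminus_def Let_def if_not_P[OF False]
    by (rule trans[OF _ sum_subsets_k_nxt], intro sum.cong refl, drule subsets_kD)
       (simp only: shift_rot boundary_prod_nxt)
qed

text \<open>The difference on the link from \<open>m\<close> to \<open>nxt N m\<close> changes only
  if one end lies in \<open>I\<close>: it grows by \<open>c\<close> if that end is \<open>m\<close>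
  and drops by \<open>c\<close> if it is \<open>nxt N m\<close>. A loop \<open>nxt N m = m\<close>
  never changes, so nothing is assumed there.\<close>

lemma prod_shift_boundary:
  assumes g: "\<forall>m<N. nxt N m \<noteq> m \<longrightarrow> shift_regular g r c (x (nxt N m) - x m + k)"
    and I: "I \<subseteq> {..<N}"
  shows "(\<Prod>m<N. g (shift I (- c) x (nxt N m) - shift I (- c) x m + k)) *
       (\<Prod>m\<in>{m\<in>I. prv N m \<notin> I}. 1 + exp (of_real pi * (2 * (x m - x (prv N m) + k) - c) / of_real r))
     = (\<Prod>m<N. g (x (nxt N m) - x m + k)) *
       (\<Prod>m\<in>{m\<in>I. nxt N m \<notin> I}. 1 + exp (of_real pi * (2 * (x (nxt N m) - x m + k) + c) / of_real r))"
    (is "_ * (\<Prod>m\<in>_. ?e m) = _ * (\<Prod>m\<in>_. ?e' m)")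
proof -
  have eq: "(\<Prod>m\<in>{m\<in>I. prv N m \<notin> I}. ?e m) = (\<Prod>m<N. if nxt N m \<in> I \<and> m \<notin> I then ?e (nxt N m) else 1)"
    unfolding prod_set_if[OF I] by (subst prod_nxt[symmetric]) (auto simp: prv_nxt intro!: prod.cong)
  show ?thesis
    unfolding eq prod_set_if[OF I] prod.distrib[symmetric]
  proof (rule prod.cong)
    fix m assume "m \<in> {..<N}"
    then have m: "m < N" by simp
    have e: "x (nxt N m) + - c - x m + k = x (nxt N m) - x m + k - c"
      "x (nxt N m) - (x m + - c) + k = x (nxt N m) - x m + k + c"
      "x (nxt N m) + - c - (x m + - c) + k = x (nxt N m) - x m + k"
      by simp_all
    show "g (shift I (- c) x (nxt N m) - shift I (- c) x m + k) *
        (if nxt N m \<in> I \<and> m \<notin> I then ?e (nxt N m) else 1) =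
      g (x (nxt N m) - x m + k) * (if m \<in> I \<and> nxt N m \<notin> I then ?e' m else 1)"
    proof (cases "nxt N m = m")
      case True
      then show ?thesis by simp
    next
      case False
      have reg: "g (x (nxt N m) - x m + k + c) = ?e' m * g (x (nxt N m) - x m + k)"
        "g (x (nxt N m) - x m + k) = ?e (nxt N m) * g (x (nxt N m) - x m + k - c)"
        using g[rule_format, OF m False] unfolding shift_regular_def by (auto simp: prv_nxt[OF m])
      show ?thesis
      proof (cases "m \<in> I"; cases "nxt N m \<in> I")
        assume "m \<in> I" "nxt N m \<in> I"
        then show ?thesis by (simp only: shift_def e if_True simp_thms if_False)
      next
        assume "m \<in> I" "nxt N m \<notin> I"
        then show ?thesis by (simp only: shift_def e if_True simp_thms if_False reg(1)) (simp only: mult_ac mult_1_right mult_1_left)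
      next
        assume "m \<notin> I" "nxt N m \<in> I"
        then show ?thesis by (simp only: shift_def e if_True simp_thms if_False mult_1_right, subst mult.commute) (rule reg(2)[symmetric])
      next
        assume "m \<notin> I" "nxt N m \<notin> I"
        then show ?thesis by (simp only: shift_def e if_True simp_thms if_False)
      qed
    qed
  qed simp
qed

text \<open>The exclusion of \<open>nxt N m = m\<close> concerns \<open>N = 1\<close>, where the
  argument is the constant \<open>eta\<close> and cannot be varied.\<close>

definition U_regular :: "nat \<Rightarrow> real \<Rightarrow> real \<Rightarrow> real \<Rightarrow> bool \<Rightarrow> (nat \<Rightarrow> complex) \<Rightarrow> bool" where
  "U_regular N ap am eta d x \<longleftrightarrow> (\<forall>m<N. nxt N m \<noteq> m \<longrightarrow>
     shift_regular (G_L ap am) (adelta ap am d) (\<i> * of_real (adelta ap am (\<not> d))) (x (nxt N m) - x m + of_real eta))"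

lemma shift_regular_minus:
  "shift_regular g r (- c) w \<longleftrightarrow> g w \<noteq> 0 \<and> g (w + c) \<noteq> 0 \<and> g (w - c) \<noteq> 0 \<and>
     g (w - c) = (1 + exp (of_real pi * (2 * w - c) / of_real r)) * g w \<and>
     g w = (1 + exp (of_real pi * (2 * w + c) / of_real r)) * g (w + c)"
  unfolding shift_regular_def by auto

lemma shift_regular_inverse:
  assumes "shift_regular g r c w"
  shows "shift_regular (\<lambda>w. 1 / g w) r (- c) w"
proof -
  define e1 e2 where "e1 = 1 + exp (of_real pi * (2 * w - c) / of_real r)"
    and "e2 = 1 + exp (of_real pi * (2 * w + c) / of_real r)"
  show ?thesis
    using assms unfolding shift_regular_minus unfolding shift_regular_def e1_def[symmetric] e2_def[symmetric]
    by auto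
qed

lemma Ufun_shift_nz:
  assumes nz: "G_L ap am (of_real eta) \<noteq> 0" and reg: "U_regular N ap am eta d x"
    and c: "c = \<i> * of_real (adelta ap am (\<not> d))" and k: "k \<in> {0, c, - c}"
  shows "Ufun N ap am eta (shift I k x) \<noteq> 0"
proof -
  have "G_L ap am (shift I k x (nxt N m) - shift I k x m + of_real eta) \<noteq> 0" if m: "m < N" for m
  proof (cases "nxt N m = m")
    case True
    then show ?thesis using nz by simp
  next
    case False
    define w where "w = x (nxt N m) - x m + of_real eta"
    have "shift_regular (G_L ap am) (adelta ap am d) c w"
      using reg m False unfolding U_regular_def w_def c by blast
    then have "G_L ap am w \<noteq> 0" "G_L ap am (w + c) \<noteq> 0" "G_L ap am (w - c) \<noteq> 0"
      unfolding shift_regular_def by auto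
    moreover have "shift I k x (nxt N m) - shift I k x m + of_real eta \<in> {w, w + c, w - c}"
      using k unfolding shift_def w_def by auto
    ultimately show ?thesis by auto
  qed
  then show ?thesis by (auto simp: Ufun_def prod_zero_iff)
qed

text \<open>The conjugation of the operators by \<open>U\<close>, compared term by term for a fixed
  \<open>I\<close>. The second equation is the same boundary formula applied to
  \<open>1 / G_L\<close> with step \<open>- c\<close>, which is why regularity of reciprocals is
  needed.\<close>

lemma Ufun_conjugation:
  assumes nz: "G_L ap am (of_real eta) \<noteq> 0" and reg: "U_regular N ap am eta d x"
    and c: "c = \<i> * of_real (adelta ap am (\<not> d))" and I: "I \<subseteq> {..<N}"
  shows "(\<Prod>m\<in>{m\<in>I. prv N m \<notin> I}. Tfun ap am eta d False (x m - x (prv N m))) * Ufun N ap am eta x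
       = (\<Prod>m\<in>{m\<in>I. nxt N m \<notin> I}. Tfun ap am eta d True (x (nxt N m) - x m)) * Ufun N ap am eta (shift I (- c) x)"
    and "(\<Prod>m\<in>{m\<in>I. nxt N m \<notin> I}. Tfun ap am eta d False (x (nxt N m) - x m)) * Ufun N ap am eta x
       = (\<Prod>m\<in>{m\<in>I. prv N m \<notin> I}. Tfun ap am eta d True (x m - x (prv N m))) * Ufun N ap am eta (shift I c x)"
proof -
  have gl: "\<forall>m<N. nxt N m \<noteq> m \<longrightarrow> shift_regular (G_L ap am) (adelta ap am d) c (x (nxt N m) - x m + of_real eta)"
    using reg unfolding U_regular_def c .
  then have gl': "\<forall>m<N. nxt N m \<noteq> m \<longrightarrow>
      shift_regular (\<lambda>w. 1 / G_L ap am w) (adelta ap am d) (- c) (x (nxt N m) - x m + of_real eta)"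
    using shift_regular_inverse by blast
  have T: "Tfun ap am eta d True z = 1 + exp (of_real pi * (2 * (z + of_real eta) + c) / of_real (adelta ap am d))"
    "Tfun ap am eta d False z = 1 + exp (of_real pi * (2 * (z + of_real eta) - c) / of_real (adelta ap am d))" for z
    unfolding Tfun_def c by (simp_all add: algebra_simps)
  have U: "(\<Prod>m<N. G_L ap am (z (nxt N m) - z m + of_real eta)) = 1 / Ufun N ap am eta z"
    "(\<Prod>m<N. 1 / G_L ap am (z (nxt N m) - z m + of_real eta)) = Ufun N ap am eta z" for z
    by (simp_all add: Ufun_def prod_dividef)
  have "Ufun N ap am eta (shift {} 0 x) \<noteq> 0" "Ufun N ap am eta (shift I (- c) x) \<noteq> 0"
    using Ufun_shift_nz[OF nz reg c] by auto
  then have nz': "Ufun N ap am eta x \<noteq> 0" "Ufun N ap am eta (shift I (- c) x) \<noteq> 0"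
    by (auto simp: shift_def)
  have *: "u * t = v * s" if "1 / v * t = 1 / u * s" "u \<noteq> 0" "v \<noteq> 0" for u v s t :: complex
    using that by (simp add: field_simps)
  show "(\<Prod>m\<in>{m\<in>I. prv N m \<notin> I}. Tfun ap am eta d False (x m - x (prv N m))) * Ufun N ap am eta x
       = (\<Prod>m\<in>{m\<in>I. nxt N m \<notin> I}. Tfun ap am eta d True (x (nxt N m) - x m)) * Ufun N ap am eta (shift I (- c) x)"
    using *[OF prod_shift_boundary[where x = x and k = "of_real eta", OF gl I, unfolded U] nz'] unfolding T by (simp only: mult.commute)
  have "Ufun N ap am eta (shift I c x) * (\<Prod>m\<in>{m\<in>I. prv N m \<notin> I}. Tfun ap am eta d True (x m - x (prv N m)))
     = Ufun N ap am eta x * (\<Prod>m\<in>{m\<in>I. nxt N m \<notin> I}. Tfun ap am eta d False (x (nxt N m) - x m))"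
    using prod_shift_boundary[where x = x and k = "of_real eta", OF gl' I, unfolded U] unfolding T
    by (simp only: minus_minus diff_minus_eq_add add_uminus_conv_diff)
  then show "(\<Prod>m\<in>{m\<in>I. nxt N m \<notin> I}. Tfun ap am eta d False (x (nxt N m) - x m)) * Ufun N ap am eta x
       = (\<Prod>m\<in>{m\<in>I. prv N m \<notin> I}. Tfun ap am eta d True (x m - x (prv N m))) * Ufun N ap am eta (shift I c x)"
    by (simp only: mult.commute)
qed

text \<open>At each shifted point the root enters twice, once from the kernel and once from
  \<open>Hop\<close>, so only its square is seen there. Hence \<open>sq\<close> may be chosen point
  by point, without continuity or a consistent branch.\<close>

lemma Hop_Aplus:
  assumes nz: "G_L ap am (of_real eta) \<noteq> 0" and reg: "U_regular N ap am eta d x"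
    and sq: "\<forall>x. (sq x)\<^sup>2 = Ufun N ap am eta x"
  shows "Hop sq N ap am eta d l (\<lambda>x'. f x' / (sq x' * w)) x = Aplus N ap am eta d l f x / (sq x * w)"
proof -
  define c where "c = \<i> * of_real (adelta ap am (\<not> d))"
  note conj = Ufun_conjugation[OF nz reg c_def]
  have U: "Ufun N ap am eta x = sq x * sq x" for x
    using sq by (simp add: power2_eq_square)
  have "Ufun N ap am eta (shift {} 0 x) \<noteq> 0"
    using Ufun_shift_nz[OF nz reg c_def, of 0 "{}"] by simp
  then have nz0: "sq x \<noteq> 0" by (auto simp: U shift_def)
  have nz1: "sq (shift I (- c) x) \<noteq> 0" "sq (shift I c x) \<noteq> 0" for I
    using Ufun_shift_nz[OF nz reg c_def] by (auto simp: U)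
  have *: "u * (s * (f' / (v * w) / v)) = t * f' / (u * w)"
    if "s * (u * u) = t * (v * v)" "u \<noteq> 0" "v \<noteq> 0" for s t u v f' :: complex
  proof -
    have s: "s = t * (v * v) / (u * u)" using that by (simp add: field_simps)
    \<comment> \<open>The parameter \<open>w\<close> stands for the root at the other point and may
      be 0; then both sides are 0 because division by 0 yields 0.\<close>
    show ?thesis unfolding s using that(2,3) by (cases "w = 0") (simp_all add: field_simps)
  qed
  show ?thesis
  proof (cases "l > 0")
    case True
    show ?thesis
      unfolding Hop_def Aminus_def Aplus_def Let_def c_def[symmetric] if_P[OF True] sum_distrib_left sum_divide_distrib
      by (intro sum.cong refl *) (use conj(1)[OF subsets_kD] nz0 nz1 in \<open>auto simp: U\<close>)
  next
    case False
    show ?thesis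
      unfolding Hop_def Aminus_def Aplus_def Let_def c_def[symmetric] if_not_P[OF False] sum_distrib_left sum_divide_distrib
      by (intro sum.cong refl *) (use conj(2)[OF subsets_kD] nz0 nz1 in \<open>auto simp: U\<close>)
  qed
qed

lemma Hop_Aminus:
  assumes nz: "G_L ap am (of_real eta) \<noteq> 0" and reg: "U_regular N ap am eta d x"
    and sq: "\<forall>x. (sq x)\<^sup>2 = Ufun N ap am eta x"
  shows "Hop sq N ap am eta d l (\<lambda>x'. sq x' * w * f x') x = sq x * w * Aminus N ap am eta d l f x"
proof -
  define c where "c = \<i> * of_real (adelta ap am (\<not> d))"
  have nz1: "sq (shift I (- c) x) \<noteq> 0" "sq (shift I c x) \<noteq> 0" for I
    using Ufun_shift_nz[OF nz reg c_def] by (auto simp flip: sq[rule_format])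
  show ?thesis
    using nz1 by (simp add: Hop_def Aminus_def Let_def sum_distrib_left mult_ac flip: c_def)
qed

section \<open>From generic points to the four identities\<close>

lemma generic_U_regular:
  assumes "eventually (shift_regular (G_L ap am) (adelta ap am d) (\<i> * of_real (adelta ap am (\<not> d)))) (cosparse UNIV)"
  shows "generic (\<lambda>(x, y :: nat \<Rightarrow> complex). U_regular N ap am eta d x)"
proof -
  let ?R = "shift_regular (G_L ap am) (adelta ap am d) (\<i> * of_real (adelta ap am (\<not> d)))"
  have "generic (\<lambda>p. \<forall>m\<in>{m\<in>{..<N}. nxt N m \<noteq> m}. (\<lambda>(x, y :: nat \<Rightarrow> complex). ?R (x (nxt N m) - x m + of_real eta)) p)"
    by (rule generic_Ball) (use generic_diff_fst[OF assms] in auto)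
  then show ?thesis
    by (rule generic_mono) (auto simp: U_regular_def)
qed

lemma generic_kernel_regular:
  assumes "eventually (shift_regular g r c) (cosparse UNIV)"
  shows "generic (\<lambda>(x, y). kernel_regular g r N c s x y)"
proof -
  have "generic (\<lambda>p. \<forall>m\<in>{..<N}. (\<lambda>(x, y). shift_regular g r c (x m - y (prv N m) + s)) p
       \<and> (\<lambda>(x, y). shift_regular g r c (y m - x m + s)) p)"
  proof (intro generic_Ball generic_conj)
    show "generic (\<lambda>(x, y). shift_regular g r c (x m - y (prv N m) + s))" for m :: nat
      by (rule generic_diff_mixed[OF assms])
    show "generic (\<lambda>(x, y). shift_regular g r c (y m - x m + s))" for m :: nat
      by (rule generic_swap[where P = "\<lambda>x y. shift_regular g r c (x m - y m + s)", OF generic_diff_mixed[OF assms]])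
  qed simp
  then show ?thesis
    by (rule generic_mono) (auto simp: kernel_regular_def)
qed

lemma kernel_identitiesI:
  assumes reg: "eventually (shift_regular (G_L ap am) (adelta ap am d) (\<i> * of_real (adelta ap am (\<not> d)))) (cosparse UNIV)"
    and nz: "G_L ap am (of_real eta) \<noteq> 0" and sq: "\<forall>x. (sq x)\<^sup>2 = Ufun N ap am eta x"
    and plus: "generic (\<lambda>(x, y). Aplus N ap am eta d l (\<lambda>x'. Kp x' y) x = Aplus N ap am eta d (- l) (\<lambda>y'. Kp x y') y)"
    and minus: "generic (\<lambda>(x, y). Aminus N ap am eta d l (\<lambda>x'. Km x' y) x = Aminus N ap am eta d (- l) (\<lambda>y'. Km x y') y)"
  shows "kernel_identities sq N ap am eta d l Kp Km"
proof -
  note U = generic_conj[OF generic_U_regular[OF reg, where N = N and eta = eta]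
      generic_swap[OF generic_U_regular[OF reg, where N = N and eta = eta]]]
  have "generic (\<lambda>(x, y). Hop sq N ap am eta d l (\<lambda>x'. Kp x' y / (sq x' * sq y)) x
       = Hop sq N ap am eta d (- l) (\<lambda>y'. Kp x y' / (sq x * sq y')) y)"
  proof (rule generic_mono[OF generic_conj[OF plus U]], clarify)
    fix x y
    assume "Aplus N ap am eta d l (\<lambda>x'. Kp x' y) x = Aplus N ap am eta d (- l) (\<lambda>y'. Kp x y') y"
      "U_regular N ap am eta d x" "U_regular N ap am eta d y"
    then show "Hop sq N ap am eta d l (\<lambda>x'. Kp x' y / (sq x' * sq y)) x
       = Hop sq N ap am eta d (- l) (\<lambda>y'. Kp x y' / (sq x * sq y')) y"
      using Hop_Aplus[OF nz _ sq, of d x l "\<lambda>x'. Kp x' y" "sq y"]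
        Hop_Aplus[OF nz _ sq, of d y "- l" "\<lambda>y'. Kp x y'" "sq x"]
      by (simp only: mult.commute)
  qed
  moreover have "generic (\<lambda>(x, y). Hop sq N ap am eta d l (\<lambda>x'. sq x' * sq y * Km x' y) x
       = Hop sq N ap am eta d (- l) (\<lambda>y'. sq x * sq y' * Km x y') y)"
  proof (rule generic_mono[OF generic_conj[OF minus U]], clarify)
    fix x y
    assume "Aminus N ap am eta d l (\<lambda>x'. Km x' y) x = Aminus N ap am eta d (- l) (\<lambda>y'. Km x y') y"
      "U_regular N ap am eta d x" "U_regular N ap am eta d y"
    then show "Hop sq N ap am eta d l (\<lambda>x'. sq x' * sq y * Km x' y) x
       = Hop sq N ap am eta d (- l) (\<lambda>y'. sq x * sq y' * Km x y') y"
      using Hop_Aminus[OF nz _ sq, of d x l "sq y" "\<lambda>x'. Km x' y"]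
        Hop_Aminus[OF nz _ sq, of d y "- l" "sq x" "\<lambda>y'. Km x y'"]
      by (simp only: mult.commute[of "sq x"])
  qed
  ultimately show ?thesis
    using plus minus unfolding kernel_identities_def mero_zero_iff_generic
    by (simp add: case_prod_unfold)
qed

lemma kernel_identities_all:
  assumes pos: "ap > 0" "am > 0" and l: "l \<noteq> 0" "\<bar>l\<bar> \<le> int N"
    and sq: "\<forall>x. (sq x)\<^sup>2 = Ufun N ap am eta x"
    and GR: "\<And>z. G_R ap am z = 1 / G_L ap am (- z)"
    and reg: "eventually (shift_regular (G_L ap am) (adelta ap am d) (\<i> * of_real (adelta ap am (\<not> d)))) (cosparse UNIV)"
    and nz: "G_L ap am (of_real eta) \<noteq> 0"
  shows "kernel_identities sq N ap am eta d l (Splus N ap am eta) (Sminus N ap am eta)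
       \<and> kernel_identities sq N ap am eta d l
           (\<lambda>x y. Splus N ap am eta y x) (\<lambda>x y. Sminus N ap am eta y x)
       \<and> (\<forall>j. kernel_identities sq N ap am eta d l
           (\<lambda>x y. Splus N ap am eta (rot N j x) y) (\<lambda>x y. Sminus N ap am eta (rot N j x) y))"
proof -
  have N: "N > 0" using l by auto
  have r: "adelta ap am d > 0" using pos by (simp add: adelta_def)
  have plus_pos: "generic (\<lambda>(x, y). Aplus N ap am eta d l (\<lambda>x'. Splus N ap am eta x' y) x
      = Aplus N ap am eta d (- l) (\<lambda>y'. Splus N ap am eta x y') y)" if "l > 0" for l
    by (rule generic_mono[OF generic_kernel_regular[OF reg]])
       (use Aplus_Splus_pos[OF GR r N that refl refl] in auto)
  have minus_pos: "generic (\<lambda>(x, y). Aminus N ap am eta d l (\<lambda>x'. Sminus N ap am eta x' y) x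
      = Aminus N ap am eta d (- l) (\<lambda>y'. Sminus N ap am eta x y') y)" if "l > 0" "l \<le> int N" for l
    by (rule generic_mono[OF generic_kernel_regular[OF reg]])
       (use Aminus_Sminus_pos[OF GR r N that refl refl] in auto)
  have Srot: "Splus N ap am eta x y = Splus N ap am eta y (rot N 1 x)"
    "Sminus N ap am eta x y = Sminus N ap am eta y (rot N 1 x)" for x y
    unfolding Splus_eq_kernel_prod[OF GR] Sminus_eq_kernel_prod[OF GR] by (subst kernel_prod_rot, rule refl)+
  have plus: "generic (\<lambda>(x, y). Aplus N ap am eta d l (\<lambda>x'. Splus N ap am eta x' y) x
      = Aplus N ap am eta d (- l) (\<lambda>y'. Splus N ap am eta x y') y)" if "l \<noteq> 0" for l
  proof (cases "l > 0")
    case False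
    with that have "- l > 0" by simp
    \<comment> \<open>For negative \<open>l\<close> the identity with \<open>- l\<close> is used
      with \<open>y\<close> in the role of \<open>x\<close> and the rotated \<open>x\<close> in the
      role of \<open>y\<close>; the rotation symmetry of the kernel restores the original
      arrangement.\<close>
    from generic_rot_fst[OF generic_swap[OF plus_pos[OF this]], of N] show ?thesis
    proof (rule generic_mono, clarify)
      fix x y
      assume "Aplus N ap am eta d (- l) (\<lambda>y'. Splus N ap am eta y' (rot N 1 x)) y
        = Aplus N ap am eta d (- (- l)) (\<lambda>x'. Splus N ap am eta y x') (rot N 1 x)"
      then show "Aplus N ap am eta d l (\<lambda>x'. Splus N ap am eta x' y) x
        = Aplus N ap am eta d (- l) (\<lambda>y'. Splus N ap am eta x y') y"
        unfolding Aplus_rot minus_minus Srot[symmetric] by (rule sym)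
    qed
  qed (rule plus_pos)
  have minus: "generic (\<lambda>(x, y). Aminus N ap am eta d l (\<lambda>x'. Sminus N ap am eta x' y) x
      = Aminus N ap am eta d (- l) (\<lambda>y'. Sminus N ap am eta x y') y)" if "l \<noteq> 0" "\<bar>l\<bar> \<le> int N" for l
  proof (cases "l > 0")
    case True
    then show ?thesis using that minus_pos by simp
  next
    case False
    with that have "- l > 0" "- l \<le> int N" by auto
    from generic_rot_fst[OF generic_swap[OF minus_pos[OF this]], of N] show ?thesis
    proof (rule generic_mono, clarify)
      fix x y
      assume "Aminus N ap am eta d (- l) (\<lambda>y'. Sminus N ap am eta y' (rot N 1 x)) y
        = Aminus N ap am eta d (- (- l)) (\<lambda>x'. Sminus N ap am eta y x') (rot N 1 x)"
      then show "Aminus N ap am eta d l (\<lambda>x'. Sminus N ap am eta x' y) x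
        = Aminus N ap am eta d (- l) (\<lambda>y'. Sminus N ap am eta x y') y"
        unfolding Aminus_rot minus_minus Srot[symmetric] by (rule sym)
    qed
  qed
  have plus_rot: "generic (\<lambda>(x, y). Aplus N ap am eta d l (\<lambda>x'. Splus N ap am eta (rot N j x') y) x
      = Aplus N ap am eta d (- l) (\<lambda>y'. Splus N ap am eta (rot N j x) y') y)" for j
  proof (induction j)
    case 0
    show ?case using plus[OF l(1)] by (simp add: rot_0)
  next
    case (Suc j)
    from generic_rot_fst[OF this, of N] show ?case
      unfolding Aplus_rot rot_rot Suc_eq_plus1 .
  qed
  have minus_rot: "generic (\<lambda>(x, y). Aminus N ap am eta d l (\<lambda>x'. Sminus N ap am eta (rot N j x') y) x
      = Aminus N ap am eta d (- l) (\<lambda>y'. Sminus N ap am eta (rot N j x) y') y)" for j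
  proof (induction j)
    case 0
    show ?case using minus[OF l] by (simp add: rot_0)
  next
    case (Suc j)
    from generic_rot_fst[OF this, of N] show ?case
      unfolding Aminus_rot rot_rot Suc_eq_plus1 .
  qed
  have "generic (\<lambda>(x, y). Aplus N ap am eta d l (\<lambda>x'. Splus N ap am eta y x') x
      = Aplus N ap am eta d (- l) (\<lambda>y'. Splus N ap am eta y' x) y)"
    by (rule generic_mono[OF generic_swap[OF plus[of "- l"]]]) (use l in auto)
  moreover have "generic (\<lambda>(x, y). Aminus N ap am eta d l (\<lambda>x'. Sminus N ap am eta y x') x
      = Aminus N ap am eta d (- l) (\<lambda>y'. Sminus N ap am eta y' x) y)"
    by (rule generic_mono[OF generic_swap[OF minus[of "- l"]]]) (use l in auto)
  ultimately show ?thesis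
    using plus[OF l(1)] minus[OF l] plus_rot minus_rot
    by (intro conjI allI kernel_identitiesI[OF reg nz sq]) simp_all
qed

section \<open>The exponent of the hyperbolic gamma function\<close>

text \<open>Only \<open>f\<close> needs an integrable bound: Cauchy's inequality transfers it to the
  derivative and so to the difference quotients, and dominated convergence applies to these.\<close>

lemma has_field_derivative_integral_param:
  fixes f :: "complex \<Rightarrow> 'a \<Rightarrow> complex"
  assumes U: "open U" and hol: "\<And>y. y \<in> space M \<Longrightarrow> (\<lambda>z. f z y) holomorphic_on U"
    and meas: "\<And>z. z \<in> U \<Longrightarrow> f z \<in> borel_measurable M"
    and bound: "\<And>z y. z \<in> U \<Longrightarrow> y \<in> space M \<Longrightarrow> norm (f z y) \<le> B y"
    and B: "integrable M B" and z: "z \<in> U"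
  shows "((\<lambda>z. \<integral>y. f z y \<partial>M) has_field_derivative (\<integral>y. deriv (\<lambda>z. f z y) z \<partial>M)) (at z)"
proof -
  obtain e where e: "e > 0" "cball z e \<subseteq> U" using U z open_contains_cball by blast
  \<comment> \<open>Half the radius, so that closed balls of radius \<open>r\<close> about points of
    \<open>ball z r\<close> still lie in \<open>U\<close>.\<close>
  define r where "r = e / 2"
  have r: "r > 0" using e(1) by (simp add: r_def)
  have rU: "cball w r \<subseteq> U" if "w \<in> ball z r" for w
  proof
    fix x assume "x \<in> cball w r"
    then have "dist z x \<le> e" using that dist_triangle[of z x w] by (simp add: r_def)
    then show "x \<in> U" using e(2) by auto
  qed
  have zr: "ball z r \<subseteq> U" using e r by (auto simp: r_def)
  have int: "integrable M (f w)" if "w \<in> U" for w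
    using bound[OF that] by (intro Bochner_Integration.integrable_bound[OF B meas[OF that]] AE_I2) force
  have der: "((\<lambda>z. f z y) has_field_derivative deriv (\<lambda>z. f z y) w) (at w)" if "w \<in> U" "y \<in> space M" for w y
    using holomorphic_derivI[OF hol[OF that(2)] U that(1)] .
  have dbound: "norm (deriv (\<lambda>z. f z y) w) \<le> B y / r" if w: "w \<in> ball z r" and y: "y \<in> space M" for w y
  proof -
    have "norm ((deriv ^^ 1) (\<lambda>z. f z y) w) \<le> fact 1 * B y / r ^ 1"
    proof (rule Cauchy_inequality)
      show "(\<lambda>z. f z y) holomorphic_on ball w r"
        using rU[OF w] hol[OF y] by (meson ball_subset_cball holomorphic_on_subset order_trans)
      show "continuous_on (cball w r) (\<lambda>z. f z y)"
        using rU[OF w] hol[OF y] by (meson holomorphic_on_imp_continuous_on holomorphic_on_subset)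
      show "norm (f x y) \<le> B y" if "norm (w - x) = r" for x
        using that rU[OF w] bound[OF _ y] by (auto simp: dist_norm subset_iff)
    qed (rule r)
    then show ?thesis by simp
  qed
  have quot: "norm ((f w y - f z y) / (w - z)) \<le> B y / r" if w: "w \<in> ball z r" and y: "y \<in> space M" for w y
  proof (cases "w = z")
    case False
    have "norm (f w y - f z y) \<le> B y / r * norm (w - z)"
    proof (rule field_differentiable_bound[where S = "ball z r" and f' = "deriv (\<lambda>z. f z y)"])
      show "((\<lambda>z. f z y) has_field_derivative deriv (\<lambda>z. f z y) v) (at v within ball z r)" if "v \<in> ball z r" for v
        using der[OF _ y] zr that by (blast intro: has_field_derivative_at_within)
    qed (use w r dbound y in auto)
    then show ?thesis using False r by (simp add: norm_divide divide_simps)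
  qed (use order_trans[OF norm_ge_zero dbound[OF _ y, of z]] r in auto)
  have "((\<lambda>w. ((\<integral>y. f w y \<partial>M) - (\<integral>y. f z y \<partial>M)) / (w - z)) \<longlongrightarrow> (\<integral>y. deriv (\<lambda>z. f z y) z \<partial>M)) (at z)"
    unfolding tendsto_at_iff_sequentially
  proof (intro allI impI)
    fix X :: "nat \<Rightarrow> complex" assume X: "\<forall>i. X i \<in> UNIV - {z}" "X \<longlonglongrightarrow> z"
    then obtain n where n: "\<And>i. i \<ge> n \<Longrightarrow> X i \<in> ball z r"
      using r by (metis LIMSEQ_iff_nz dist_commute dist_norm mem_ball metric_LIMSEQ_D)
    define Y where "Y = (\<lambda>i. X (i + n))"
    have Y: "Y i \<in> ball z r" "Y i \<noteq> z" "Y i \<in> U" for i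
      using n X zr by (auto simp: Y_def)
    have Yz: "Y \<longlonglongrightarrow> z" unfolding Y_def using X(2) by (rule LIMSEQ_ignore_initial_segment)
    have lim: "(\<lambda>i. (f (Y i) y - f z y) / (Y i - z)) \<longlonglongrightarrow> deriv (\<lambda>z. f z y) z" if "y \<in> space M" for y
    proof -
      have "((\<lambda>w. (f w y - f z y) / (w - z)) \<longlongrightarrow> deriv (\<lambda>z. f z y) z) (at z)"
        using der[OF z that] by (simp add: has_field_derivative_iff)
      from this[unfolded tendsto_at_iff_sequentially, rule_format, of Y] show ?thesis
        using Y Yz by (simp add: o_def)
    qed
    have ms: "(\<lambda>y. (f (Y i) y - f z y) / (Y i - z)) \<in> borel_measurable M" for i
      using meas[OF Y(3)] meas[OF z] by measurable
    have "(\<lambda>i. \<integral>y. (f (Y i) y - f z y) / (Y i - z) \<partial>M) \<longlonglongrightarrow> (\<integral>y. deriv (\<lambda>z. f z y) z \<partial>M)"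
    proof (rule integral_dominated_convergence[where w = "\<lambda>y. B y / r"])
      show "(\<lambda>y. deriv (\<lambda>z. f z y) z) \<in> borel_measurable M"
        by (rule borel_measurable_LIMSEQ_metric[OF ms lim])
    qed (use B ms lim quot Y in auto)
    also have "(\<lambda>i. \<integral>y. (f (Y i) y - f z y) / (Y i - z) \<partial>M) =
        (\<lambda>i. ((\<integral>y. f (Y i) y \<partial>M) - (\<integral>y. f z y \<partial>M)) / (Y i - z))"
      using int Y z by (simp add: Bochner_Integration.integral_diff)
    finally have "(\<lambda>i. ((\<lambda>w. ((\<integral>y. f w y \<partial>M) - (\<integral>y. f z y \<partial>M)) / (w - z)) \<circ> X) (i + n)) \<longlonglongrightarrow> (\<integral>y. deriv (\<lambda>z. f z y) z \<partial>M)"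
      by (simp add: Y_def o_def)
    then show "((\<lambda>w. ((\<integral>y. f w y \<partial>M) - (\<integral>y. f z y \<partial>M)) / (w - z)) \<circ> X) \<longlonglongrightarrow> (\<integral>y. deriv (\<lambda>z. f z y) z \<partial>M)"
      by (rule LIMSEQ_offset)
  qed
  then show ?thesis by (simp add: has_field_derivative_iff)
qed

section \<open>Integrals over the half line\<close>

abbreviation half_line :: "real measure" where "half_line \<equiv> restrict_space lborel {0<..}"

lemma space_half_line: "space half_line = {0<..}"
  by (simp add: space_restrict_space)

lemma half_line_measurable:
  fixes f :: "real \<Rightarrow> 'a::topological_space"
  assumes "continuous_on {0<..} f"
  shows "f \<in> borel_measurable half_line"
proof -
  have "f \<in> borel_measurable (restrict_space borel {0<..})"
    by (rule borel_measurable_continuous_on_restrict[OF assms])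
  then show ?thesis
    by (subst measurable_cong_sets[OF sets_restrict_space_cong[OF sets_lborel] refl])
qed

lemma half_line_integrable_iff:
  fixes f :: "real \<Rightarrow> 'a::{banach, second_countable_topology}"
  shows "integrable half_line f \<longleftrightarrow> set_integrable lborel {0<..} f"
  unfolding set_integrable_def by (rule integrable_restrict_space) simp

text \<open>\<open>G_strip\<close> is stated with the gauge integral, whereas the convergence
  theorems concern the Lebesgue integral; absolute integrability reconciles the two.\<close>

lemma half_line_integral_eq:
  fixes f :: "real \<Rightarrow> 'a::euclidean_space"
  assumes "integrable half_line f"
  shows "integral {0<..} f = integral\<^sup>L half_line f"
proof -
  have "integral\<^sup>L half_line f = (LINT x:{0<..}|lborel. f x)"
    unfolding set_lebesgue_integral_def by (rule integral_restrict_space) simp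
  then show ?thesis
    using set_borel_integral_eq_integral(2)[of "{0<..}" f] assms by (simp add: half_line_integrable_iff)
qed

lemma half_line_integrable_square: "integrable half_line (\<lambda>y. C / (1 + y\<^sup>2))"
proof -
  have "set_integrable lborel {0<..} (\<lambda>x::real. 1 / (1 + x^2))"
    using integrable_I0i_1_div_plus_square
    by (simp add: interval_lebesgue_integrable_def zero_ereal_def)
  then have "integrable half_line (\<lambda>y. C * (1 / (1 + y\<^sup>2)))"
    unfolding half_line_integrable_iff[symmetric] by (rule integrable_mult_right)
  then show ?thesis by simp
qed

lemma half_line_integrable_exp: "u > 0 \<Longrightarrow> integrable half_line (\<lambda>y. exp (- (y * u)))"
  using integrable_I0i_exp_mscale[of u] by (simp add: half_line_integrable_iff)

lemma half_line_integrable_bound: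
  fixes f :: "real \<Rightarrow> 'a::{banach, second_countable_topology}"
  assumes "continuous_on {0<..} f" "integrable half_line B" "\<And>y. y > 0 \<Longrightarrow> norm (f y) \<le> B y"
  shows "integrable half_line f"
proof (rule Bochner_Integration.integrable_bound[OF assms(2) half_line_measurable[OF assms(1)]], rule AE_I2)
  fix y assume "y \<in> space half_line"
  then have "norm (f y) \<le> B y" using assms(3) by (simp add: space_half_line)
  then show "norm (f y) \<le> norm (B y)" by simp
qed

lemma norm_sin_le: "norm (sin z) \<le> exp \<bar>Im z\<bar>"
proof -
  have "norm (sin z) = norm (exp (\<i> * z) - exp (- (\<i> * z))) / 2"
    by (simp add: sin_exp_eq norm_divide norm_mult)
  also have "\<dots> \<le> (norm (exp (\<i> * z)) + norm (exp (- (\<i> * z)))) / 2"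
    by (intro divide_right_mono norm_triangle_ineq4) simp
  also have "\<dots> = (exp (- Im z) + exp (Im z)) / 2" by simp
  also have "\<dots> \<le> exp \<bar>Im z\<bar>"
    by (auto simp: abs_if)
  finally show ?thesis .
qed

lemma norm_sin_minus_le: "norm (sin z - z) \<le> exp \<bar>Im z\<bar> * norm z ^ 3 / 2"
proof -
  have "(\<Sum>k\<le>2. complex_of_real (sin_coeff k) * z ^ k) = z"
    by (simp add: sin_coeff_def numeral_2_eq_2)
  then show ?thesis using Taylor_sin[of z 2] by (simp add: numeral_2_eq_2 numeral_3_eq_3)
qed

definition G_integrand :: "real \<Rightarrow> real \<Rightarrow> complex \<Rightarrow> real \<Rightarrow> complex" where
  "G_integrand ap am z y = (1 / of_real y) *
        (sin (2 * of_real y * z) / (2 * of_real (sinh (ap * y) * sinh (am * y)))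
         - z / of_real (ap * am * y))"

lemma sinh_ge_exp:
  fixes t t0 :: real
  assumes "t \<ge> t0"
  shows "sinh t \<ge> (1 - exp (-2 * t0)) / 2 * exp t"
proof -
  have "exp (- t) \<le> exp (-2 * t0) * exp t"
    using assms by (simp flip: exp_add)
  then show ?thesis by (simp add: sinh_field_def algebra_simps divide_simps)
qed

lemma sinh_real_ge: "t \<ge> 0 \<Longrightarrow> sinh (t::real) \<ge> t"
proof -
  assume "t \<ge> 0"
  then have "(\<lambda>t::real. sinh t - t) 0 \<le> (\<lambda>t. sinh t - t) t"
  proof (rule DERIV_nonneg_imp_nondecreasing)
    fix x :: real
    have "((\<lambda>t. sinh t - t) has_real_derivative (cosh x - 1)) (at x)"
      by (auto intro!: derivative_eq_intros)
    then show "\<exists>y. ((\<lambda>t. sinh t - t) has_real_derivative y) (at x) \<and> 0 \<le> y"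
      using cosh_real_ge_1[of x] by force
  qed
  then show ?thesis by simp
qed

lemma inverse_sinh_product_asymp:
  assumes "ap > 0" "am > 0"
  shows "(\<lambda>y::real. 1 / y * (y / (sinh (ap * y) * sinh (am * y)) - 1 / (ap * am * y))) \<in> O[at_right 0](\<lambda>_. 1)"
  using assms by real_asymp

text \<open>Near 0 the subtracted term of the integrand cancels the singularity. Far out, the
  product of the two \<open>sinh\<close> grows like \<open>exp (2 * ahalf ap am * y)\<close>, while
  the sine is at most \<open>exp (2 * y * (ahalf ap am - \<rho>))\<close>; the surplus
  \<open>exp (- 2 * \<rho> * y)\<close> is estimated by a multiple of
  \<open>1 / y\<^sup>2\<close>.\<close>

lemma G_integrand_bound:
  assumes pos: "ap > 0" "am > 0" and R: "R > 0" and \<rho>: "\<rho> > 0"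
  obtains C where "\<And>z y. norm z \<le> R \<Longrightarrow> \<bar>Im z\<bar> \<le> ahalf ap am - \<rho> \<Longrightarrow> y > 0 \<Longrightarrow>
    norm (G_integrand ap am z y) \<le> C / (1 + y\<^sup>2)"
proof -
  define s where "s = (\<lambda>y. sinh (ap * y) * sinh (am * y))"
  define h where "h = (\<lambda>y::real. 1 / y * (y / s y - 1 / (ap * am * y)))"
  have s_ge: "s y \<ge> ap * am * y\<^sup>2" if "y > 0" for y
    using mult_mono[OF sinh_real_ge[of "ap * y"] sinh_real_ge[of "am * y"]] that pos
    by (simp add: s_def power2_eq_square mult_ac)
  have s_pos: "s y > 0" if "y > 0" for y
    using that pos by (simp add: s_def)
  obtain C1 where "eventually (\<lambda>y. norm (h y) \<le> C1 * norm (1::real)) (at_right 0)"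
    using inverse_sinh_product_asymp[OF pos] unfolding h_def s_def
    by (elim landau_o.bigE)
  then obtain e0 where e0: "e0 > 0" "\<And>y. 0 < y \<Longrightarrow> y < e0 \<Longrightarrow> \<bar>h y\<bar> \<le> C1"
    by (auto simp: eventually_at_right_field)
  define e where "e = min e0 1 / 2"
  have e: "e > 0" "e \<le> 1" "\<And>y. 0 < y \<Longrightarrow> y \<le> e \<Longrightarrow> \<bar>h y\<bar> \<le> C1"
    using e0 by (auto simp: e_def)
  define C2 where "C2 = 2 * R ^ 3 * exp (2 * R) / (ap * am) + R * C1"
  have near: "norm (G_integrand ap am z y) \<le> C2" if z: "norm z \<le> R" and y: "0 < y" "y \<le> e" for z y
  proof -
    let ?w = "2 * of_real y * z"
    have y1: "y \<le> 1" using y e by simp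
    \<comment> \<open>The linear part of the sine joins the subtracted term to form
      \<open>z * h y\<close> with \<open>h\<close> bounded; the cubic remainder is matched by the
      factor \<open>y * s y\<close>, which is at least \<open>ap * am * y ^ 3\<close>.\<close>
    have eq: "G_integrand ap am z y = (sin ?w - ?w) / of_real (2 * y * s y) + z * of_real (h y)"
    proof -
      have "G_integrand ap am z y = 1 / of_real y * (sin ?w / (2 * of_real (s y)) - z / of_real (ap * am * y))"
        by (simp only: G_integrand_def s_def)
      then show ?thesis
        using y pos s_pos[OF y(1)] unfolding h_def by (simp add: field_simps)
    qed
    have w: "norm ?w \<le> 2 * R * y" using z y by (simp add: norm_mult mult_mono mult_ac)
    have "\<bar>Im ?w\<bar> \<le> norm ?w" by (rule abs_Im_le_cmod)
    also have "\<dots> \<le> 2 * R" using w y1 R by (meson mult_left_le order_trans less_imp_le mult_pos_pos zero_less_numeral)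
    finally have im: "\<bar>Im ?w\<bar> \<le> 2 * R" .
    have "norm (sin ?w - ?w) \<le> exp \<bar>Im ?w\<bar> * norm ?w ^ 3 / 2" by (rule norm_sin_minus_le)
    also have "\<dots> \<le> exp (2 * R) * (2 * R * y) ^ 3 / 2"
      using im w by (intro divide_right_mono mult_mono power_mono) auto
    finally have n: "norm (sin ?w - ?w) \<le> 4 * R ^ 3 * exp (2 * R) * y ^ 3"
      by (simp add: power_mult_distrib mult_ac)
    have "norm ((sin ?w - ?w) / of_real (2 * y * s y)) \<le> (4 * R ^ 3 * exp (2 * R) * y ^ 3) / (2 * y * (ap * am * y\<^sup>2))"
      unfolding norm_divide using n s_ge[OF y(1)] y pos R s_pos[OF y(1)]
      by (intro frac_le) (auto simp: norm_mult)
    also have "\<dots> = 2 * R ^ 3 * exp (2 * R) / (ap * am)"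
      using y pos by (simp add: field_simps power2_eq_square power3_eq_cube)
    finally have a: "norm ((sin ?w - ?w) / of_real (2 * y * s y)) \<le> 2 * R ^ 3 * exp (2 * R) / (ap * am)" .
    have b: "norm (z * of_real (h y)) \<le> R * C1"
      unfolding norm_mult using z e(3)[OF y] R by (intro mult_mono) auto
    show ?thesis unfolding eq C2_def by (rule norm_triangle_mono[OF a b])
  qed
  define k where "k = (1 - exp (-2 * (ap * e))) / 2 * ((1 - exp (-2 * (am * e))) / 2)"
  have k: "k > 0" using pos e by (simp add: k_def)
  define C3 where "C3 = 1 / (e * 2 * k) / (2 * \<rho>\<^sup>2) + R / (ap * am)"
  have far: "norm (G_integrand ap am z y) \<le> C3 / y\<^sup>2"
    if z: "norm z \<le> R" "\<bar>Im z\<bar> \<le> ahalf ap am - \<rho>" and y: "y \<ge> e" for z y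
  proof -
    have y0: "y > 0" using y e by simp
    have "k * exp (2 * ahalf ap am * y) = ((1 - exp (-2 * (ap * e))) / 2 * exp (ap * y)) * ((1 - exp (-2 * (am * e))) / 2 * exp (am * y))"
    proof -
      have "exp (2 * ahalf ap am * y) = exp (ap * y) * exp (am * y)"
        by (simp add: ahalf_def algebra_simps flip: exp_add)
      then show ?thesis by (simp only: k_def mult_ac)
    qed
    also have "\<dots> \<le> s y"
      unfolding s_def using y y0 pos e by (intro mult_mono sinh_ge_exp) auto
    finally have sk: "k * exp (2 * ahalf ap am * y) \<le> s y" .
    have "norm (sin (2 * of_real y * z)) \<le> exp \<bar>Im (2 * of_real y * z)\<bar>" by (rule norm_sin_le)
    also have "\<dots> = exp (2 * y * \<bar>Im z\<bar>)" using y0 by (simp add: abs_mult)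
    also have "\<dots> \<le> exp (2 * y * (ahalf ap am - \<rho>))" using z y0 by simp
    finally have sn: "norm (sin (2 * of_real y * z)) \<le> exp (2 * y * (ahalf ap am - \<rho>))" .
    have "norm (sin (2 * of_real y * z) / (2 * of_real (s y))) \<le>
        exp (2 * y * (ahalf ap am - \<rho>)) / (2 * (k * exp (2 * ahalf ap am * y)))"
      unfolding norm_divide using sn sk k s_pos[OF y0] by (intro frac_le) (auto simp: norm_mult)
    also have "\<dots> = exp (- (2 * \<rho> * y)) / (2 * k)"
      using k by (simp add: field_simps flip: exp_add)
    also have "\<dots> \<le> (1 / (2 * \<rho>\<^sup>2 * y\<^sup>2)) / (2 * k)"
    proof (intro divide_right_mono)
      have "(2 * \<rho> * y)\<^sup>2 / 2 \<le> exp (2 * \<rho> * y)"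
      proof -
        have "0 \<le> 2 * \<rho> * y" using \<rho> y0 by simp
        from exp_lower_Taylor_quadratic[OF this] this show ?thesis by linarith
      qed
      then show "exp (- (2 * \<rho> * y)) \<le> 1 / (2 * \<rho>\<^sup>2 * y\<^sup>2)"
        using \<rho> y0 by (simp add: exp_minus field_simps power_mult_distrib)
    qed (use k in simp)
    finally have a: "norm (sin (2 * of_real y * z) / (2 * of_real (s y))) \<le> (1 / (2 * \<rho>\<^sup>2 * y\<^sup>2)) / (2 * k)" .
    have "norm (1 / of_real y * (sin (2 * of_real y * z) / (2 * of_real (s y)))) \<le> 1 / e * ((1 / (2 * \<rho>\<^sup>2 * y\<^sup>2)) / (2 * k))"
      unfolding norm_mult using a e y0 y by (intro mult_mono) (auto simp: norm_divide intro!: divide_left_mono)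
    moreover have "norm (z / of_real (ap * am * y) * (1 / of_real y)) \<le> R / (ap * am * y\<^sup>2)"
      using z y0 pos by (simp add: norm_mult norm_divide power2_eq_square abs_mult divide_right_mono mult_ac)
    ultimately have "norm (1 / of_real y * (sin (2 * of_real y * z) / (2 * of_real (s y))) - z / of_real (ap * am * y) * (1 / of_real y))
       \<le> 1 / e * ((1 / (2 * \<rho>\<^sup>2 * y\<^sup>2)) / (2 * k)) + R / (ap * am * y\<^sup>2)"
      using norm_triangle_ineq4 order_trans add_mono by meson
    also have "\<dots> = C3 / y\<^sup>2"
      using y0 by (simp add: C3_def add_divide_distrib mult_ac)
    finally show ?thesis unfolding G_integrand_def s_def by (simp add: right_diff_distrib mult.commute)
  qed
  \<comment> \<open>On \<open>y \<le> e\<close> one has \<open>1 + y\<^sup>2 \<le> 2\<close>, and on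
    \<open>y \<ge> e\<close> one has
    \<open>1 + y\<^sup>2 \<le> (1 + 1 / e\<^sup>2) * y\<^sup>2\<close>; the two factors in
    \<open>C\<close> convert both bounds to \<open>1 / (1 + y\<^sup>2)\<close>.\<close>
  define C where "C = max (2 * \<bar>C2\<bar>) (\<bar>C3\<bar> * (1 + 1 / e\<^sup>2))"
  show ?thesis
  proof (rule that[of C])
    fix z y assume z: "norm z \<le> R" "\<bar>Im z\<bar> \<le> ahalf ap am - \<rho>" and y: "(y::real) > 0"
    show "norm (G_integrand ap am z y) \<le> C / (1 + y\<^sup>2)"
    proof (cases "y \<le> e")
      case True
      have "y\<^sup>2 \<le> 1" using True y e by (simp add: power_le_one)
      then have "\<bar>C2\<bar> * (1 + y\<^sup>2) \<le> \<bar>C2\<bar> * 2" by (intro mult_left_mono) auto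
      also have "\<dots> \<le> C" by (simp add: C_def mult.commute)
      finally have "\<bar>C2\<bar> \<le> C / (1 + y\<^sup>2)"
        by (simp add: pos_le_divide_eq add_pos_nonneg)
      then show ?thesis using near[OF z(1) y True] by simp
    next
      case False
      then have ye: "y \<ge> e" by simp
      have "e\<^sup>2 \<le> y\<^sup>2" using ye e by (simp add: power_mono)
      then have "1 + y\<^sup>2 \<le> (1 + 1 / e\<^sup>2) * y\<^sup>2" using e by (simp add: field_simps)
      then have "\<bar>C3\<bar> * (1 + y\<^sup>2) \<le> \<bar>C3\<bar> * ((1 + 1 / e\<^sup>2) * y\<^sup>2)" by (intro mult_left_mono) auto
      also have "\<dots> \<le> C * y\<^sup>2" unfolding mult.assoc[symmetric] by (intro mult_right_mono) (auto simp: C_def)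
      finally have "\<bar>C3\<bar> / y\<^sup>2 \<le> C / (1 + y\<^sup>2)"
        using y by (simp add: divide_simps add_pos_nonneg mult_ac)
      moreover have "C3 / y\<^sup>2 \<le> \<bar>C3\<bar> / y\<^sup>2" by (intro divide_right_mono) auto
      ultimately show ?thesis using far[OF z ye] by linarith
    qed
  qed
qed

lemma continuous_on_G_integrand:
  assumes "ap > 0" "am > 0"
  shows "continuous_on {0<..} (G_integrand ap am z)"
  unfolding G_integrand_def using assms by (intro continuous_intros) auto

lemma holomorphic_G_integrand: "(\<lambda>z. G_integrand ap am z y) holomorphic_on S"
  unfolding G_integrand_def
  by (cases "ap * am * y = 0"; cases "sinh (ap * y) * sinh (am * y) = 0"; cases "y = 0")
     (auto intro!: holomorphic_intros)

definition G_strip_set :: "real \<Rightarrow> real \<Rightarrow> complex set" where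
  "G_strip_set ap am = {z. \<bar>Im z\<bar> < ahalf ap am}"

lemma open_G_strip_set: "open (G_strip_set ap am)"
  unfolding G_strip_set_def by (intro open_Collect_less continuous_intros)

lemma G_integrand_local_bound:
  assumes "ap > 0" "am > 0" "z \<in> G_strip_set ap am"
  obtains r C where "r > 0" "ball z r \<subseteq> G_strip_set ap am"
    "\<And>w y. w \<in> ball z r \<Longrightarrow> y > 0 \<Longrightarrow> norm (G_integrand ap am w y) \<le> C / (1 + y\<^sup>2)"
proof -
  define \<rho> where "\<rho> = (ahalf ap am - \<bar>Im z\<bar>) / 2"
  have \<rho>: "\<rho> > 0" using assms by (simp add: \<rho>_def G_strip_set_def)
  have R: "norm z + \<rho> > 0" using \<rho> norm_ge_zero[of z] by linarith
  obtain C where C: "\<And>w y. norm w \<le> norm z + \<rho> \<Longrightarrow> \<bar>Im w\<bar> \<le> ahalf ap am - \<rho> \<Longrightarrow> y > 0 \<Longrightarrow>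
    norm (G_integrand ap am w y) \<le> C / (1 + y\<^sup>2)"
    using G_integrand_bound[OF assms(1,2) R \<rho>] by blast
  have ball: "norm w \<le> norm z + \<rho>" "\<bar>Im w\<bar> \<le> ahalf ap am - \<rho>" if "w \<in> ball z \<rho>" for w
  proof -
    have d: "norm (w - z) < \<rho>" using that by (simp add: dist_norm norm_minus_commute)
    then show "norm w \<le> norm z + \<rho>" using norm_triangle_sub[of w z] by linarith
    have "\<bar>Im w - Im z\<bar> < \<rho>" using d abs_Im_le_cmod[of "w - z"] by simp
    then have "\<bar>Im w\<bar> \<le> \<bar>Im z\<bar> + \<rho>" by linarith
    also have "\<dots> = ahalf ap am - \<rho>" by (simp add: \<rho>_def field_simps)
    finally show "\<bar>Im w\<bar> \<le> ahalf ap am - \<rho>" .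
  qed
  show ?thesis
  proof (rule that[OF \<rho>])
    show "ball z \<rho> \<subseteq> G_strip_set ap am"
    proof
      fix w assume "w \<in> ball z \<rho>"
      from ball(2)[OF this] show "w \<in> G_strip_set ap am" using \<rho> by (simp add: G_strip_set_def)
    qed
    show "norm (G_integrand ap am w y) \<le> C / (1 + y\<^sup>2)" if "w \<in> ball z \<rho>" "y > 0" for w y
      by (rule C[OF ball[OF that(1)] that(2)])
  qed
qed

lemma G_integrand_integrable:
  assumes "ap > 0" "am > 0" "z \<in> G_strip_set ap am"
  shows "integrable half_line (G_integrand ap am z)"
proof -
  obtain r C where "r > 0" "\<And>w y. w \<in> ball z r \<Longrightarrow> y > 0 \<Longrightarrow> norm (G_integrand ap am w y) \<le> C / (1 + y\<^sup>2)"
    using G_integrand_local_bound[OF assms] by metis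
  then show ?thesis
    by (intro half_line_integrable_bound[OF continuous_on_G_integrand half_line_integrable_square[of C]])
       (use assms in auto)
qed

definition G_exponent :: "real \<Rightarrow> real \<Rightarrow> complex \<Rightarrow> complex" where
  "G_exponent ap am z = (\<integral>y. G_integrand ap am z y \<partial>half_line)"

lemma G_strip_eq:
  assumes "ap > 0" "am > 0" "z \<in> G_strip_set ap am"
  shows "G_strip ap am z = exp (\<i> * G_exponent ap am z)"
  using half_line_integral_eq[OF G_integrand_integrable[OF assms]]
  by (simp add: G_strip_def G_exponent_def G_integrand_def[abs_def])

lemma holomorphic_G_exponent:
  assumes "ap > 0" "am > 0"
  shows "G_exponent ap am holomorphic_on G_strip_set ap am"
proof (rule holomorphic_onI)
  fix z assume z: "z \<in> G_strip_set ap am"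
  obtain r C where r: "r > 0" "\<And>w y. w \<in> ball z r \<Longrightarrow> y > 0 \<Longrightarrow> norm (G_integrand ap am w y) \<le> C / (1 + y\<^sup>2)"
    using G_integrand_local_bound[OF assms z] by metis
  have "((\<lambda>z. \<integral>y. G_integrand ap am z y \<partial>half_line) has_field_derivative
     (\<integral>y. deriv (\<lambda>z. G_integrand ap am z y) z \<partial>half_line)) (at z)"
    by (rule has_field_derivative_integral_param[where U = "ball z r" and B = "\<lambda>y. C / (1 + y\<^sup>2)"])
       (use r assms in \<open>auto simp: space_half_line intro!: holomorphic_G_integrand half_line_measurable
          continuous_on_G_integrand half_line_integrable_square\<close>)
  then show "G_exponent ap am field_differentiable at z within G_strip_set ap am"
    unfolding G_exponent_def[abs_def] field_differentiable_def
    using has_field_derivative_at_within by blast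
qed

lemma G_exponent_minus: "G_exponent ap am (- z) = - G_exponent ap am z"
proof -
  have "G_integrand ap am (- z) y = - G_integrand ap am z y" for y
    by (simp add: G_integrand_def algebra_simps)
  then show ?thesis by (simp add: G_exponent_def)
qed

lemma G_exponent_commute: "G_exponent ap am = G_exponent am ap"
  by (simp add: G_exponent_def G_integrand_def mult_ac fun_eq_iff)

definition cosh_integrand :: "real \<Rightarrow> complex \<Rightarrow> real \<Rightarrow> complex" where
  "cosh_integrand r z y = 1 / of_real (r * y\<^sup>2) - cos (2 * of_real y * z) / of_real (y * sinh (r * y))"

definition cosh_exponent :: "real \<Rightarrow> complex \<Rightarrow> complex" where
  "cosh_exponent r z = (\<integral>y. cosh_integrand r z y \<partial>half_line)"

text \<open>The sines at \<open>2 * y * z\<close> plus and minus \<open>\<i> * b * y\<close> differ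
  by a multiple of \<open>sinh (b * y)\<close>, which cancels against the denominator. The result no
  longer depends on \<open>b\<close>.\<close>

lemma G_integrand_diff:
  assumes "r > 0" "b > 0" "y > 0"
  shows "\<i> * (G_integrand r b (z + \<i> * of_real b / 2) y - G_integrand r b (z - \<i> * of_real b / 2) y)
     = cosh_integrand r z y"
proof -
  define S T where "S = complex_of_real (sinh (r * y))" and "T = complex_of_real (sinh (b * y))"
  have nz: "S \<noteq> 0" "T \<noteq> 0" "complex_of_real y \<noteq> 0" "complex_of_real r \<noteq> 0" "complex_of_real b \<noteq> 0"
    using assms by (auto simp: S_def T_def)
  have sinT: "sin (\<i> * of_real (b * y)) = \<i> * T"
    by (simp add: T_def sin_i_times sinh_field_def exp_minus flip: exp_of_real)
  have e: "2 * of_real y * (z + \<i> * of_real b / 2) = 2 * of_real y * z + \<i> * of_real (b * y)"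
     "2 * of_real y * (z - \<i> * of_real b / 2) = 2 * of_real y * z - \<i> * of_real (b * y)"
    by (simp_all add: algebra_simps)
  have d: "sin (2 * of_real y * (z + \<i> * of_real b / 2)) - sin (2 * of_real y * (z - \<i> * of_real b / 2))
      = 2 * \<i> * cos (2 * of_real y * z) * T"
    unfolding e sin_add sin_diff sinT by simp
  have "\<i> * (G_integrand r b (z + \<i> * of_real b / 2) y - G_integrand r b (z - \<i> * of_real b / 2) y)
     = \<i> / of_real y * ((sin (2 * of_real y * (z + \<i> * of_real b / 2)) - sin (2 * of_real y * (z - \<i> * of_real b / 2))) / (2 * (S * T))
         - \<i> * of_real b / (of_real r * of_real b * of_real y))"
    unfolding G_integrand_def S_def T_def
    by (simp add: diff_divide_distrib add_divide_distrib right_diff_distrib ring_distribs)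
  also have "\<dots> = cosh_integrand r z y"
    unfolding d cosh_integrand_def using nz
    by (simp add: S_def[symmetric] field_simps power2_eq_square)
  finally show ?thesis .
qed

lemma cosh_exponent_eq_diff:
  assumes pos: "r > 0" "b > 0" and z: "\<bar>Im z\<bar> < r / 2"
  shows "integrable half_line (cosh_integrand r z)"
    and "cosh_exponent r z = \<i> * (G_exponent r b (z + \<i> * of_real b / 2) - G_exponent r b (z - \<i> * of_real b / 2))"
proof -
  let ?w = "z + \<i> * of_real b / 2" and ?v = "z - \<i> * of_real b / 2"
  have "?w \<in> G_strip_set r b" "?v \<in> G_strip_set r b"
    using z pos by (auto simp: G_strip_set_def ahalf_def abs_less_iff field_simps)
  note int = G_integrand_integrable[OF pos this(1)] G_integrand_integrable[OF pos this(2)]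
  have "integrable half_line (\<lambda>y. \<i> * (G_integrand r b ?w y - G_integrand r b ?v y))"
    using int by (intro integrable_mult_right Bochner_Integration.integrable_diff)
  also have "?this \<longleftrightarrow> integrable half_line (cosh_integrand r z)"
    by (intro Bochner_Integration.integrable_cong) (auto simp: space_half_line G_integrand_diff pos)
  finally show "integrable half_line (cosh_integrand r z)" .
  have "cosh_exponent r z = (\<integral>y. \<i> * (G_integrand r b ?w y - G_integrand r b ?v y) \<partial>half_line)"
    unfolding cosh_exponent_def
    by (intro Bochner_Integration.integral_cong) (auto simp: space_half_line G_integrand_diff pos)
  also have "\<dots> = \<i> * (G_exponent r b ?w - G_exponent r b ?v)"
    using int by (simp add: G_exponent_def)
  finally show "cosh_exponent r z = \<i> * (G_exponent r b ?w - G_exponent r b ?v)" .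
qed

lemma holomorphic_cosh_exponent:
  assumes "r > 0"
  shows "cosh_exponent r holomorphic_on {z. \<bar>Im z\<bar> < r / 2}"
proof -
  \<comment> \<open>As \<open>cosh_exponent\<close> does not involve \<open>b\<close>, any positive
    value serves; here it is 1.\<close>
  have "(\<lambda>z. \<i> * (G_exponent r 1 (z + \<i> * of_real 1 / 2) - G_exponent r 1 (z - \<i> * of_real 1 / 2)))
      holomorphic_on {z. \<bar>Im z\<bar> < r / 2}"
    by (intro holomorphic_intros holomorphic_on_compose_gen[OF _ holomorphic_G_exponent, unfolded o_def])
       (use assms in \<open>auto simp: G_strip_set_def ahalf_def abs_less_iff field_simps\<close>)
  then show ?thesis
    by (rule holomorphic_transform) (use cosh_exponent_eq_diff(2)[OF assms, of 1] in auto)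
qed

section \<open>The difference equation of the hyperbolic gamma function\<close>

lemma half_line_exp_integral:
  assumes c: "Re c > 0"
  shows "integrable half_line (\<lambda>y. exp (- (c * of_real y)))"
    and "(\<integral>y. exp (- (c * of_real y)) \<partial>half_line) = 1 / c"
proof -
  show int: "integrable half_line (\<lambda>y. exp (- (c * of_real y)))"
    by (rule half_line_integrable_bound[OF _ half_line_integrable_exp[OF c]])
       (auto intro!: continuous_intros simp: mult.commute)
  have c0: "c \<noteq> 0" using c by auto
  have "(LBINT y=0..\<infinity>. exp (- (c * of_real y))) = 0 - (- 1 / c)"
  proof (rule interval_integral_FTC_integrable)
    show "((\<lambda>y. - exp (- (c * of_real y)) / c) has_vector_derivative exp (- (c * of_real x))) (at x)" for x :: real
      by (rule has_vector_derivative_real_field) (use c0 in \<open>auto intro!: derivative_eq_intros\<close>)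
    show "isCont (\<lambda>y. exp (- (c * complex_of_real y))) x" for x
      by (intro continuous_intros)
    show "set_integrable lborel (einterval 0 \<infinity>) (\<lambda>y. exp (- (c * complex_of_real y)))"
      using int by (simp add: half_line_integrable_iff zero_ereal_def)
    have "((\<lambda>y. - exp (- (c * of_real y)) / c) \<longlongrightarrow> - exp (- (c * of_real 0)) / c) (at_right (0::real))"
      using c0 by (intro tendsto_intros) auto
    then show "(((\<lambda>y. - exp (- (c * of_real y)) / c) \<circ> real_of_ereal) \<longlongrightarrow> - 1 / c) (at_right 0)"
      by (simp add: zero_ereal_def ereal_tendsto_simps)
    have "((\<lambda>y. exp (- Re c * y)) \<longlongrightarrow> 0) at_top"
      using c by real_asymp
    then have "((\<lambda>y. exp (- (c * of_real y))) \<longlongrightarrow> 0) at_top"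
      by (subst tendsto_norm_zero_iff[symmetric]) simp
    then have "((\<lambda>y. - exp (- (c * of_real y)) / c) \<longlongrightarrow> - 0 / c) at_top"
      using c0 by (intro tendsto_intros) auto
    then show "(((\<lambda>y. - exp (- (c * of_real y)) / c) \<circ> real_of_ereal) \<longlongrightarrow> 0) (at_left \<infinity>)"
      by (simp add: ereal_tendsto_simps)
  qed simp
  moreover have "(\<integral>y. exp (- (c * of_real y)) \<partial>half_line) = (LINT y:{0<..}|lborel. exp (- (c * of_real y)))"
    unfolding set_lebesgue_integral_def by (rule integral_restrict_space) simp
  ultimately show "(\<integral>y. exp (- (c * of_real y)) \<partial>half_line) = 1 / c"
    by (simp add: interval_lebesgue_integral_0_infty)
qed

lemma norm_exp_minus_one_le:
  fixes u :: complex
  assumes "Re u \<le> B" "B \<ge> 0"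
  shows "norm (exp u - 1) \<le> exp B * norm u"
proof -
  have "norm (exp u - exp 0) \<le> exp B * norm (u - 0)"
  proof (rule field_differentiable_bound[of "closed_segment 0 u" exp exp])
    fix z assume "z \<in> closed_segment 0 u"
    then obtain t where t: "0 \<le> t" "t \<le> 1" "z = of_real t * u"
      by (auto simp: closed_segment_def scaleR_conv_of_real)
    have "t * Re u \<le> B"
    proof (cases "Re u \<ge> 0")
      case True
      then show ?thesis using mult_right_mono[OF t(2), of "Re u"] assms by simp
    next
      case False
      then show ?thesis using mult_nonneg_nonpos[OF t(1), of "Re u"] assms by simp
    qed
    then show "norm (exp z) \<le> exp B" by (simp add: t)
  qed (auto intro!: derivative_eq_intros)
  then show ?thesis by simp
qed

definition frullani :: "real \<Rightarrow> complex \<Rightarrow> real \<Rightarrow> complex" where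
  "frullani s w y = (exp (- (of_real s * of_real y)) - exp (- ((of_real s + w) * of_real y))) / of_real y"

text \<open>Frullani's integral has value \<open>ln (1 + w / s)\<close>; the exponentiated form
  avoids choosing a branch. Differentiating in \<open>w\<close> removes the denominator
  \<open>y\<close> and leaves the integral of an exponential.\<close>

lemma frullani_integral:
  assumes s: "s > 0" and w: "Re w = 0"
  shows "integrable half_line (frullani s w)"
    and "exp (\<integral>y. frullani s w y \<partial>half_line) = 1 + w / of_real s"
proof -
  \<comment> \<open>A convex set joining 0 and \<open>w\<close> on which one majorant works: the
    first condition leaves decay \<open>exp (- y * s / 2)\<close>, the second bounds
    \<open>norm v\<close>.\<close>
  define U where "U = {v. Re v > - (s / 2) \<and> norm v < norm w + 1}"
  have U_eq: "U = {v. Re v > - (s / 2)} \<inter> ball 0 (norm w + 1)" by (auto simp: U_def)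
  have oU: "open U" unfolding U_def by (intro open_Collect_conj open_Collect_less continuous_intros)
  have cU: "convex U" unfolding U_eq by (intro convex_Int convex_halfspace_Re_gt convex_ball)
  have mem: "w \<in> U" "0 \<in> U" using s w norm_ge_zero[of w] by (simp_all add: U_def add_nonneg_pos)
  define B where "B = (\<lambda>y. (norm w + 1) * exp (- (y * (s / 2))))"
  have B: "integrable half_line B"
    unfolding B_def using s by (intro integrable_mult_right half_line_integrable_exp) simp
  have cont: "continuous_on {0<..} (frullani s v)" for v
    unfolding frullani_def by (intro continuous_intros) auto
  have bound: "norm (frullani s v y) \<le> B y" if v: "v \<in> U" and y: "y > 0" for v y
  proof -
    have "- (s / 2) * y \<le> Re v * y"
      using v y by (intro mult_right_mono) (auto simp: U_def)
    then have "norm (exp (- (v * of_real y)) - 1) \<le> exp (s / 2 * y) * norm (- (v * of_real y))"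
      using s y by (intro norm_exp_minus_one_le) simp_all
    also have "\<dots> = exp (s / 2 * y) * norm v * y"
      using y by (simp add: norm_mult)
    finally have n: "norm (1 - exp (- (v * of_real y))) \<le> exp (s / 2 * y) * norm v * y"
      by (simp add: norm_minus_commute)
    have "frullani s v y = exp (- of_real (s * y)) * (1 - exp (- (v * of_real y))) / of_real y"
    proof -
      have "exp (- ((of_real s + v) * of_real y)) = exp (- of_real (s * y)) * exp (- (v * of_real y))"
        unfolding exp_add[symmetric] by (simp add: ring_distribs)
      then show ?thesis unfolding frullani_def by (simp add: right_diff_distrib)
    qed
    then have "norm (frullani s v y) = exp (- (s * y)) * norm (1 - exp (- (v * of_real y))) / y"
      using y by (simp add: norm_mult norm_divide)
    also have "\<dots> \<le> exp (- (s * y)) * (exp (s / 2 * y) * norm v * y) / y"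
      using n y by (intro divide_right_mono mult_left_mono) auto
    also have "\<dots> = norm v * (exp (- (s * y)) * exp (s / 2 * y))"
      using y by simp
    also have "exp (- (s * y)) * exp (s / 2 * y) = exp (- (y * (s / 2)))"
    proof -
      have "- (s * y) + s / 2 * y = - (y * (s / 2))" by (simp add: field_simps)
      then show ?thesis by (simp only: mult_exp_exp)
    qed
    also have "norm v * exp (- (y * (s / 2))) \<le> B y"
      unfolding B_def using v by (intro mult_right_mono) (auto simp: U_def)
    finally show ?thesis .
  qed
  show "integrable half_line (frullani s w)"
    by (rule half_line_integrable_bound[OF cont B bound[OF mem(1)]])
  define \<psi> where "\<psi> = (\<lambda>v. \<integral>y. frullani s v y \<partial>half_line)"
  have der: "(\<psi> has_field_derivative 1 / (of_real s + v)) (at v)" if v: "v \<in> U" for v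
  proof -
    have d: "((\<lambda>z. frullani s z y) has_field_derivative exp (- ((of_real s + z) * of_real y))) (at z)" if "y > 0" for y z
      unfolding frullani_def using that by (auto intro!: derivative_eq_intros)
    have "(\<psi> has_field_derivative (\<integral>y. deriv (\<lambda>z. frullani s z y) v \<partial>half_line)) (at v)"
      unfolding \<psi>_def
    proof (rule has_field_derivative_integral_param[OF oU _ _ _ B v])
      fix y assume "y \<in> space half_line"
      then have y: "y > 0" by (simp add: space_half_line)
      show "(\<lambda>z. frullani s z y) holomorphic_on U"
        unfolding holomorphic_on_open[OF oU] using d[OF y] by blast
      show "norm (frullani s z y) \<le> B y" if "z \<in> U" for z
        by (rule bound[OF that y])
    qed (rule half_line_measurable[OF cont])
    also have "(\<integral>y. deriv (\<lambda>z. frullani s z y) v \<partial>half_line) = (\<integral>y. exp (- ((of_real s + v) * of_real y)) \<partial>half_line)"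
      by (intro Bochner_Integration.integral_cong) (auto simp: space_half_line intro!: DERIV_imp_deriv d)
    also have "\<dots> = 1 / (of_real s + v)"
      using v s by (intro half_line_exp_integral) (auto simp: U_def)
    finally show ?thesis .
  qed
  \<comment> \<open>This product has derivative 0, so it keeps its value at \<open>v = 0\<close>,
    which is \<open>s\<close>.\<close>
  have "((\<lambda>v. exp (- \<psi> v) * (of_real s + v)) has_field_derivative 0) (at v within U)" if v: "v \<in> U" for v
  proof -
    have "Re (of_real s + v) > 0" using v s by (simp add: U_def)
    then have nz: "of_real s + v \<noteq> 0" by (intro notI) simp
    have "((\<lambda>v. exp (- \<psi> v)) has_field_derivative (exp (- \<psi> v) * - (1 / (of_real s + v)))) (at v)"
      by (rule DERIV_chain2[OF DERIV_exp DERIV_minus[OF der[OF v]]])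
    moreover have "((\<lambda>v. of_real s + v) has_field_derivative 0 + 1) (at v)"
      by (rule DERIV_add[OF DERIV_const DERIV_ident])
    ultimately have "((\<lambda>v. exp (- \<psi> v) * (of_real s + v)) has_field_derivative
        (exp (- \<psi> v) * - (1 / (of_real s + v)) * (of_real s + v) + (0 + 1) * exp (- \<psi> v))) (at v)"
      by (rule DERIV_mult)
    moreover have "exp (- \<psi> v) * - (1 / (of_real s + v)) * (of_real s + v) + (0 + 1) * exp (- \<psi> v) = 0"
      using nz by (simp add: divide_simps)
    ultimately show ?thesis
      by (metis has_field_derivative_at_within)
  qed
  then have "\<exists>k. \<forall>v\<in>U. exp (- \<psi> v) * (of_real s + v) = k"
    by (rule has_field_derivative_zero_constant[OF cU])
  then obtain k where k: "\<forall>v\<in>U. exp (- \<psi> v) * (of_real s + v) = k" ..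
  have "\<psi> 0 = 0" by (simp add: \<psi>_def frullani_def)
  then have "k = of_real s" using k[rule_format, OF mem(2)] by simp
  then have "of_real s + w = exp (\<psi> w) * of_real s"
    using k[rule_format, OF mem(1)] by (simp add: exp_minus field_simps)
  then show "exp (\<integral>y. frullani s w y \<partial>half_line) = 1 + w / of_real s"
    using s by (simp add: \<psi>_def field_simps)
qed

text \<open>The integrand is the sum of the Frullani integrands at \<open>2 * \<i> * x\<close> and
  \<open>- 2 * \<i> * x\<close>, and the logarithm comes from
  \<open>(1 + w / s) * (1 - w / s)\<close>.\<close>

lemma cos_integral:
  fixes s x :: real
  assumes s: "s > 0"
  shows "integrable half_line (\<lambda>y. 2 * (1 - cos (2 * y * x)) * exp (- (s * y)) / y)"
    and "(\<integral>y. 2 * (1 - cos (2 * y * x)) * exp (- (s * y)) / y \<partial>half_line) = ln (1 + 4 * x\<^sup>2 / s\<^sup>2)"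
proof -
  let ?g = "\<lambda>y. 2 * (1 - cos (2 * y * x)) * exp (- (s * y)) / y"
  let ?w = "2 * \<i> * of_real x"
  have eq: "complex_of_real (?g y) = frullani s ?w y + frullani s (- ?w) y" for y
  proof -
    define e where "e = complex_of_real (exp (- (s * y)))"
    define t where "t = complex_of_real (2 * y * x)"
    have e1: "exp (- ((of_real s + ?w) * of_real y)) = e * exp (- (\<i> * t))"
      "exp (- ((of_real s + - ?w) * of_real y)) = e * exp (\<i> * t)"
      "exp (- (of_real s * complex_of_real y)) = e"
      unfolding e_def t_def exp_of_real[symmetric] mult_exp_exp
      by (rule arg_cong[of _ _ exp], simp add: algebra_simps)+
    have cs: "exp (\<i> * t) + exp (- (\<i> * t)) = 2 * complex_of_real (cos (2 * y * x))"
      unfolding t_def cos_of_real[symmetric] cos_exp_eq by simp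
    have "frullani s ?w y + frullani s (- ?w) y = e * (2 - (exp (\<i> * t) + exp (- (\<i> * t)))) / of_real y"
      unfolding frullani_def e1 by (simp only: add_divide_distrib[symmetric]) (simp add: algebra_simps)
    also have "\<dots> = complex_of_real (?g y)"
      unfolding cs e_def by (simp add: algebra_simps)
    finally show ?thesis ..
  qed
  have w: "Re ?w = 0" "Re (- ?w) = 0" by simp_all
  note int = frullani_integral(1)[OF s w(1)] frullani_integral(1)[OF s w(2)]
  have "integrable half_line (\<lambda>y. complex_of_real (?g y))"
    unfolding eq by (rule Bochner_Integration.integrable_add[OF int])
  then show "integrable half_line ?g" by (rule complex_of_real_integrable_eq[THEN iffD1])
  have "complex_of_real (\<integral>y. ?g y \<partial>half_line) = (\<integral>y. complex_of_real (?g y) \<partial>half_line)"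
    by (rule integral_complex_of_real[symmetric])
  also have "\<dots> = (\<integral>y. frullani s ?w y \<partial>half_line) + (\<integral>y. frullani s (- ?w) y \<partial>half_line)"
    unfolding eq by (rule Bochner_Integration.integral_add[OF int])
  finally have "exp (complex_of_real (\<integral>y. ?g y \<partial>half_line)) = (1 + ?w / of_real s) * (1 + - ?w / of_real s)"
    by (simp only: exp_add frullani_integral(2)[OF s w(1)] frullani_integral(2)[OF s w(2)])
  also have "\<dots> = 1 - (?w / of_real s)\<^sup>2"
    by (simp add: algebra_simps power2_eq_square)
  also have "\<dots> = complex_of_real (1 + 4 * x\<^sup>2 / s\<^sup>2)"
    by (simp add: power_divide power_mult_distrib)
  finally have "exp (\<integral>y. ?g y \<partial>half_line) = 1 + 4 * x\<^sup>2 / s\<^sup>2"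
    by (simp only: exp_of_real of_real_eq_iff)
  from arg_cong[OF this, of ln] show "(\<integral>y. ?g y \<partial>half_line) = ln (1 + 4 * x\<^sup>2 / s\<^sup>2)"
    by (simp only: ln_exp)
qed

lemma sinh_product_formula:
  "(\<lambda>n. pi * x * (\<Prod>k=1..n. 1 + x\<^sup>2 / (real k)\<^sup>2)) \<longlonglongrightarrow> sinh (pi * x)"
proof -
  have "(\<lambda>n. of_real pi * (\<i> * of_real x) * (\<Prod>k=1..n. 1 - (\<i> * of_real x)\<^sup>2 / (of_nat k)\<^sup>2)) \<longlonglongrightarrow> sin (of_real pi * (\<i> * complex_of_real x))"
    by (rule sin_product_formula_complex)
  then have "(\<lambda>n. - \<i> * (of_real pi * (\<i> * of_real x) * (\<Prod>k=1..n. 1 - (\<i> * of_real x)\<^sup>2 / (of_nat k)\<^sup>2))) \<longlonglongrightarrow> - \<i> * sin (of_real pi * (\<i> * complex_of_real x))"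
    by (intro tendsto_mult_left)
  also have "(\<lambda>n. - \<i> * (of_real pi * (\<i> * of_real x) * (\<Prod>k=1..n. 1 - (\<i> * of_real x)\<^sup>2 / (of_nat k)\<^sup>2)))
      = (\<lambda>n. complex_of_real (pi * x * (\<Prod>k=1..n. 1 + x\<^sup>2 / (real k)\<^sup>2)))"
    by (simp add: power_mult_distrib mult_ac)
  also have "- \<i> * sin (of_real pi * (\<i> * complex_of_real x)) = complex_of_real (sinh (pi * x))"
  proof -
    have "of_real pi * (\<i> * complex_of_real x) = \<i> * of_real (pi * x)" by simp
    then show ?thesis
      by (simp only: sin_i_times) (simp add: sinh_field_def exp_minus flip: exp_of_real)
  qed
  finally show ?thesis by (simp only: tendsto_of_real_iff)
qed

text \<open>In the product for \<open>sinh\<close> at \<open>2 * x\<close> the factors of even index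
  form the product at \<open>x\<close>. Dividing leaves the odd ones, and
  \<open>sinh (2 t) = 2 * sinh t * cosh t\<close> identifies the limit.\<close>

lemma cosh_product_formula:
  "(\<lambda>n. \<Prod>k<n. 1 + 4 * x\<^sup>2 / (2 * real k + 1)\<^sup>2) \<longlonglongrightarrow> cosh (pi * x)"
proof (cases "x = 0")
  case False
  define P where "P = (\<lambda>x n. \<Prod>k=1..n. 1 + x\<^sup>2 / (real k)\<^sup>2)"
  have P_pos: "P x n > 0" for x n
    unfolding P_def by (intro prod_pos) (auto intro: add_pos_nonneg)
  have eq: "P (2 * x) (2 * n) = P x n * (\<Prod>k<n. 1 + 4 * x\<^sup>2 / (2 * real k + 1)\<^sup>2)" for n
  proof (induction n)
    case (Suc n)
    have "P (2 * x) (2 * Suc n) = P (2 * x) (2 * n) * (1 + (2 * x)\<^sup>2 / (2 * real n + 1)\<^sup>2) * (1 + (2 * x)\<^sup>2 / (2 * real n + 2)\<^sup>2)"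
      by (simp add: P_def prod.nat_ivl_Suc' mult_ac add_ac)
    also have "(2 * x)\<^sup>2 / (2 * real n + 2)\<^sup>2 = x\<^sup>2 / (real (Suc n))\<^sup>2"
    proof -
      have "2 * real n + 2 = 2 * real (Suc n)" by simp
      then show ?thesis by (simp only: power_mult_distrib) simp
    qed
    finally show ?case
      unfolding Suc.IH by (simp add: P_def prod.nat_ivl_Suc' mult_ac power_mult_distrib)
  qed (simp add: P_def)
  have lim: "(\<lambda>n. P x n) \<longlonglongrightarrow> sinh (pi * x) / (pi * x)" if "x \<noteq> 0" for x
    using tendsto_divide[OF sinh_product_formula[of x] tendsto_const[of "pi * x"]] that
    by (simp add: P_def)
  have "(\<lambda>n. P (2 * x) (2 * n)) \<longlonglongrightarrow> sinh (pi * (2 * x)) / (pi * (2 * x))"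
    using LIMSEQ_subseq_LIMSEQ[OF lim[of "2 * x"], of "\<lambda>n. 2 * n"] False
    by (simp add: strict_mono_def o_def)
  then have "(\<lambda>n. P (2 * x) (2 * n) / P x n) \<longlonglongrightarrow> (sinh (pi * (2 * x)) / (pi * (2 * x))) / (sinh (pi * x) / (pi * x))"
    using lim[OF False] False by (intro tendsto_divide) auto
  also have "(\<lambda>n. P (2 * x) (2 * n) / P x n) = (\<lambda>n. \<Prod>k<n. 1 + 4 * x\<^sup>2 / (2 * real k + 1)\<^sup>2)"
    using P_pos by (simp add: eq less_imp_neq[symmetric])
  also have "(sinh (pi * (2 * x)) / (pi * (2 * x))) / (sinh (pi * x) / (pi * x)) = cosh (pi * x)"
  proof -
    have "sinh (pi * (2 * x)) = 2 * sinh (pi * x) * cosh (pi * x)"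
      using sinh_double[of "pi * x"] by (simp add: mult_ac)
    then show ?thesis using False by simp
  qed
  finally show ?thesis .
qed simp

lemma inverse_sinh_sums:
  fixes t :: real
  assumes "t > 0"
  shows "(\<lambda>n. 2 * exp (- ((2 * real n + 1) * t))) sums (1 / sinh t)"
proof -
  have "(\<lambda>n. exp (- 2 * t) ^ n) sums (1 / (1 - exp (- 2 * t)))"
    using assms by (intro geometric_sums) simp
  then have "(\<lambda>n. 2 * exp (- t) * exp (- 2 * t) ^ n) sums (2 * exp (- t) * (1 / (1 - exp (- 2 * t))))"
    by (rule sums_mult)
  moreover have "2 * exp (- t) * exp (- 2 * t) ^ n = 2 * exp (- ((2 * real n + 1) * t))" for n
  proof -
    have "exp (- 2 * t) ^ n = exp (real n * (- 2 * t))" by (rule exp_of_nat_mult[symmetric])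
    moreover have "- t + real n * (- 2 * t) = - ((2 * real n + 1) * t)" by (simp add: algebra_simps)
    ultimately show ?thesis by (simp only: mult.assoc mult_exp_exp)
  qed
  moreover have "2 * exp (- t) * (1 / (1 - exp (- 2 * t))) = 1 / sinh t"
  proof -
    have "exp (- 2 * t) = exp (- t) * exp (- t)" unfolding mult_exp_exp by simp
    moreover have "exp t * exp (- t) = 1" by (simp add: mult_exp_exp)
    moreover have "2 * sinh t = exp t - exp (- t)" by (simp add: sinh_field_def)
    ultimately have "exp (- t) * (2 * sinh t) = 1 - exp (- 2 * t)"
      by (simp only: right_diff_distrib mult.commute)
    moreover have "sinh t \<noteq> 0" "1 - exp (- 2 * t) \<noteq> 0" using assms by auto
    ultimately show ?thesis by (simp add: divide_simps)
  qed
  ultimately show ?thesis by (simp only:)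
qed

text \<open>Expanding \<open>1 / sinh (r * y)\<close> as a geometric series turns the integral into
  a sum of \<open>cos_integral\<close> values with \<open>s = (2 n + 1) * r\<close>, that is, the
  logarithm of the product for \<open>cosh\<close>. The terms are nonnegative and their integrals
  are dominated by inverse squares, which permits termwise integration.\<close>

lemma cosh_integral_real:
  fixes x r :: real
  assumes r: "r > 0"
  shows "exp (\<integral>y. (1 - cos (2 * y * x)) / (y * sinh (r * y)) \<partial>half_line) = cosh (pi * (x / r))"
proof -
  define s where "s = (\<lambda>n::nat. (2 * real n + 1) * r)"
  have s: "s n > 0" for n using r by (simp add: s_def)
  define f where "f = (\<lambda>n y. 2 * (1 - cos (2 * y * x)) * exp (- (s n * y)) / y)"
  define D where "D = (\<lambda>y. (1 - cos (2 * y * x)) / (y * sinh (r * y)))"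
  have f_nonneg: "f n y \<ge> 0" if "y > 0" for n y
    using that by (auto simp: f_def intro!: divide_nonneg_pos mult_nonneg_nonneg)
  have f_sums: "(\<lambda>n. f n y) sums D y" if y: "y > 0" for y
  proof -
    have "(\<lambda>n. (1 - cos (2 * y * x)) / y * (2 * exp (- ((2 * real n + 1) * (r * y))))) sums ((1 - cos (2 * y * x)) / y * (1 / sinh (r * y)))"
      using r y by (intro sums_mult inverse_sinh_sums) simp
    then show ?thesis
      by (simp add: f_def D_def s_def mult_ac del: right_diff_distrib_numeral left_diff_distrib_numeral)
  qed
  have int: "integrable half_line (f n)" "(\<integral>y. f n y \<partial>half_line) = ln (1 + 4 * x\<^sup>2 / (s n)\<^sup>2)" for n
    unfolding f_def using cos_integral[OF s] by auto
  have norm_int: "(\<integral>y. norm (f n y) \<partial>half_line) = ln (1 + 4 * x\<^sup>2 / (s n)\<^sup>2)" for n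
    unfolding int(2)[symmetric]
    by (intro Bochner_Integration.integral_cong) (auto simp: space_half_line f_nonneg)
  have sm: "summable (\<lambda>n. ln (1 + 4 * x\<^sup>2 / (s n)\<^sup>2))"
  proof (rule summable_comparison_test'[where N = 0])
    show "summable (\<lambda>n. 4 * x\<^sup>2 / r\<^sup>2 * (1 / (real n + 1)\<^sup>2))"
      using inverse_squares_sums by (intro summable_mult sums_summable) (simp add: add.commute)
    fix n :: nat
    have "norm (ln (1 + 4 * x\<^sup>2 / (s n)\<^sup>2)) = ln (1 + 4 * x\<^sup>2 / (s n)\<^sup>2)" by simp
    also have "\<dots> \<le> 4 * x\<^sup>2 / (s n)\<^sup>2" by (rule ln_add_one_self_le_self) simp
    also have "\<dots> \<le> 4 * x\<^sup>2 / ((real n + 1) * r)\<^sup>2"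
      using r s[of n] by (intro divide_left_mono power_mono mult_pos_pos) (auto simp: s_def)
    finally show "norm (ln (1 + 4 * x\<^sup>2 / (s n)\<^sup>2)) \<le> 4 * x\<^sup>2 / r\<^sup>2 * (1 / (real n + 1)\<^sup>2)"
      by (simp add: power_mult_distrib mult_ac)
  qed
  have "(\<lambda>n. integral\<^sup>L half_line (f n)) sums (\<integral>y. (\<Sum>n. f n y) \<partial>half_line)"
  proof (rule sums_integral)
    show "summable (\<lambda>n. \<integral>y. norm (f n y) \<partial>half_line)"
      unfolding norm_int by (rule sm)
    show "AE y in half_line. summable (\<lambda>n. norm (f n y))"
    proof (rule AE_I2)
      fix y assume "y \<in> space half_line"
      then have y: "y > 0" by (simp add: space_half_line)
      then show "summable (\<lambda>n. norm (f n y))"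
        using sums_summable[OF f_sums[OF y]] f_nonneg[OF y] by simp
    qed
  qed (rule int)
  also have "(\<integral>y. (\<Sum>n. f n y) \<partial>half_line) = integral\<^sup>L half_line D"
    by (intro Bochner_Integration.integral_cong) (auto simp: space_half_line sums_unique[OF f_sums])
  finally have "(\<lambda>m. \<Sum>n<m. ln (1 + 4 * x\<^sup>2 / (s n)\<^sup>2)) \<longlonglongrightarrow> integral\<^sup>L half_line D"
    by (simp add: int sums_def)
  then have "(\<lambda>m. exp (\<Sum>n<m. ln (1 + 4 * x\<^sup>2 / (s n)\<^sup>2))) \<longlonglongrightarrow> exp (integral\<^sup>L half_line D)"
    by (rule tendsto_exp)
  also have "(\<lambda>m. exp (\<Sum>n<m. ln (1 + 4 * x\<^sup>2 / (s n)\<^sup>2))) = (\<lambda>m. \<Prod>n<m. 1 + 4 * (x / r)\<^sup>2 / (2 * real n + 1)\<^sup>2)"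
  proof
    fix m
    have "exp (\<Sum>n<m. ln (1 + 4 * x\<^sup>2 / (s n)\<^sup>2)) = (\<Prod>n<m. exp (ln (1 + 4 * x\<^sup>2 / (s n)\<^sup>2)))"
      by (simp add: exp_sum)
    also have "\<dots> = (\<Prod>n<m. 1 + 4 * (x / r)\<^sup>2 / (2 * real n + 1)\<^sup>2)"
      by (intro prod.cong refl, subst exp_ln)
         (auto simp: s_def power_mult_distrib power_divide mult_ac intro: add_pos_nonneg)
    finally show "exp (\<Sum>n<m. ln (1 + 4 * x\<^sup>2 / (s n)\<^sup>2)) = (\<Prod>n<m. 1 + 4 * (x / r)\<^sup>2 / (2 * real n + 1)\<^sup>2)" .
  qed
  finally have "exp (integral\<^sup>L half_line D) = cosh (pi * (x / r))"
    using cosh_product_formula[of "x / r"] by (rule LIMSEQ_unique)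
  then show ?thesis by (simp only: D_def)
qed

text \<open>Subtracting the value at 0 cancels the term \<open>1 / (r * y\<^sup>2)\<close> and
  leaves a real integrand.\<close>

lemma cosh_exponent_real:
  assumes r: "r > 0"
  shows "exp (cosh_exponent r (of_real x) - cosh_exponent r 0) = of_real (cosh (pi * (x / r)))"
proof -
  have int: "integrable half_line (cosh_integrand r (of_real x))" "integrable half_line (cosh_integrand r 0)"
    using cosh_exponent_eq_diff(1)[OF r zero_less_one] r by simp_all
  have "cosh_integrand r (of_real x) y - cosh_integrand r 0 y
      = complex_of_real ((1 - cos (2 * y * x)) / (y * sinh (r * y)))" for y
    by (simp add: cosh_integrand_def diff_divide_distrib flip: cos_of_real)
  then have "cosh_exponent r (of_real x) - cosh_exponent r 0
      = (\<integral>y. complex_of_real ((1 - cos (2 * y * x)) / (y * sinh (r * y))) \<partial>half_line)"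
    unfolding cosh_exponent_def using Bochner_Integration.integral_diff[OF int] by (simp only:)
  also have "\<dots> = complex_of_real (\<integral>y. (1 - cos (2 * y * x)) / (y * sinh (r * y)) \<partial>half_line)"
    by (rule integral_complex_of_real)
  finally show ?thesis
    using cosh_integral_real[OF r, of x] by (simp only: exp_of_real)
qed

text \<open>Identity theorem: both sides are holomorphic in the strip and agree on the real
  axis.\<close>

lemma cosh_exponent_ratio:
  assumes r: "r > 0" and z: "\<bar>Im z\<bar> < r / 2"
  shows "exp (cosh_exponent r z - cosh_exponent r 0) = cosh (of_real pi * (z / of_real r))"
proof -
  define S where "S = {z :: complex. \<bar>Im z\<bar> < r / 2}"
  have S_eq: "S = {z. Im z < r / 2} \<inter> {z. Im z > - (r / 2)}" by (auto simp: S_def abs_less_iff)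
  have "exp (cosh_exponent r z - cosh_exponent r 0) - cosh (of_real pi * (z / of_real r)) = 0"
  proof (rule analytic_continuation[where S = S and U = "range of_real" and \<xi> = 0
        and f = "\<lambda>z. exp (cosh_exponent r z - cosh_exponent r 0) - cosh (of_real pi * (z / of_real r))"])
    show "(\<lambda>z. exp (cosh_exponent r z - cosh_exponent r 0) - cosh (of_real pi * (z / of_real r))) holomorphic_on S"
      unfolding S_def cosh_def using holomorphic_cosh_exponent[OF r] r
      by (intro holomorphic_intros) auto
    show "open S" unfolding S_eq by (intro open_Int open_halfspace_Im_lt open_halfspace_Im_gt)
    show "connected S"
      unfolding S_eq by (intro convex_connected convex_Int convex_halfspace_Im_lt convex_halfspace_Im_gt)
    show "range of_real \<subseteq> S" using r by (auto simp: S_def)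
    show "(0::complex) islimpt range of_real"
      unfolding islimpt_approachable
    proof (intro allI impI)
      fix e :: real assume "e > 0"
      then show "\<exists>x'\<in>range complex_of_real. x' \<noteq> 0 \<and> dist x' 0 < e"
        by (intro bexI[of _ "complex_of_real (e / 2)"]) (auto simp del: of_real_divide)
    qed
    show "exp (cosh_exponent r w - cosh_exponent r 0) - cosh (of_real pi * (w / of_real r)) = 0"
      if "w \<in> range of_real" for w
    proof -
      obtain x where "w = complex_of_real x" using \<open>w \<in> range of_real\<close> by auto
      then show ?thesis
        using cosh_exponent_real[OF r, of x] by (simp add: cosh_field_def flip: exp_of_real)
    qed
  qed (use r z in \<open>auto simp: S_def\<close>)
  then show ?thesis by simp
qed

text \<open>The constant is pinned down by duplication: the integrand at \<open>\<i> r / 4\<close> is, up to scaling, the integrand at \<open>0\<close>.\<close>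
lemma cosh_exponent_duplication:
  assumes r: "r > 0"
  shows "2 * cosh_exponent r (\<i> * of_real r / 4) = cosh_exponent r 0"
proof -
  define h where "h = cosh_integrand r 0"
  have eq: "2 * cosh_integrand r (\<i> * of_real r / 4) y = (1/2) *\<^sub>R h (y / 2)" if y: "y > 0" for y
  proof -
    define C S where "C = complex_of_real (cosh (r * y / 2))" and "S = complex_of_real (sinh (r * y / 2))"
    have nz: "C \<noteq> 0" "S \<noteq> 0" using r y by (auto simp: C_def S_def)
    have "sinh (r * y) = 2 * sinh (r * y / 2) * cosh (r * y / 2)"
      using sinh_double[of "r * y / 2"] by simp
    then have sh: "complex_of_real (sinh (r * y)) = 2 * S * C" by (simp add: C_def S_def)
    \<comment> \<open>At this point the cosine equals \<open>cosh (r * y / 2)\<close>, which cancels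
      one factor of \<open>sinh (r * y) = 2 * sinh (r * y / 2) * cosh (r * y / 2)\<close>.\<close>
    have "cos (2 * of_real y * (\<i> * of_real r / 4)) = cos (\<i> * of_real (r * y / 2))"
      by (rule arg_cong[of _ _ cos]) simp
    also have "\<dots> = C"
      unfolding C_def cosh_field_def cos_i_times by (simp add: exp_minus flip: exp_of_real)
    finally have cs: "cos (2 * of_real y * (\<i> * of_real r / 4)) = C" .
    have "2 * cosh_integrand r (\<i> * of_real r / 4) y = 2 / (of_real r * (of_real y)\<^sup>2) - 1 / (of_real y * S)"
      unfolding cosh_integrand_def cs of_real_mult sh using nz r y by (simp add: field_simps)
    also have "\<dots> = (1/2) *\<^sub>R h (y / 2)"
    proof -
      have "r * (y / 2) = r * y / 2" by simp
      then have "h (y / 2) = 1 / of_real (r * (y / 2)\<^sup>2) - 1 / (of_real (y / 2) * S)"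
        unfolding h_def cosh_integrand_def S_def by simp
      then show ?thesis using nz r y by (simp add: scaleR_conv_of_real field_simps power2_eq_square)
    qed
    finally show ?thesis .
  qed
  have scale: "(\<integral>y. h y \<partial>half_line) = (\<integral>y. (1/2) *\<^sub>R h (y / 2) \<partial>half_line)"
  proof -
    have "(\<integral>y. h y \<partial>half_line) = (\<integral>y. indicator {0<..} y *\<^sub>R h y \<partial>lborel)"
      by (rule integral_restrict_space) simp
    also have "\<dots> = \<bar>1/2\<bar> *\<^sub>R (\<integral>y. indicator {0<..} (0 + 1/2 * y) *\<^sub>R h (0 + 1/2 * y) \<partial>lborel)"
      by (rule lborel_integral_real_affine) simp
    also have "(\<lambda>y::real. indicator {0<..} (0 + 1/2 * y) *\<^sub>R h (0 + 1/2 * y)) = (\<lambda>y. indicator {0<..} y *\<^sub>R h (y / 2))"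
      by (auto simp: indicator_def)
    also have "\<bar>1/2\<bar> *\<^sub>R (\<integral>y. indicator {0<..} y *\<^sub>R h (y / 2) \<partial>lborel) = (1/2) *\<^sub>R (\<integral>y. h (y / 2) \<partial>half_line)"
      by (subst integral_restrict_space) simp_all
    also have "\<dots> = (\<integral>y. (1/2) *\<^sub>R h (y / 2) \<partial>half_line)" by simp
    finally show ?thesis .
  qed
  have "2 * cosh_exponent r (\<i> * of_real r / 4) = (\<integral>y. 2 * cosh_integrand r (\<i> * of_real r / 4) y \<partial>half_line)"
    unfolding cosh_exponent_def by simp
  also have "\<dots> = (\<integral>y. (1/2) *\<^sub>R h (y / 2) \<partial>half_line)"
    by (intro Bochner_Integration.integral_cong) (auto simp: space_half_line eq)
  finally show ?thesis using scale by (simp add: cosh_exponent_def h_def)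
qed

text \<open>The ratio at \<open>\<i> * r / 4\<close> is \<open>cos (pi / 4)\<close>, with square
  \<open>1 / 2\<close>. By duplication that square is also \<open>exp (- cosh_exponent r 0)\<close>,
  and so the constant is 2.\<close>

lemma exp_cosh_exponent:
  assumes r: "r > 0" and z: "\<bar>Im z\<bar> < r / 2"
  shows "exp (cosh_exponent r z) = 2 * cosh (of_real pi * (z / of_real r))"
proof -
  let ?I = "cosh_exponent r 0"
  have "cosh (of_real pi * ((\<i> * of_real r / 4) / of_real r)) = cos (complex_of_real (pi / 4))"
    using r by (simp add: cosh_conv_cos algebra_simps)
  also have "\<dots> = of_real (sqrt 2 / 2)" by (simp only: cos_of_real cos_45)
  finally have "exp (cosh_exponent r (\<i> * of_real r / 4) - ?I) = of_real (sqrt 2 / 2)"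
    using cosh_exponent_ratio[OF r, of "\<i> * of_real r / 4"] r by simp
  then have "(exp (cosh_exponent r (\<i> * of_real r / 4) - ?I))\<^sup>2 = of_real ((sqrt 2 / 2)\<^sup>2)" by (simp only: of_real_power)
  also have "(sqrt 2 / 2)\<^sup>2 = 1 / (2::real)" by (simp add: power_divide)
  also have "(exp (cosh_exponent r (\<i> * of_real r / 4) - ?I))\<^sup>2 = exp (2 * cosh_exponent r (\<i> * of_real r / 4) - 2 * ?I)"
    by (simp add: power2_eq_square mult_exp_exp)
  finally have "exp (- ?I) = 1 / 2"
    unfolding cosh_exponent_duplication[OF r] by simp
  then have "exp ?I = 2" by (simp add: exp_minus field_simps)
  moreover have "exp (cosh_exponent r z) = exp ?I * exp (cosh_exponent r z - ?I)"
    by (simp add: mult_exp_exp)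
  ultimately show ?thesis by (simp only: cosh_exponent_ratio[OF r z])
qed

lemma G_strip_difference:
  assumes pos: "r > 0" "b > 0" and z: "\<bar>Im z\<bar> < r / 2"
  shows "exp (\<i> * G_exponent r b (z + \<i> * of_real b / 2)) =
     2 * cosh (of_real pi * (z / of_real r)) * exp (\<i> * G_exponent r b (z - \<i> * of_real b / 2))"
proof -
  have "\<i> * G_exponent r b (z + \<i> * of_real b / 2) = cosh_exponent r z + \<i> * G_exponent r b (z - \<i> * of_real b / 2)"
    unfolding cosh_exponent_eq_diff(2)[OF pos z] by (simp add: algebra_simps)
  then show ?thesis by (simp only: exp_add exp_cosh_exponent[OF pos(1) z])
qed

section \<open>Meromorphic continuation\<close>

text \<open>Going upwards the equation only multiplies by the entire function \<open>c\<close>, so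
  no poles arise; going downwards would divide by it.\<close>

lemma holomorphic_upper_extension:
  fixes F c :: "complex \<Rightarrow> complex" and a p :: real
  assumes p: "0 < p" "p < 2 * a"
    and F: "F holomorphic_on {z. \<bar>Im z\<bar> < a}" and c: "c holomorphic_on UNIV"
    and eq: "\<And>w. \<bar>Im w\<bar> < a - p / 2 \<Longrightarrow> F (w + \<i> * of_real p / 2) = c w * F (w - \<i> * of_real p / 2)"
  obtains E where "E holomorphic_on {z. Im z > - a}" "\<And>z. \<bar>Im z\<bar> < a \<Longrightarrow> E z = F z"
proof -
  \<comment> \<open>The number of steps down by \<open>p\<close> until the imaginary part is at most
    \<open>p / 2\<close>; \<open>nat\<close> gives 0 when it already is. For positive
    \<open>n z\<close> the final imaginary part lies in \<open>(- p / 2, p / 2]\<close>, inside the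
    strip since \<open>p < 2 * a\<close>.\<close>
  define n where "n = (\<lambda>z. nat \<lceil>(Im z - p / 2) / p\<rceil>)"
  define E where "E = (\<lambda>z. F (z - \<i> * of_nat (n z) * of_real p) * (\<Prod>j<n z. c (z - \<i> * of_real p / 2 - \<i> * of_nat j * of_real p)))"
  let ?p = "\<i> * complex_of_real p"
  have n0: "n z = 0" if "Im z \<le> p / 2" for z
  proof -
    have "(Im z - p / 2) / p \<le> 0" using that p by (simp add: divide_nonpos_pos)
    then show ?thesis by (simp add: n_def)
  qed
  have nS: "n z = Suc (n (z - ?p))" if "Im z > p / 2" for z
  proof -
    have "(Im z - p / 2) / p > 0" using that p by simp
    moreover have "(Im (z - ?p) - p / 2) / p = (Im z - p / 2) / p - 1"
      using p by (simp add: field_simps)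
    ultimately show ?thesis unfolding n_def by (simp add: nat_diff_distrib')
  qed
  have E0: "E z = F z" if "Im z \<le> p / 2" for z
    using n0[OF that] by (simp add: E_def)
  have ES: "E z = c (z - ?p / 2) * E (z - ?p)" if "Im z > p / 2" for z
  proof -
    have shift: "z - \<i> * of_nat (Suc k) * of_real p = z - ?p - \<i> * of_nat k * of_real p"
      "z - ?p / 2 - \<i> * of_nat (Suc k) * of_real p = z - ?p - ?p / 2 - \<i> * of_nat k * of_real p" for k
      by (simp_all add: algebra_simps)
    show ?thesis
      unfolding E_def nS[OF that] prod.lessThan_Suc_shift shift by simp
  qed
  have EF: "E z = F z" if "\<bar>Im z\<bar> < a" for z
    using that
  proof (induction "n z" arbitrary: z)
    case 0
    then have "\<not> Im z > p / 2" using nS[of z] by auto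
    then show ?case by (intro E0) simp
  next
    case (Suc k)
    then have z: "Im z > p / 2" using n0[of z] by (cases "Im z > p / 2") auto
    then have "k = n (z - ?p)" using nS[OF z] Suc.hyps(2) by simp
    moreover have "\<bar>Im (z - ?p)\<bar> < a" using z Suc.prems p by (auto simp: abs_less_iff)
    ultimately have "E (z - ?p) = F (z - ?p)" by (rule Suc.hyps(1))
    then have "E z = c (z - ?p / 2) * F (z - ?p)" using ES[OF z] by simp
    also have "\<dots> = F z"
    proof -
      have "z - ?p / 2 + ?p / 2 = z" "z - ?p / 2 - ?p / 2 = z - ?p" by (simp_all add: field_simps)
      moreover have "\<bar>Im (z - ?p / 2)\<bar> < a - p / 2" using z Suc.prems p by (auto simp: abs_less_iff)
      ultimately show ?thesis using eq[of "z - ?p / 2"] by simp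
    qed
    finally show ?case .
  qed
  \<comment> \<open>The equation also holds below \<open>p / 2\<close>, where both points lie in the
    original strip. Holomorphy can therefore be carried upwards across the lines where
    \<open>n\<close> jumps.\<close>
  have Eeq: "E z = c (z - ?p / 2) * E (z - ?p)" if "Im z > p - a" for z
  proof (cases "Im z > p / 2")
    case False
    then have "\<bar>Im z\<bar> < a" "\<bar>Im (z - ?p)\<bar> < a" "\<bar>Im (z - ?p / 2)\<bar> < a - p / 2"
      using that p by (auto simp: abs_less_iff)
    moreover have "z - ?p / 2 + ?p / 2 = z" "z - ?p / 2 - ?p / 2 = z - ?p" by (simp_all add: field_simps)
    ultimately show ?thesis using eq[of "z - ?p / 2"] EF by simp
  qed (rule ES)
  have hol: "E holomorphic_on {z. - a < Im z \<and> Im z < a + real k * p}" for k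
  proof (induction k)
    case 0
    have "E holomorphic_on {z. \<bar>Im z\<bar> < a}" using F by (rule holomorphic_transform) (simp add: EF)
    then show ?case by (rule holomorphic_on_subset) (auto simp: abs_less_iff)
  next
    case (Suc k)
    let ?A = "{z. - a < Im z \<and> Im z < a + real k * p}" and ?B = "{z. p - a < Im z \<and> Im z < a + real (Suc k) * p}"
    have "(\<lambda>z. c (z - ?p / 2) * E (z - ?p)) holomorphic_on ?B"
    proof (intro holomorphic_on_mult)
      show "(\<lambda>z. c (z - ?p / 2)) holomorphic_on ?B"
        by (rule holomorphic_on_compose_gen[OF _ c, unfolded o_def])
           (auto intro!: holomorphic_on_diff holomorphic_on_ident holomorphic_on_const)
      show "(\<lambda>z. E (z - ?p)) holomorphic_on ?B"
        by (rule holomorphic_on_compose_gen[OF _ Suc.IH, unfolded o_def])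
           (auto simp: algebra_simps intro!: holomorphic_on_diff holomorphic_on_ident holomorphic_on_const)
    qed
    then have "E holomorphic_on ?B"
      by (rule holomorphic_transform) (simp add: Eeq)
    moreover have "open ?A" "open ?B"
      by (intro open_Collect_conj open_Collect_less continuous_intros)+
    ultimately have "E holomorphic_on ?A \<union> ?B" using Suc.IH by (intro holomorphic_on_Un)
    then show ?case
    proof (rule holomorphic_on_subset, intro subsetI)
      fix z assume z: "z \<in> {z. - a < Im z \<and> Im z < a + real (Suc k) * p}"
      have k: "0 \<le> real k * p" using p by simp
      show "z \<in> ?A \<union> ?B"
      proof (cases "p - a < Im z")
        case True
        then show ?thesis using z by blast
      next
        case False
        then have "Im z < a + real k * p" using p k by linarith
        then show ?thesis using z by blast
      qed
    qed
  qed
  have "E holomorphic_on {z. Im z > - a}"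
  proof (rule holomorphic_onI)
    fix z assume z: "z \<in> {z. Im z > - a}"
    obtain k :: nat where k: "(Im z - a) / p < real k" using reals_Archimedean2 by blast
    let ?A = "{z. - a < Im z \<and> Im z < a + real k * p}"
    have "z \<in> ?A" using z k p by (simp add: field_simps)
    moreover have "open ?A" by (intro open_Collect_conj open_Collect_less continuous_intros)
    ultimately have "E field_differentiable (at z)"
      using hol[of k] by (simp add: holomorphic_on_imp_differentiable_at)
    then show "E field_differentiable (at z within {z. Im z > - a})"
      by (rule field_differentiable_at_within)
  qed
  then show ?thesis using that EF by blast
qed

text \<open>The lower half is defined through reflection, so its poles are mirror images of the
  zeros of \<open>E\<close>. \<open>remove_sings\<close> then supplies the normalised
  values.\<close>

lemma nicely_meromorphic_reflection_extension:
  fixes F E :: "complex \<Rightarrow> complex" and a :: real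
  assumes a: "a > 0" and E: "E holomorphic_on {z. Im z > - a}"
    and F: "\<And>z. \<bar>Im z\<bar> < a \<Longrightarrow> E z = F z" and refl: "\<And>z. \<bar>Im z\<bar> < a \<Longrightarrow> F (- z) = inverse (F z)"
  obtains g where "g nicely_meromorphic_on UNIV" "\<And>z. \<bar>Im z\<bar> < a \<Longrightarrow> g z = F z"
proof -
  define g where "g = (\<lambda>z. if Im z > - a then E z else inverse (E (- z)))"
  have opens: "open {z. Im z > - a}" "open {z. Im z < a}"
    by (intro open_halfspace_Im_gt open_halfspace_Im_lt)+
  have gE: "g analytic_on {z. Im z > - a}"
  proof -
    have "g holomorphic_on {z. Im z > - a}"
      using E by (rule holomorphic_transform) (simp add: g_def)
    then show ?thesis using opens by (simp add: analytic_on_open)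
  qed
  have low: "g z = inverse (E (- z))" if "Im z < a" for z
    using that F[of z] F[of "- z"] refl[of z] by (auto simp: g_def abs_less_iff)
  have "(E \<circ> uminus) holomorphic_on {z. Im z < a}"
    by (rule holomorphic_on_compose_gen[OF holomorphic_on_minus[OF holomorphic_on_ident] E]) auto
  then have "(\<lambda>z. E (- z)) holomorphic_on {z. Im z < a}" by (simp add: o_def)
  then have "(\<lambda>z. inverse (E (- z))) meromorphic_on {z. Im z < a}"
    using opens by (intro meromorphic_intros analytic_on_imp_meromorphic_on) (simp add: analytic_on_open)
  also have "?this \<longleftrightarrow> g meromorphic_on {z. Im z < a}"
  proof (rule meromorphic_on_cong)
    fix z assume "z \<in> {z. Im z < a}"
    then have "eventually (\<lambda>w. w \<in> {z. Im z < a}) (at z)"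
      using opens by (intro eventually_at_in_open') auto
    then show "eventually (\<lambda>w. inverse (E (- w)) = g w) (at z)"
      by eventually_elim (simp add: low)
  qed simp
  finally have "g meromorphic_on {z. Im z > - a} \<union> {z. Im z < a}"
    by (rule meromorphic_on_Un[OF analytic_on_imp_meromorphic_on[OF gE]])
  moreover have "{z. Im z > - a} \<union> {z. Im z < a} = UNIV" using a by auto
  ultimately have "remove_sings g nicely_meromorphic_on UNIV"
    by (intro remove_sings_nicely_meromorphic) simp
  moreover have "remove_sings g z = F z" if "\<bar>Im z\<bar> < a" for z
  proof -
    have "g analytic_on {z}" using gE that by (auto intro: analytic_on_subset)
    moreover have "g z = F z" using F[OF that] that by (simp add: g_def abs_less_iff)
    ultimately show ?thesis by simp
  qed
  ultimately show ?thesis using that by blast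
qed

section \<open>Identity theorems for meromorphic functions\<close>

lemma meromorphic_eq_cosparse:
  fixes f g :: "complex \<Rightarrow> complex"
  assumes "f meromorphic_on UNIV" "g meromorphic_on UNIV" "open W" "W \<noteq> {}" "\<And>z. z \<in> W \<Longrightarrow> f z = g z"
  shows "eventually (\<lambda>z. f z = g z) (cosparse UNIV)"
proof -
  obtain w where w: "w \<in> W" using assms by blast
  have "(\<lambda>z. f z - g z) meromorphic_on UNIV" using assms by (intro meromorphic_intros)
  then consider "eventually (\<lambda>z. f z - g z = 0) (cosparse UNIV)" | "eventually (\<lambda>z. f z - g z \<noteq> 0) (cosparse UNIV)"
    using meromorphic_imp_constant_or_avoid[of _ UNIV 0] by blast
  then show ?thesis
  proof cases
    case 1
    then show ?thesis by (rule eventually_mono) simp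
  next
    case 2
    then have "eventually (\<lambda>z. f z - g z \<noteq> 0) (at w)"
      by (rule eventually_cosparse_imp_eventually_at) auto
    moreover have "eventually (\<lambda>z. z \<in> W) (at w)" using assms w by (intro eventually_at_in_open') auto
    ultimately have "eventually (\<lambda>z. False) (at w)"
      by eventually_elim (use assms(5) in auto)
    then show ?thesis by simp
  qed
qed

text \<open>Agreement off a sparse set gives the same poles and the same limits; a nicely
  meromorphic function is 0 at its poles and equals its limit elsewhere.\<close>

lemma nicely_meromorphic_eqI:
  fixes f g :: "complex \<Rightarrow> complex"
  assumes f: "f nicely_meromorphic_on UNIV" and g: "g nicely_meromorphic_on UNIV"
    and W: "open W" "W \<noteq> {}" "\<And>z. z \<in> W \<Longrightarrow> f z = g z"
  shows "f = g"
proof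
  fix z
  have "eventually (\<lambda>z. f z = g z) (cosparse UNIV)"
    using f g W by (intro meromorphic_eq_cosparse[of f g W]) (auto simp: nicely_meromorphic_on_def)
  then have ev: "eventually (\<lambda>w. f w = g w) (at z)"
    by (rule eventually_cosparse_imp_eventually_at) auto
  have pole: "is_pole f z \<longleftrightarrow> is_pole g z" by (rule is_pole_cong[OF ev refl])
  have f': "(is_pole f z \<and> f z = 0) \<or> f \<midarrow>z\<rightarrow> f z" and g': "(is_pole g z \<and> g z = 0) \<or> g \<midarrow>z\<rightarrow> g z"
    using f g by (auto simp: nicely_meromorphic_on_def)
  show "f z = g z"
  proof (cases "is_pole f z")
    case True
    have "\<not> f \<midarrow>z\<rightarrow> f z" "\<not> g \<midarrow>z\<rightarrow> g z"
      using True pole unfolding is_pole_def by (auto dest: not_tendsto_and_filterlim_at_infinity[rotated])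
    then show ?thesis using f' g' by auto
  next
    case False
    then have "f \<midarrow>z\<rightarrow> f z" "g \<midarrow>z\<rightarrow> g z" using f' g' pole by auto
    moreover have "f \<midarrow>z\<rightarrow> g z" using tendsto_cong[OF ev] \<open>g \<midarrow>z\<rightarrow> g z\<close> by blast
    ultimately show ?thesis using LIM_unique by blast
  qed
qed

lemma nicely_meromorphic_minus:
  assumes "f nicely_meromorphic_on UNIV"
  shows "(\<lambda>z. f (- z)) nicely_meromorphic_on UNIV"
  unfolding nicely_meromorphic_on_def
proof (intro conjI ballI)
  show "(\<lambda>z. f (- z)) meromorphic_on UNIV"
    by (rule meromorphic_on_compose[of f UNIV]) (use assms in \<open>auto simp: nicely_meromorphic_on_def intro!: analytic_intros\<close>)
  fix z :: complex
  have lim: "filterlim uminus (at (- z)) (at z)"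
    by (rule filterlim_atI[OF tendsto_minus[OF tendsto_ident_at]])
       (simp add: eventually_at_filter always_eventually)
  have "(is_pole f (- z) \<and> f (- z) = 0) \<or> f \<midarrow>- z\<rightarrow> f (- z)"
    using assms by (auto simp: nicely_meromorphic_on_def)
  then show "(is_pole (\<lambda>z. f (- z)) z \<and> f (- z) = 0) \<or> (\<lambda>z. f (- z)) \<midarrow>z\<rightarrow> f (- z)"
    unfolding is_pole_def using filterlim_compose[OF _ lim, of f] by blast
qed

section \<open>Kernel identities\<close>

definition is_hypG :: "real \<Rightarrow> real \<Rightarrow> (complex \<Rightarrow> complex) \<Rightarrow> bool" where
  "is_hypG ap am g \<longleftrightarrow> g nicely_meromorphic_on UNIV \<and> (\<forall>z. \<bar>Im z\<bar> < ahalf ap am \<longrightarrow> g z = G_strip ap am z)"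

lemma is_hypG_hypG:
  assumes pos: "ap > 0" "am > 0"
  shows "is_hypG ap am (hypG ap am)"
proof -
  define a where "a = ahalf ap am"
  have a: "a > 0" "ap < 2 * a" "a - ap / 2 = am / 2" using pos by (auto simp: a_def ahalf_def field_simps)
  define F where "F = (\<lambda>z. exp (\<i> * G_exponent ap am z))"
  have strip: "G_strip_set ap am = {z. \<bar>Im z\<bar> < a}" by (simp add: G_strip_set_def a_def)
  have GF: "G_strip ap am z = F z" if "\<bar>Im z\<bar> < a" for z
    unfolding F_def using that by (intro G_strip_eq[OF pos]) (simp add: strip)
  have "F holomorphic_on {z. \<bar>Im z\<bar> < a}"
    unfolding F_def using holomorphic_G_exponent[OF pos] by (intro holomorphic_intros) (simp add: strip)
  moreover have "(\<lambda>w. 2 * cosh (of_real pi * (w / complex_of_real am))) holomorphic_on UNIV"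
    unfolding cosh_def using pos by (intro holomorphic_intros) auto
  \<comment> \<open>The continuation uses steps of length \<open>ap\<close>, hence the parameters in
    the order \<open>am\<close>, \<open>ap\<close>; the equation then holds for
    \<open>\<bar>Im w\<bar> < am / 2\<close>, which is \<open>a - ap / 2\<close>.\<close>
  moreover have "F (w + \<i> * of_real ap / 2) = 2 * cosh (of_real pi * (w / complex_of_real am)) * F (w - \<i> * of_real ap / 2)"
    if "\<bar>Im w\<bar> < a - ap / 2" for w
    unfolding F_def G_exponent_commute[of ap am]
    by (rule G_strip_difference) (use pos that a in auto)
  ultimately obtain E where E: "E holomorphic_on {z. Im z > - a}" "\<And>z. \<bar>Im z\<bar> < a \<Longrightarrow> E z = F z"
    using holomorphic_upper_extension[OF pos(1) a(2)] by blast
  have "F (- z) = inverse (F z)" for z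
    by (simp add: F_def G_exponent_minus exp_minus)
  then obtain g where g: "g nicely_meromorphic_on UNIV" "\<And>z. \<bar>Im z\<bar> < a \<Longrightarrow> g z = F z"
    using nicely_meromorphic_reflection_extension[OF a(1) E] by blast
  have "is_hypG ap am g" using g GF by (simp add: is_hypG_def a_def)
  moreover have "h = g" if "is_hypG ap am h" for h
  proof (rule nicely_meromorphic_eqI[of h g "{z. \<bar>Im z\<bar> < a}"])
    show "open {z. \<bar>Im z\<bar> < a}" using open_G_strip_set[of ap am] by (simp add: strip)
    show "{z. \<bar>Im z\<bar> < a} \<noteq> {}" using a by (auto intro: exI[of _ 0])
  qed (use that g GF in \<open>auto simp: is_hypG_def a_def\<close>)
  ultimately have "is_hypG ap am (THE g. is_hypG ap am g)" by (rule theI)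
  then show ?thesis unfolding hypG_def is_hypG_def .
qed

lemma hypG_strip:
  assumes "ap > 0" "am > 0" "\<bar>Im z\<bar> < ahalf ap am"
  shows "hypG ap am z = exp (\<i> * G_exponent ap am z)"
  using is_hypG_hypG[OF assms(1,2)] G_strip_eq[OF assms(1,2), of z] assms(3)
  by (simp add: is_hypG_def G_strip_set_def)

text \<open>No exceptional points remain: poles carry the value 0, and \<open>inverse 0 = 0\<close>
  matches them with zeros at the reflected points.\<close>

lemma hypG_minus:
  assumes "ap > 0" "am > 0"
  shows "hypG ap am (- z) = inverse (hypG ap am z)"
proof -
  have nice: "hypG ap am nicely_meromorphic_on UNIV"
    using is_hypG_hypG[OF assms] by (simp add: is_hypG_def)
  have "(\<lambda>z. hypG ap am (- z)) = (\<lambda>z. inverse (hypG ap am z))"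
  proof (rule nicely_meromorphic_eqI[OF nicely_meromorphic_minus[OF nice] nicely_meromorphic_on_inverse[OF nice] open_G_strip_set])
    show "G_strip_set ap am \<noteq> {}" using assms by (auto simp: G_strip_set_def ahalf_def intro: exI[of _ 0])
    show "hypG ap am (- z) = inverse (hypG ap am z)" if "z \<in> G_strip_set ap am" for z
      using that assms by (simp add: hypG_strip G_strip_set_def G_exponent_minus exp_minus)
  qed
  then show ?thesis by (simp add: fun_eq_iff)
qed

lemma G_R_eq_inverse_G_L:
  assumes "ap > 0" "am > 0"
  shows "G_R ap am z = 1 / G_L ap am (- z)"
proof -
  have "- \<i> * of_real (chi ap am) - \<i> * of_real pi * (- z)\<^sup>2 / of_real (2 * ap * am)
      = - (\<i> * of_real (chi ap am) + \<i> * of_real pi * z\<^sup>2 / of_real (2 * ap * am))" by simp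
  then show ?thesis
    unfolding G_R_def G_L_def hypG_minus[OF assms] by (simp only: exp_minus) (simp add: divide_simps)
qed

section \<open>The difference equation of \<open>G_L\<close>\<close>

lemma G_exponent_adelta: "G_exponent (adelta ap am d) (adelta ap am (\<not> d)) = G_exponent ap am"
  by (cases d) (simp_all add: adelta_def G_exponent_commute[of am ap])

lemma G_L_nz_strip:
  assumes "ap > 0" "am > 0" "\<bar>Im z\<bar> < ahalf ap am"
  shows "G_L ap am z \<noteq> 0"
  by (simp add: G_L_def hypG_strip[OF assms])

lemma meromorphic_G_L:
  assumes "ap > 0" "am > 0"
  shows "G_L ap am meromorphic_on UNIV"
proof -
  have "hypG ap am meromorphic_on UNIV"
    using is_hypG_hypG[OF assms] by (simp add: is_hypG_def nicely_meromorphic_on_def)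
  moreover have "(\<lambda>z. exp (- \<i> * of_real (chi ap am) - \<i> * of_real pi * z\<^sup>2 / of_real (2 * ap * am))) meromorphic_on UNIV"
    using assms by (intro analytic_on_imp_meromorphic_on analytic_intros) auto
  ultimately show ?thesis
    unfolding G_L_def[abs_def] by (rule meromorphic_on_mult)
qed

lemma eventually_cosparse_translate:
  assumes "eventually P (cosparse (UNIV :: complex set))"
  shows "eventually (\<lambda>w. P (w + k)) (cosparse UNIV)"
proof -
  have "eventually (\<lambda>w. P (w + k)) (at z)" for z
  proof -
    have "eventually P (at (z + k))"
      using assms by (rule eventually_cosparse_imp_eventually_at) auto
    moreover have "filterlim (\<lambda>w. w + k) (at (z + k)) (at z)"
      by (rule filterlim_atI) (auto intro!: tendsto_intros simp: eventually_at_filter)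
    ultimately show ?thesis by (rule eventually_compose_filterlim)
  qed
  then show ?thesis by (simp add: eventually_cosparse_open_eq)
qed

text \<open>With \<open>z\<close> the midpoint of the step and \<open>u = pi * z / r\<close>, the
  Gaussian factor of \<open>G_L\<close> changes by exactly \<open>exp u\<close>, and
  \<open>2 * cosh u * exp u = 1 + exp (2 * u)\<close>.\<close>

lemma G_L_shift:
  assumes pos: "ap > 0" "am > 0" and r: "r = adelta ap am d" and b: "b = adelta ap am (\<not> d)"
    and w: "\<bar>Im w + b / 2\<bar> < r / 2"
  shows "G_L ap am (w + \<i> * of_real b) = (1 + exp (of_real pi * (2 * w + \<i> * of_real b) / of_real r)) * G_L ap am w"
proof -
  have rb: "r > 0" "b > 0" "ap * am = r * b" "ahalf ap am = (r + b) / 2"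
    using pos by (auto simp: r b adelta_def ahalf_def)
  define z where "z = w + \<i> * of_real b / 2"
  have Imz: "Im z = Im w + b / 2" by (simp add: z_def)
  have zw: "z + \<i> * of_real b / 2 = w + \<i> * of_real b" "z - \<i> * of_real b / 2 = w"
    by (simp_all add: z_def)
  have inG: "\<bar>Im (w + \<i> * of_real b)\<bar> < ahalf ap am" "\<bar>Im w\<bar> < ahalf ap am"
  proof -
    have w': "Im w + b / 2 < r / 2" "- (Im w + b / 2) < r / 2" using w by (simp_all only: abs_less_iff)
    have Im: "Im (w + \<i> * of_real b) = Im w + b" by simp
    show "\<bar>Im (w + \<i> * of_real b)\<bar> < ahalf ap am"
      unfolding rb(4) abs_less_iff Im by (rule conjI) (use w' rb(1,2) in \<open>simp_all add: field_simps\<close>)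
    show "\<bar>Im w\<bar> < ahalf ap am"
      unfolding rb(4) abs_less_iff by (rule conjI) (use w' rb(1,2) in \<open>simp_all add: field_simps\<close>)
  qed
  have G: "hypG ap am (w + \<i> * of_real b) = 2 * cosh (of_real pi * (z / of_real r)) * hypG ap am w"
    unfolding hypG_strip[OF pos inG(1)] hypG_strip[OF pos inG(2)] G_exponent_adelta[symmetric, of ap am d] r[symmetric] b[symmetric]
    using G_strip_difference[OF rb(1,2), of z] w unfolding zw Imz by simp
  define u where "u = of_real pi * (z / complex_of_real r)"
  have nz: "complex_of_real r \<noteq> 0" "complex_of_real b \<noteq> 0" using rb by auto
  have e: "- \<i> * of_real (chi ap am) - \<i> * of_real pi * (w + \<i> * of_real b)\<^sup>2 / of_real (2 * ap * am)
     = u + (- \<i> * of_real (chi ap am) - \<i> * of_real pi * w\<^sup>2 / of_real (2 * ap * am))"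
  proof -
    have "(w + \<i> * of_real b)\<^sup>2 = w\<^sup>2 + 2 * \<i> * of_real b * z"
      by (simp add: z_def power2_eq_square algebra_simps)
    moreover have "complex_of_real (2 * ap * am) = 2 * of_real r * of_real b"
    proof -
      have "2 * ap * am = 2 * r * b" using rb(3) by (simp add: mult.assoc)
      then show ?thesis by (simp only: of_real_mult of_real_numeral)
    qed
    moreover have "\<i> * of_real pi * (2 * \<i> * of_real b * z) / (2 * of_real r * of_real b) = - u"
      using nz by (simp add: u_def field_simps)
    ultimately show ?thesis by (simp add: distrib_left add_divide_distrib)
  qed
  have ch: "2 * cosh u * exp u = 1 + exp (of_real pi * (2 * w + \<i> * of_real b) / of_real r)"
  proof -
    have "of_real pi * (2 * w + \<i> * of_real b) / of_real r = u + u"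
      using nz by (simp add: u_def z_def field_simps)
    moreover have "exp (- u) * exp u = 1" by (simp add: mult_exp_exp)
    moreover have "2 * cosh u = exp u + exp (- u)" by (simp add: cosh_field_def)
    ultimately show ?thesis by (simp only: distrib_right exp_add add.commute)
  qed
  have "G_L ap am (w + \<i> * of_real b) = (2 * cosh u * exp u) * G_L ap am w"
    unfolding G_L_def e exp_add G u_def[symmetric] by (simp only: mult_ac)
  then show ?thesis unfolding ch .
qed

lemma eventually_shift_regular_G_L:
  assumes pos: "ap > 0" "am > 0"
  shows "eventually (shift_regular (G_L ap am) (adelta ap am d) (\<i> * of_real (adelta ap am (\<not> d)))) (cosparse UNIV)"
proof -
  define r b where "r = adelta ap am d" and "b = adelta ap am (\<not> d)"
  define c where "c = \<i> * complex_of_real b"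
  have rb: "r > 0" "b > 0" using pos by (auto simp: r_def b_def adelta_def)
  note mero = meromorphic_G_L[OF pos]
  \<comment> \<open>In this strip, centred at \<open>- \<i> * b / 2\<close>, both \<open>w\<close>
    and \<open>w + c\<close> lie where \<open>hypG\<close> is given by its integral.\<close>
  have openW: "open {w. \<bar>Im w + b / 2\<bar> < r / 2}"
    by (intro open_Collect_less continuous_intros)
  have "- \<i> * of_real b / 2 \<in> {w. \<bar>Im w + b / 2\<bar> < r / 2}" using rb by simp
  then have nonemptyW: "{w. \<bar>Im w + b / 2\<bar> < r / 2} \<noteq> {}" by blast
  have diff: "eventually (\<lambda>w. G_L ap am (w + c) = (1 + exp (of_real pi * (2 * w + c) / of_real r)) * G_L ap am w) (cosparse UNIV)"
  proof (rule meromorphic_eq_cosparse[OF _ _ openW nonemptyW])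
    show "(\<lambda>w. G_L ap am (w + c)) meromorphic_on UNIV"
      by (rule meromorphic_on_compose[OF mero]) (auto intro!: analytic_intros)
    have "(\<lambda>w. 1 + exp (of_real pi * (2 * w + c) / of_real r)) meromorphic_on UNIV"
      using rb by (intro analytic_on_imp_meromorphic_on analytic_intros) auto
    then show "(\<lambda>w. (1 + exp (of_real pi * (2 * w + c) / of_real r)) * G_L ap am w) meromorphic_on UNIV"
      using mero by (rule meromorphic_on_mult)
  qed (use G_L_shift[OF pos r_def b_def] in \<open>auto simp: c_def\<close>)
  have nz: "eventually (\<lambda>w. G_L ap am w \<noteq> 0) (cosparse UNIV)"
  proof -
    have "\<not> eventually (\<lambda>w. G_L ap am w = 0) (cosparse UNIV)"
    proof
      assume "eventually (\<lambda>w. G_L ap am w = 0) (cosparse UNIV)"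
      then have "eventually (\<lambda>w. G_L ap am w = 0) (at 0)"
        by (rule eventually_cosparse_imp_eventually_at) auto
      moreover have "eventually (\<lambda>w. w \<in> G_strip_set ap am) (at 0)"
        using pos by (intro eventually_at_in_open' open_G_strip_set) (simp add: G_strip_set_def ahalf_def)
      ultimately have "eventually (\<lambda>w::complex. False) (at 0)"
        by eventually_elim (use G_L_nz_strip[OF pos] in \<open>auto simp: G_strip_set_def\<close>)
      then show False by simp
    qed
    then show ?thesis
      using meromorphic_imp_constant_or_avoid[OF mero open_UNIV connected_UNIV, of 0] by blast
  qed
  have "eventually (\<lambda>w. G_L ap am w = (1 + exp (of_real pi * (2 * w - c) / of_real r)) * G_L ap am (w - c)) (cosparse UNIV)"
    using eventually_cosparse_translate[OF diff, of "- c"]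
    by (rule eventually_mono) (simp add: algebra_simps)
  moreover have "eventually (\<lambda>w. G_L ap am (w + c) \<noteq> 0) (cosparse UNIV)"
    by (rule eventually_cosparse_translate[OF nz])
  moreover have "eventually (\<lambda>w. G_L ap am (w - c) \<noteq> 0) (cosparse UNIV)"
    using eventually_cosparse_translate[OF nz, of "- c"] by simp
  ultimately have "eventually (shift_regular (G_L ap am) r c) (cosparse UNIV)"
    using diff nz unfolding shift_regular_def by eventually_elim blast
  then show ?thesis unfolding r_def b_def c_def .
qed

theorem theorem2p7:
  fixes N :: nat and ap am eta :: real and d :: bool and l :: int
    and sq :: "(nat \<Rightarrow> complex) \<Rightarrow> complex"
  assumes "ap > 0" and "am > 0"
    and "l \<noteq> 0" and "\<bar>l\<bar> \<le> int N"
    and "\<forall>x. (sq x)\<^sup>2 = Ufun N ap am eta x"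
  shows "kernel_identities sq N ap am eta d l
           (Splus N ap am eta) (Sminus N ap am eta)
       \<and> kernel_identities sq N ap am eta d l
           (\<lambda>x y. Splus N ap am eta y x) (\<lambda>x y. Sminus N ap am eta y x)
       \<and> (\<forall>j. kernel_identities sq N ap am eta d l
           (\<lambda>x y. Splus N ap am eta (rot N j x) y) (\<lambda>x y. Sminus N ap am eta (rot N j x) y))"
proof (rule kernel_identities_all[OF assms])
  show "G_R ap am z = 1 / G_L ap am (- z)" for z
    by (rule G_R_eq_inverse_G_L[OF assms(1,2)])
  show "eventually (shift_regular (G_L ap am) (adelta ap am d) (\<i> * of_real (adelta ap am (\<not> d)))) (cosparse UNIV)"
    by (rule eventually_shift_regular_G_L[OF assms(1,2)])
  \<comment> \<open>\<open>eta\<close> is real, so it lies in the strip, where \<open>hypG\<close>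
    is an exponential.\<close>
  show "G_L ap am (of_real eta) \<noteq> 0"
    using assms by (intro G_L_nz_strip) (simp_all add: ahalf_def)
qed

end
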